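(* Let $X$ be a symmetric transient Borel right process with state space $\mathbb N$ and strictly positive potential density $U=\{U_{j,k}\}_{j,k\in\mathbb N}$, let $f=\{f_k\}_{k\in\mathbb N}$ be a finite excessive function for $X$, and for $\alpha>0$ let $\widetilde X_\alpha=\{\widetilde X_{\alpha,j}\}_{j\in\mathbb N}$ be an $\alpha$-permanental sequence with kernel $\widetilde U_{j,k}=U_{j,k}+f_k$, $j,k\in\mathbb N$. Let $\eta=\{\eta_j\}_{j\in\mathbb N}$ be a mean zero Gaussian sequence with covariance $U$. Then for all $l\ge 0$, $n\ge 1$, $$\sum_{k=1}^{n}(U(l,n))^{j,k}f_{k+l}\ge 0,\qquad j=1,\dots,n.$$ Suppose, in addition, that $$\sum_{j,k=1}^{n}(U(l,n))^{j,k}f_{k+l}=o_l(1),\quad\text{uniformly in } n,$$ and that there exists a sequence of positive numbers $\phi=\{\phi_j\}_{j\in\mathbb N}$ such that $$\limsup_{j\to\infty}\frac{\eta_j}{(2\phi_j)^{1/2}}=1\quad\text{a.s.}\qquad\text{and}\qquad f_j=o(\phi_j)\ \text{ as } j\to\infty.$$ Then $$\limsup_{j\to\infty}\frac{\widetilde X_{\alpha,j}}{\phi_j}=1\quad\text{a.s.}$$ for all $\alpha\ge 1/2$. (Also, the upper bound $\limsup_{j\to\infty}\widetilde X_{\alpha,j}/\phi_j\le 1$ a.s. holds for all $\alpha>0$.)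
   Context: $\mathbb N=\{1,2,\dots\}$. Permanental sequences: for $\alpha>0$ and a matrix $K=\{K_{j,k}\}_{j,k\in\mathbb N}$, an $\alpha$-permanental sequence with kernel $K$ is a sequence $\{Z_j\}_{j\in\mathbb N}$ of non-negative random variables such that for all $n$, all distinct $i_1,\dots,i_n\in\mathbb N$ and all $s_1,\dots,s_n>0$, $E\exp(-\sum_{m=1}^n s_mZ_{i_m})=\det(I+K'S)^{-\alpha}$, where $K'=\{K_{i_p,i_q}\}_{p,q=1}^n$ and $S=\mathrm{diag}(s_1,\dots,s_n)$. Processes: a Borel right process $X$ on the countable discrete space $\mathbb N$ is a continuous-time right-continuous strong Markov process (possibly sent to a cemetery state at a finite lifetime) with transition functions $p_t(j,k)$ and semigroup $P_t$. Its potential density (with respect to counting measure) is $U_{j,k}=\int_0^\infty p_t(j,k)\,dt$; $X$ is transient if these are finite and symmetric if $p_t(j,k)=p_t(k,j)$. A non-negative function $f$ on $\mathbb N$ is excessive for $X$ if $P_tf(j)\uparrow f(j)$ as $t\downarrow 0$ for all $j$. It is a known fact that for such $X$ and finite excessive $f$, $\{U_{j,k}+f_k\}$ is the kernel of an $\alpha$-permanental sequence for every $\alpha>0$. Matrix notation: $U(l,n)$ is the $n\times n$ matrix with entries $U(l,n)_{j,k}=U_{l+j,l+k}$, $j,k=1,\dots,n$ (it is known to be invertible), and for an invertible matrix $M$, $M^{j,k}$ denotes $(M^{-1})_{j,k}$. The notation $o_l(1)$, uniformly in $n$, means a quantity whose supremum over $n$ of its absolute value tends to $0$ as $l\to\infty$.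 *)

theory Defs
  imports
    "HOL-Probability.Probability"
    "HOL-Library.Landau_Symbols"
    "Jordan_Normal_Form.Gauss_Jordan_Elimination"
    "Jordan_Normal_Form.Determinant"
begin

text \<open>
  The state space \<open>{1, 2, \<dots>}\<close> is represented by the type \<^typ>\<open>nat\<close>, the state \<open>j\<close> of the
  mathematical text being the number \<open>j - 1\<close> here.  All indices are shifted in the same way,
  so that \<open>j = 1, \<dots>, n\<close> becomes \<open>j < n\<close>.  The cemetery state is \<^term>\<open>None\<close>.
\<close>

definition transition ::
  "(nat \<Rightarrow> 'w measure) \<Rightarrow> (real \<Rightarrow> 'w \<Rightarrow> nat option) \<Rightarrow> real \<Rightarrow> nat \<Rightarrow> nat \<Rightarrow> real" where
  "transition P X t j k = measure (P j) {\<omega> \<in> space (P j). X t \<omega> = Some k}"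

definition semigroup_op ::
  "(nat \<Rightarrow> 'w measure) \<Rightarrow> (real \<Rightarrow> 'w \<Rightarrow> nat option) \<Rightarrow> real \<Rightarrow> (nat \<Rightarrow> ennreal) \<Rightarrow> nat \<Rightarrow> ennreal"
where
  "semigroup_op P X t f j = (\<Sum>k. ennreal (transition P X t j k) * f k)"

text \<open>
  The law of the process started in \<open>j\<close> is \<open>P j\<close>, and \<open>F\<close> is the filtration, whose index set
  includes \<open>\<infinity>\<close>.  Right continuity of the paths is with respect to the discrete topology; as the
  cemetery is absorbing, it does not matter whether it is adjoined as an isolated point or as the
  point at infinity.  In the strong Markov property, functions on the state space are extended
  by \<open>0\<close> to the cemetery.
\<close>

locale borel_right_process = filtration \<Omega> F
  for \<Omega> :: "'w set" and F :: "ennreal \<Rightarrow> 'w measure" +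
  fixes P :: "nat \<Rightarrow> 'w measure" and X :: "real \<Rightarrow> 'w \<Rightarrow> nat option"
  assumes prob_space_P: "prob_space (P j)"
    and sets_P: "sets (P i) = sets (P j)"
    and subalgebra_F: "subalgebra (P j) (F u)"
    and F_right_continuous:
      "0 \<le> t \<Longrightarrow> sets (F (ennreal t)) = (\<Inter>s\<in>{t<..}. sets (F (ennreal s)))"
    and adapted: "0 \<le> t \<Longrightarrow> X t \<in> F (ennreal t) \<rightarrow>\<^sub>M count_space UNIV"
    and start: "AE \<omega> in P j. X 0 \<omega> = Some j"
    and paths_right_continuous:
      "0 \<le> t \<Longrightarrow> \<omega> \<in> \<Omega> \<Longrightarrow> \<forall>\<^sub>F s in at_right t. X s \<omega> = X t \<omega>"
    and cemetery_absorbing: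
      "0 \<le> s \<Longrightarrow> s \<le> t \<Longrightarrow> \<omega> \<in> \<Omega> \<Longrightarrow> X s \<omega> = None \<Longrightarrow> X t \<omega> = None"
    and strong_markov:
      "stopping_time F T \<Longrightarrow> A \<in> sets (pre_sigma T) \<Longrightarrow> 0 \<le> t \<Longrightarrow>
        emeasure (P j) {\<omega> \<in> A. T \<omega> < \<infinity> \<and> X (enn2real (T \<omega>) + t) \<omega> = Some k} =
        (\<integral>\<^sup>+\<omega>\<in>{\<omega> \<in> A. T \<omega> < \<infinity>}.
            (case X (enn2real (T \<omega>)) \<omega> of
               None \<Rightarrow> 0
             | Some i \<Rightarrow> ennreal (transition P X t i k)) \<partial>P j)"

definition symmetric_process ::
  "(nat \<Rightarrow> 'w measure) \<Rightarrow> (real \<Rightarrow> 'w \<Rightarrow> nat option) \<Rightarrow> bool" where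
  "symmetric_process P X \<longleftrightarrow> (\<forall>t\<ge>0. \<forall>j k. transition P X t j k = transition P X t k j)"

definition potential_ennreal ::
  "(nat \<Rightarrow> 'w measure) \<Rightarrow> (real \<Rightarrow> 'w \<Rightarrow> nat option) \<Rightarrow> nat \<Rightarrow> nat \<Rightarrow> ennreal" where
  "potential_ennreal P X j k = (\<integral>\<^sup>+t\<in>{0..}. ennreal (transition P X t j k) \<partial>lborel)"

definition transient_process ::
  "(nat \<Rightarrow> 'w measure) \<Rightarrow> (real \<Rightarrow> 'w \<Rightarrow> nat option) \<Rightarrow> bool" where
  "transient_process P X \<longleftrightarrow> (\<forall>j k. potential_ennreal P X j k < \<infinity>)"

definition potential_density ::
  "(nat \<Rightarrow> 'w measure) \<Rightarrow> (real \<Rightarrow> 'w \<Rightarrow> nat option) \<Rightarrow> nat \<Rightarrow> nat \<Rightarrow> real" where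
  "potential_density P X j k = enn2real (potential_ennreal P X j k)"

definition excessive ::
  "(nat \<Rightarrow> 'w measure) \<Rightarrow> (real \<Rightarrow> 'w \<Rightarrow> nat option) \<Rightarrow> (nat \<Rightarrow> ennreal) \<Rightarrow> bool" where
  "excessive P X f \<longleftrightarrow>
     (\<forall>j. antimono_on {0<..} (\<lambda>t. semigroup_op P X t f j) \<and>
          ((\<lambda>t. semigroup_op P X t f j) \<longlongrightarrow> f j) (at_right 0))"

text \<open>
  No positivity of the determinant has to be required: the expectation is positive, while
  \<open>0 powr _ = 0\<close>, so the determinant does not vanish for any admissible \<open>s\<close>; as it tends to
  \<open>1\<close> when \<open>s\<close> tends to \<open>0\<close>, it is positive.
\<close>

definition permanental_sequence ::
  "'c measure \<Rightarrow> real \<Rightarrow> (nat \<Rightarrow> nat \<Rightarrow> real) \<Rightarrow> (nat \<Rightarrow> 'c \<Rightarrow> real) \<Rightarrow> bool" where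
  "permanental_sequence Q \<alpha> K Z \<longleftrightarrow>
     prob_space Q \<and>
     (\<forall>j. Z j \<in> borel_measurable Q \<and> (AE \<omega> in Q. 0 \<le> Z j \<omega>)) \<and>
     (\<forall>n i s. inj_on i {..<n} \<and> (\<forall>m<n. 0 < s m) \<longrightarrow>
        (\<integral>\<omega>. exp (- (\<Sum>m<n. s m * Z (i m) \<omega>)) \<partial>Q) =
        Determinant.det (1\<^sub>m n + Matrix.mat n n (\<lambda>(p, q). K (i p) (i q)) * mat_diag n s)
          powr (- \<alpha>))"

definition gaussian_variable :: "'a measure \<Rightarrow> ('a \<Rightarrow> real) \<Rightarrow> bool" where
  "gaussian_variable N Y \<longleftrightarrow>
     Y \<in> borel_measurable N \<and>
     ((\<exists>\<mu> \<sigma>. 0 < \<sigma> \<and> distributed N lborel Y (\<lambda>x. ennreal (normal_density \<mu> \<sigma> x))) \<or>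
      (\<exists>\<mu>. AE \<omega> in N. Y \<omega> = \<mu>))"

definition centered_gaussian_sequence ::
  "'a measure \<Rightarrow> (nat \<Rightarrow> nat \<Rightarrow> real) \<Rightarrow> (nat \<Rightarrow> 'a \<Rightarrow> real) \<Rightarrow> bool" where
  "centered_gaussian_sequence N C \<eta> \<longleftrightarrow>
     prob_space N \<and>
     (\<forall>n a. gaussian_variable N (\<lambda>\<omega>. \<Sum>j<n. a j * \<eta> j \<omega>)) \<and>
     (\<forall>j. (\<integral>\<omega>. \<eta> j \<omega> \<partial>N) = 0) \<and>
     (\<forall>j k. (\<integral>\<omega>. \<eta> j \<omega> * \<eta> k \<omega> \<partial>N) = C j k)"

text \<open>The matrix \<open>U(l,n)\<close> and the entries of its inverse.\<close>

definition block :: "(nat \<Rightarrow> nat \<Rightarrow> real) \<Rightarrow> nat \<Rightarrow> nat \<Rightarrow> real mat" where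
  "block U l n = Matrix.mat n n (\<lambda>(j, k). U (l + j) (l + k))"

definition inv_entry :: "real mat \<Rightarrow> nat \<Rightarrow> nat \<Rightarrow> real" where
  "inv_entry M j k = the (mat_inverse M) $$ (j, k)"

text \<open>\<open>a l n = o\<^sub>l(1)\<close> uniformly in \<open>n \<ge> 1\<close>\<close>

definition little_o_one_uniformly :: "(nat \<Rightarrow> nat \<Rightarrow> real) \<Rightarrow> bool" where
  "little_o_one_uniformly a \<longleftrightarrow> (\<lambda>l. SUP n\<in>{1..}. ereal \<bar>a l n\<bar>) \<longlonglongrightarrow> 0"

end

theory Submission
  imports Defs "HOL-Real_Asymp.Real_Asymp"
begin

text \<open>
  Write \<open>A\<close> for the inverse of a block \<open>U(l,n)\<close>.  A maximum principle for the discrete resolvent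
  kernels \<open>\<lambda>U\<^sup>\<lambda>\<close> shows that \<open>A v \<ge> 0\<close> for every finite excessive \<open>v\<close> and that \<open>A\<close> has
  non-positive off-diagonal entries.  With \<open>\<rho> = 1\<^sup>T A f\<close> and \<open>S\<close> the diagonal matrix of
  Laplace variables, \<open>det (I + (U + 1 f\<^sup>T) S) / det U\<close> is the determinant of \<open>A + S\<close> bordered by
  \<open>- A 1\<close>, \<open>- A f\<close> and \<open>1 + \<rho>\<close>.  Gaussian elimination and the binomial series, whose terms are
  non-negative because all off-diagonal entries are non-positive, show that
  \<open>det (I + (U + 1 f\<^sup>T) S)\<^sup>-\<^sup>\<alpha> - (1 + \<rho>)\<^sup>-\<^sup>\<alpha> det (I + U S)\<^sup>-\<^sup>\<alpha>\<close>
  is the Laplace transform of a positive measure.  As the total mass of this measure is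
  \<open>1 - (1 + \<rho>)\<^sup>-\<^sup>\<alpha>\<close>, which tends to \<open>0\<close>, the permanental sequence with kernel \<open>U + 1 f\<^sup>T\<close> is close in
  total variation to the one with kernel \<open>U\<close> on every block.  The latter is increasing
  in \<open>\<alpha>\<close> in distribution, and for \<open>\<alpha> = m / 2\<close> it is half the sum of the squares of \<open>m\<close> independent
  copies of \<open>\<eta>\<close>; a finite net of the unit sphere and rotation invariance reduce its upper
  tails to those of \<open>\<eta>\<close>.
\<close>

section \<open>Transition probabilities and resolvents\<close>

text \<open>The maximum principle concerns discrete Green kernels, while \<open>U\<close> is the
  potential of a process in continuous time. If \<open>V_e\<close> is its resolvent, however,
  \<open>I + \<lambda> V_e\<close> is the Green kernel of
  \<open>R = \<lambda> V_(\<lambda>+e)\<close>, by the resolvent equation, and the rows of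
  \<open>R\<close> sum to at most \<lambda> / (\<lambda> + e) < 1. The signs are therefore proved
  for inverses of blocks of \<open>V_e + I / \<lambda>\<close> and survive the limit e \<rightarrow>
  0, \<lambda> \<rightarrow> \<infinity>. The kernel \<open>U + 1 f\<^sup>T\<close> is not symmetric
  in general, so no Gaussian sequence stands behind it; positivity has to come from the algebra of
  Laplace transforms. Transforms are used to compare measures on rectangles
  \<open>{z. \<forall>i<n. z i \<le> c i}\<close>, and these suffice: the tail events behind a
  limsup are monotone limits of such events or of their complements. The error
  \<open>1 - (1 + \<rho>)\<^sup>-\<^sup>\<alpha>\<close> is uniform in the thresholds and, by
  hypothesis, in the length of the block. The restriction \<alpha> \<ge> 1/2 in the lower bound is
  the range in which the sequence with kernel \<open>U\<close> dominates
  \<open>\<eta>\<^sup>2 / 2\<close>; for the upper bound any m with \<alpha> \<le> m/2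
  serves.\<close>

lemma right_continuous_borel:
  fixes g :: "real \<Rightarrow> real"
  assumes rc: "\<And>t. 0 \<le> t \<Longrightarrow> (g \<longlongrightarrow> g t) (at_right t)"
  shows "(\<lambda>t. indicator {0..} t * g t) \<in> borel_measurable borel"
proof (rule borel_measurable_LIMSEQ_real)
  \<comment> \<open>\<open>?u n t\<close> is the least multiple of \<open>1 / (n + 1)\<close>
    strictly above \<open>t\<close>. Strictness lets right continuity apply, and for fixed
    \<open>n\<close> only countably many values of \<open>g\<close> occur, which gives
    measurability.\<close>
  let ?u = "\<lambda>n t. (real_of_int \<lfloor>real (Suc n) * t\<rfloor> + 1) / real (Suc n)"
  show "(\<lambda>n. indicator {0..} t * g (?u n t)) \<longlonglongrightarrow> indicator {0..} t * g t" for t :: real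
  proof (cases "0 \<le> t")
    case True
    have gt: "t < ?u n t" for n
    proof -
      have "real (Suc n) * t < real_of_int \<lfloor>real (Suc n) * t\<rfloor> + 1" by linarith
      then show ?thesis by (simp add: field_simps)
    qed
    have le: "?u n t \<le> t + 1 / real (Suc n)" for n
    proof -
      have "real_of_int \<lfloor>real (Suc n) * t\<rfloor> + 1 \<le> real (Suc n) * t + 1" by linarith
      then have "?u n t \<le> (real (Suc n) * t + 1) / real (Suc n)"
        by (rule divide_right_mono) simp
      also have "\<dots> = t + 1 / real (Suc n)" by (simp add: field_simps)
      finally show ?thesis .
    qed
    have l1: "(\<lambda>n. t + 1 / real (Suc n)) \<longlonglongrightarrow> t"
      using tendsto_add[OF tendsto_const LIMSEQ_Suc[OF lim_1_over_n]] by simp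
    have "(\<lambda>n. ?u n t) \<longlonglongrightarrow> t"
      by (rule tendsto_sandwich[OF always_eventually always_eventually tendsto_const l1])
         (use less_imp_le[OF gt] le in blast)+
    then have "filterlim (\<lambda>n. ?u n t) (at_right t) sequentially"
      unfolding filterlim_at using gt by (intro conjI always_eventually allI) (simp_all add: less_imp_neq[symmetric] del: of_nat_Suc)
    from filterlim_compose[OF rc[OF True] this] show ?thesis using True by simp
  qed simp
  show "(\<lambda>t. indicator {0..} t * g (?u n t)) \<in> borel_measurable borel" for n
  proof -
    have "(\<lambda>k::int. g ((real_of_int k + 1) / real (Suc n))) \<in> count_space UNIV \<rightarrow>\<^sub>M borel" by simp
    moreover have "(\<lambda>t::real. \<lfloor>real (Suc n) * t\<rfloor>) \<in> borel \<rightarrow>\<^sub>M count_space UNIV" by measurable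
    ultimately have "(\<lambda>t. g (?u n t)) \<in> borel_measurable borel"
      using measurable_compose by fast
    then show ?thesis by measurable
  qed
qed

section \<open>Path regularity and the Chapman-Kolmogorov equations\<close>

context borel_right_process begin

lemma space_P: "space (P j) = \<Omega>"
  using subalgebra_F[of j 0] space_F[of 0] by (auto simp: subalgebra_def)

lemma measurable_X: "0 \<le> t \<Longrightarrow> X t \<in> P j \<rightarrow>\<^sub>M count_space UNIV"
  using measurable_from_subalg[OF subalgebra_F adapted] by blast

lemma sets_X: "0 \<le> t \<Longrightarrow> {\<omega> \<in> \<Omega>. X t \<omega> = Some k} \<in> sets (P j)"
proof -
  assume t: "0 \<le> t"
  have "{\<omega> \<in> \<Omega>. X t \<omega> = Some k} = X t -` {Some k} \<inter> space (P j)"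
    by (auto simp: space_P)
  also have "\<dots> \<in> sets (P j)"
    by (rule measurable_sets[OF measurable_X[OF t]]) simp
  finally show ?thesis .
qed

lemma emeasure_X: "emeasure (P j) {\<omega> \<in> \<Omega>. X t \<omega> = Some k} = ennreal (transition P X t j k)"
proof -
  interpret prob_space "P j" by (rule prob_space_P)
  show ?thesis by (simp add: transition_def emeasure_eq_measure space_P)
qed

lemma transition_nonneg: "0 \<le> transition P X t j k"
  by (simp add: transition_def)

lemma transition_row: "0 \<le> t \<Longrightarrow> (\<Sum>k. ennreal (transition P X t j k)) \<le> 1"
proof -
  assume t: "0 \<le> t"
  interpret prob_space "P j" by (rule prob_space_P)
  have "(\<Sum>k. emeasure (P j) {\<omega> \<in> \<Omega>. X t \<omega> = Some k}) =
      emeasure (P j) (\<Union>k. {\<omega> \<in> \<Omega>. X t \<omega> = Some k})"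
    by (rule suminf_emeasure) (use sets_X[OF t] in \<open>auto simp: disjoint_family_on_def\<close>)
  also have "\<dots> \<le> 1" by (rule emeasure_le_1)
  finally show ?thesis by (simp add: emeasure_X)
qed

lemma transition_0: "transition P X 0 j k = (if j = k then 1 else 0)"
proof -
  interpret prob_space "P j" by (rule prob_space_P)
  have "transition P X 0 j k = measure (P j) {\<omega> \<in> space (P j). j = k}"
    unfolding transition_def
  proof (rule finite_measure_eq_AE)
    show "AE \<omega> in P j. (\<omega> \<in> {\<omega> \<in> space (P j). X 0 \<omega> = Some k}) = (\<omega> \<in> {\<omega> \<in> space (P j). j = k})"
      using start[of j] by eventually_elim auto
    show "{\<omega> \<in> space (P j). X 0 \<omega> = Some k} \<in> sets (P j)"
      using sets_X[of 0 k j] by (simp add: space_P)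
  qed simp
  also have "\<dots> = (if j = k then 1 else 0)" 
  proof (cases "j = k")
    case True
    then have "{\<omega> \<in> space (P j). j = k} = space (P j)" by auto
    then show ?thesis using True prob_space by simp
  qed simp
  finally show ?thesis .
qed

lemma transition_right_continuous:
  assumes t: "0 \<le> t"
  shows "((\<lambda>s. transition P X s j k) \<longlongrightarrow> transition P X t j k) (at_right t)"
proof (rule tendsto_at_right_sequentially[of t "t + 1"])
  interpret prob_space "P j" by (rule prob_space_P)
  fix S :: "nat \<Rightarrow> real"
  assume gt: "\<And>n. t < S n" and lim: "S \<longlonglongrightarrow> t"
  let ?I = "\<lambda>s \<omega>. indicat_real {\<omega> \<in> \<Omega>. X s \<omega> = Some k} \<omega>"
  have S0: "0 \<le> S n" for n using t gt[of n] by linarith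
  have filt: "filterlim S (at_right t) sequentially"
    unfolding filterlim_at using lim gt
    by (intro conjI always_eventually allI) (auto simp: less_le)
  have I: "integral\<^sup>L (P j) (?I s) = transition P X s j k" if "0 \<le> s" for s
  proof -
    have "{\<omega> \<in> \<Omega>. X s \<omega> = Some k} \<inter> space (P j) = {\<omega> \<in> space (P j). X s \<omega> = Some k}"
      by (auto simp: space_P)
    then show ?thesis by (simp add: transition_def)
  qed
  have "(\<lambda>n. integral\<^sup>L (P j) (?I (S n))) \<longlonglongrightarrow> integral\<^sup>L (P j) (?I t)"
  proof (rule integral_dominated_convergence[where w = "\<lambda>_. 1"])
    show "?I t \<in> borel_measurable (P j)" "?I (S n) \<in> borel_measurable (P j)" for n
      using sets_X[OF t, of k j] sets_X[OF S0, of n k j] by auto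
    show "AE \<omega> in P j. (\<lambda>n. ?I (S n) \<omega>) \<longlonglongrightarrow> ?I t \<omega>"
    proof (rule AE_I2)
      fix \<omega> assume "\<omega> \<in> space (P j)"
      then have "\<forall>\<^sub>F s in at_right t. X s \<omega> = X t \<omega>"
        using paths_right_continuous[OF t] by (simp add: space_P)
      then have "\<forall>\<^sub>F n in sequentially. X (S n) \<omega> = X t \<omega>"
        using filt by (rule eventually_compose_filterlim)
      then show "(\<lambda>n. ?I (S n) \<omega>) \<longlonglongrightarrow> ?I t \<omega>"
        by (intro tendsto_eventually) (auto elim!: eventually_mono simp: indicator_def)
    qed
  qed auto
  then show "(\<lambda>n. transition P X (S n) j k) \<longlonglongrightarrow> transition P X t j k"
    by (simp only: I t S0)
qed simp

text \<open>The indicator is there because regularity in \<open>t\<close> is known at non-negative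
  times only.\<close>

lemma measurable_transition [measurable]:
  "(\<lambda>t. indicator {0..} t * transition P X t j k) \<in> borel_measurable borel"
  by (rule right_continuous_borel) (rule transition_right_continuous)

lemma measurable_transition_ennreal [measurable]:
  "(\<lambda>t. indicator {0..} t * ennreal (transition P X t j k)) \<in> borel_measurable borel"
proof -
  have "(\<lambda>t. ennreal (indicator {0..} t * transition P X t j k)) \<in> borel_measurable borel" by measurable
  also have "(\<lambda>t. ennreal (indicator {0..} t * transition P X t j k)) =
      (\<lambda>t. indicator {0..} t * ennreal (transition P X t j k))"
    by (auto simp: fun_eq_iff indicator_def)
  finally show ?thesis .
qed

text \<open>This is the strong Markov property at the constant time \<open>s\<close> with
  \<open>A\<close> the whole space. Paths that are in the cemetery at time \<open>s\<close>
  contribute 0, so the sum over the states \<open>i\<close> is complete.\<close>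

lemma chapman_kolmogorov:
  assumes s: "0 \<le> s" and t: "0 \<le> t"
  shows "ennreal (transition P X (s + t) j k) =
    (\<Sum>i. ennreal (transition P X s j i) * ennreal (transition P X t i k))"
proof -
  have st: "stopping_time F (\<lambda>_. ennreal s)" by (rule stopping_time_const)
  have A: "\<Omega> \<in> sets (pre_sigma (\<lambda>_. ennreal s))"
  proof (rule sets_pre_sigmaI[OF st])
    fix t
    show "{\<omega> \<in> \<Omega>. ennreal s \<le> t} \<in> sets (F t)"
      using sets.top[of "F t"] by (cases "ennreal s \<le> t") (simp_all add: space_F)
  qed
  have "ennreal (transition P X (s + t) j k) = 
    (\<integral>\<^sup>+\<omega>\<in>{\<omega> \<in> \<Omega>. True}. (case X s \<omega> of None \<Rightarrow> 0 | Some i \<Rightarrow> ennreal (transition P X t i k)) \<partial>P j)"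
    using strong_markov[OF st A t, of j k] s by (simp add: emeasure_X)
  also have "\<dots> = (\<integral>\<^sup>+\<omega>. (\<Sum>i. ennreal (transition P X t i k) * indicator {\<omega> \<in> \<Omega>. X s \<omega> = Some i} \<omega>) \<partial>P j)"
  proof (rule nn_integral_cong)
    fix \<omega> assume w: "\<omega> \<in> space (P j)"
    show "(case X s \<omega> of None \<Rightarrow> 0 | Some i \<Rightarrow> ennreal (transition P X t i k)) *
         indicator {\<omega> \<in> \<Omega>. True} \<omega> =
         (\<Sum>i. ennreal (transition P X t i k) * indicator {\<omega> \<in> \<Omega>. X s \<omega> = Some i} \<omega>)"
    proof (cases "X s \<omega>")
      case (Some i0)
      then have "(\<Sum>i. ennreal (transition P X t i k) * indicator {\<omega> \<in> \<Omega>. X s \<omega> = Some i} \<omega>) =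
         (\<Sum>i. if i = i0 then ennreal (transition P X t i k) else 0)"
        using w by (intro suminf_cong) (auto simp: space_P)
      also have "\<dots> = (\<Sum>i\<in>{i0}. if i = i0 then ennreal (transition P X t i k) else 0)"
        by (rule suminf_finite) auto
      finally show ?thesis using Some w by (simp add: space_P)
    qed simp
  qed
  also have "\<dots> = (\<Sum>i. \<integral>\<^sup>+\<omega>. ennreal (transition P X t i k) * indicator {\<omega> \<in> \<Omega>. X s \<omega> = Some i} \<omega> \<partial>P j)"
    by (rule nn_integral_suminf) (use sets_X[OF s] in measurable)
  also have "\<dots> = (\<Sum>i. ennreal (transition P X t i k) * ennreal (transition P X s j i))"
    by (intro suminf_cong) (simp add: nn_integral_cmult_indicator sets_X[OF s] emeasure_X)
  finally show ?thesis by (simp add: mult.commute)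
qed

end

text \<open>\<open>G\<close> is the Green kernel of the substochastic kernel \<open>R\<close>,
  \<open>v\<close> is excessive for \<open>R\<close>, and \<open>w = G m\<close> is the potential of
  a charge \<open>m\<close> on \<open>S\<close>. Domination principle: if \<open>w \<le> v\<close>
  on \<open>S\<close>, then \<open>w \<le> v\<close> everywhere, because \<open>w = R w\<close> off
  \<open>S\<close> and \<open>R v \<le> v\<close>. At a contact point \<open>j\<close> this gives
  \<open>R w \<le> R v \<le> v j = w j\<close>, and \<open>m j = w j - R w\<close> at
  \<open>j\<close>.\<close>

lemma contraction_comparison:
  fixes R G :: "nat \<Rightarrow> nat \<Rightarrow> real"
  assumes R: "\<And>j k. 0 \<le> R j k" "\<And>j. summable (R j)" "\<And>j. (\<Sum>k. R j k) \<le> r" "r < 1"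
    and G: "\<And>j i. G j i = (if j = i then 1 else 0) + (\<Sum>k. R j k * G k i)"
    and B: "\<And>j i. 0 \<le> G j i" "\<And>j i. G j i \<le> B"
    and v: "\<And>j. 0 \<le> v j" "\<And>j. summable (\<lambda>k. R j k * v k)" "\<And>j. (\<Sum>k. R j k * v k) \<le> v j"
    and S: "finite S" "\<And>i. i \<in> S \<Longrightarrow> (\<Sum>k\<in>S. G i k * m k) \<le> v i"
    and j: "j \<in> S" "(\<Sum>k\<in>S. G j k * m k) = v j"
  shows "0 \<le> m j"
proof -
  define w where "w i = (\<Sum>k\<in>S. G i k * m k)" for i
  define C where "C = (\<Sum>k\<in>S. B * \<bar>m k\<bar>)"
  have wC: "\<bar>w i\<bar> \<le> C" for i
    unfolding w_def C_def
    by (rule order_trans[OF sum_abs]) (auto intro!: sum_mono mult_right_mono simp: abs_mult B)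
  have sRG: "summable (\<lambda>k. R j k * G k i)" for j i
  proof (rule summable_comparison_test'[where g = "\<lambda>k. R j k * B"])
    show "summable (\<lambda>k. R j k * B)" using R(2) by (rule summable_mult2)
    show "norm (R j k * G k i) \<le> R j k * B" for k
      using B R(1) by (simp add: abs_mult mult_left_mono)
  qed
  have sRw: "summable (\<lambda>k. R j k * w k)" for j
    unfolding w_def sum_distrib_left
    by (rule summable_sum) (use summable_mult2[OF sRG] in \<open>simp add: mult.assoc\<close>)
  have w: "w i = (if i \<in> S then m i else 0) + (\<Sum>k. R i k * w k)" for i
  proof -
    have "(\<Sum>k. R i k * w k) = (\<Sum>k. \<Sum>l\<in>S. R i k * G k l * m l)"
      unfolding w_def sum_distrib_left by (simp add: mult.assoc)
    also have "\<dots> = (\<Sum>l\<in>S. \<Sum>k. R i k * G k l * m l)"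
      by (rule suminf_sum) (rule summable_mult2[OF sRG])
    also have "\<dots> = (\<Sum>l\<in>S. (\<Sum>k. R i k * G k l) * m l)"
      by (intro sum.cong refl suminf_mult2[symmetric] sRG)
    also have "\<dots> = (\<Sum>l\<in>S. (G i l - (if i = l then 1 else 0)) * m l)"
      by (intro sum.cong refl) (subst (2) G, simp)
    also have "\<dots> = w i - (\<Sum>l\<in>S. if i = l then m l else 0)"
      unfolding w_def sum_subtractf[symmetric]
      by (intro sum.cong refl) (auto simp: algebra_simps)
    also have "(\<Sum>l\<in>S. if i = l then m l else 0) = (if i \<in> S then m i else 0)"
      using S(1) by (simp add: sum.delta)
    finally show ?thesis by simp
  qed
  \<comment> \<open>\<open>a\<close> vanishes on \<open>S\<close> and satisfies \<open>a \<le> R a \<le> r sup a\<close>, hence \<open>a = 0\<close>.\<close>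
  define a where "a i = max 0 (w i - v i)" for i
  have a0: "0 \<le> a i" and aC: "a i \<le> C" for i
    using wC[of i] v(1)[of i] by (auto simp: a_def abs_le_iff)
  have bdd: "bdd_above (range a)" by (rule bdd_aboveI2) (rule aC)
  define b where "b = (SUP i. a i)"
  have ab: "a i \<le> b" for i unfolding b_def by (rule cSUP_upper[OF _ bdd]) simp
  have b0: "0 \<le> b" using a0 ab order_trans by blast
  have sRa: "summable (\<lambda>k. R j k * a k)" for j
  proof (rule summable_comparison_test'[where g = "\<lambda>k. R j k * C"])
    show "summable (\<lambda>k. R j k * C)" using R(2) by (rule summable_mult2)
    show "norm (R j k * a k) \<le> R j k * C" for k
      using a0 aC R(1) by (simp add: abs_mult mult_left_mono)
  qed
  have "a i \<le> r * b" for i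
  proof (cases "i \<in> S \<or> w i \<le> v i")
    case True
    then have "a i = 0" using S(2) by (auto simp: a_def w_def)
    moreover have "0 \<le> r" using suminf_nonneg[OF R(2) R(1)] R(3) order_trans by blast
    ultimately show ?thesis using b0 by simp
  next
    case False
    then have "a i = w i - v i" by (simp add: a_def)
    also have "\<dots> \<le> (\<Sum>k. R i k * w k) - (\<Sum>k. R i k * v k)"
      using False w[of i] v(3)[of i] by simp
    also have "\<dots> = (\<Sum>k. R i k * w k - R i k * v k)"
      by (rule suminf_diff[OF sRw v(2)])
    also have "\<dots> \<le> (\<Sum>k. R i k * b)"
    proof (rule suminf_le)
      show "R i k * w k - R i k * v k \<le> R i k * b" for k
        using ab[of k] R(1)[of i k] by (simp add: a_def mult_left_mono flip: right_diff_distrib)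
      show "summable (\<lambda>k. R i k * w k - R i k * v k)" by (rule summable_diff[OF sRw v(2)])
      show "summable (\<lambda>k. R i k * b)" using R(2) by (rule summable_mult2)
    qed
    also have "\<dots> = (\<Sum>k. R i k) * b" by (rule suminf_mult2[symmetric, OF R(2)])
    also have "\<dots> \<le> r * b" using R(3) b0 by (rule mult_right_mono)
    finally show ?thesis .
  qed
  then have "b \<le> r * b" unfolding b_def by (intro cSUP_least) auto
  then have "(1 - r) * b \<le> 0" by (simp add: algebra_simps)
  then have "b = 0" using R(4) b0 by (simp add: mult_le_0_iff)
  then have wv: "w i \<le> v i" for i using ab[of i] by (simp add: a_def)
  have "(\<Sum>k. R j k * w k) \<le> (\<Sum>k. R j k * v k)"
    by (rule suminf_le[OF _ sRw v(2)]) (rule mult_left_mono[OF wv R(1)])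
  also have "\<dots> \<le> w j" using v(3) j(2) by (simp add: w_def)
  finally show ?thesis using w[of j] j(1) by simp
qed

section \<open>Resolvents and the resolvent equation\<close>

context borel_right_process begin

definition resolvent :: "real \<Rightarrow> nat \<Rightarrow> nat \<Rightarrow> ennreal" where
  "resolvent u j k = (\<integral>\<^sup>+t. ennreal (exp (- (u * t))) * (indicator {0..} t * ennreal (transition P X t j k)) \<partial>lborel)"

lemma nn_integral_exp_atLeast:
  fixes u :: real
  assumes "0 < u"
  shows "(\<integral>\<^sup>+t. ennreal (exp (- (u * t))) * indicator {0..} t \<partial>lborel) = ennreal (1 / u)"
proof -
  have "(\<integral>\<^sup>+t. ennreal (exp (- (u * t))) * indicator {0..} t \<partial>lborel) = ennreal (0 - (- (exp (- (u * 0)) / u)))"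
  proof (rule nn_integral_FTC_atLeast)
    show "((\<lambda>t. - (exp (- (u * t)) / u)) \<longlongrightarrow> 0) at_top"
      using assms by real_asymp
  qed (use assms in \<open>auto intro!: derivative_eq_intros\<close>)
  then show ?thesis using assms by simp
qed

text \<open>Integrate \<open>P_t v \<le> v\<close> against \<open>exp (- u t)\<close>. The time 0,
  at which nothing is assumed, is a null set.\<close>

lemma resolvent_excessive:
  assumes u: "0 < u" and v: "\<And>t. 0 < t \<Longrightarrow> semigroup_op P X t v j \<le> v j"
  shows "(\<Sum>k. resolvent u j k * v k) \<le> ennreal (1 / u) * v j"
proof -
  have "(\<Sum>k. resolvent u j k * v k) =
      (\<Sum>k. \<integral>\<^sup>+t. ennreal (exp (- (u * t))) * (indicator {0..} t * ennreal (transition P X t j k)) * v k \<partial>lborel)"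
    unfolding resolvent_def by (intro suminf_cong nn_integral_multc[symmetric]) measurable
  also have "\<dots> = (\<integral>\<^sup>+t. (\<Sum>k. ennreal (exp (- (u * t))) * (indicator {0..} t * ennreal (transition P X t j k)) * v k) \<partial>lborel)"
    by (rule nn_integral_suminf[symmetric]) measurable
  also have "\<dots> \<le> (\<integral>\<^sup>+t. ennreal (exp (- (u * t))) * indicator {0..} t * v j \<partial>lborel)"
  proof (rule nn_integral_mono_AE)
    have "AE t in lborel. t \<noteq> (0::real)" by (rule AE_lborel_singleton)
    then show "AE t in lborel. (\<Sum>k. ennreal (exp (- (u * t))) * (indicator {0..} t * ennreal (transition P X t j k)) * v k)
       \<le> ennreal (exp (- (u * t))) * indicator {0..} t * v j"
    proof eventually_elim
      case (elim t)
      show ?case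
      proof (cases "0 < t")
        case True
        then have "(\<Sum>k. ennreal (exp (- (u * t))) * (indicator {0..} t * ennreal (transition P X t j k)) * v k) =
          ennreal (exp (- (u * t))) * semigroup_op P X t v j"
          unfolding semigroup_op_def by (subst ennreal_suminf_cmult[symmetric]) (simp add: mult.assoc)
        then show ?thesis using True v[OF True] by (simp add: mult_left_mono)
      qed (use elim in simp)
    qed
  qed
  also have "\<dots> = (\<integral>\<^sup>+t. ennreal (exp (- (u * t))) * indicator {0..} t \<partial>lborel) * v j"
    by (rule nn_integral_multc) measurable
  also have "\<dots> = ennreal (1 / u) * v j" by (simp only: nn_integral_exp_atLeast[OF u])
  finally show ?thesis .
qed

lemma excessive_one: "0 < t \<Longrightarrow> semigroup_op P X t (\<lambda>_. 1) j \<le> 1"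
  using transition_row[of t j] by (simp add: semigroup_op_def)

lemma resolvent_row: "0 < u \<Longrightarrow> (\<Sum>k. resolvent u j k) \<le> ennreal (1 / u)"
  using resolvent_excessive[of u "\<lambda>_. 1" j] excessive_one by simp

lemma resolvent_le: "0 < u \<Longrightarrow> resolvent u j k \<le> ennreal (1 / u)"
proof -
  assume u: "0 < u"
  have "resolvent u j k = (\<Sum>i\<in>{k}. resolvent u j i)" by simp
  also have "\<dots> \<le> (\<Sum>i. resolvent u j i)" by (rule sum_le_suminf) auto
  finally show ?thesis using resolvent_row[OF u, of j] by simp
qed

lemma measurable_indicator_Icc:
  "(\<lambda>(t, s). indicator {0..t} s :: ennreal) \<in> borel_measurable (borel \<Otimes>\<^sub>M (borel :: real measure))"
  "(\<lambda>t. indicator {0..t} s :: ennreal) \<in> borel_measurable (borel :: real measure)"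
  unfolding indicator_def atLeastAtMost_iff split_def by measurable

text \<open>The product of the kernels at times \<open>s\<close> and \<open>r\<close> is the kernel
  at time \<open>s + r\<close>. After the substitution \<open>t = s + r\<close> the conditions
  \<open>0 \<le> s\<close> and \<open>0 \<le> r\<close> become \<open>s \<in> {0..t}\<close>, and
  integrating over \<open>s\<close> first produces the factor \<open>(1 - exp (- l t)) / l\<close>.
  The equation is stated without subtraction because the values are extended non-negative
  reals.\<close>

lemma resolvent_equation:
  assumes l: "0 < l" and e: "0 < e"
  shows "resolvent e j k = resolvent (l + e) j k + ennreal l * (\<Sum>i. resolvent (l + e) j i * resolvent e i k)"
proof -
  let ?p = "\<lambda>t j k. indicator {0..} t * ennreal (transition P X t j k)"
  have mp: "(\<lambda>t. ?p t j k) \<in> borel_measurable lborel" by measurable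
  have mq: "(\<lambda>t. ennreal (exp (- (e * t))) * ?p t j k * ennreal ((1 - exp (- (l * t))) / l)) \<in> borel_measurable lborel"
    by (intro borel_measurable_times_ennreal mp) measurable
  have "(\<Sum>i. resolvent (l + e) j i * resolvent e i k) =
    (\<Sum>i. \<integral>\<^sup>+s. \<integral>\<^sup>+r. ennreal (exp (- ((l + e) * s))) * ?p s j i * (ennreal (exp (- (e * r))) * ?p r i k) \<partial>lborel \<partial>lborel)"
    unfolding resolvent_def by (intro suminf_cong) (simp add: nn_integral_cmult nn_integral_multc)
  also have "\<dots> = (\<integral>\<^sup>+s. (\<Sum>i. \<integral>\<^sup>+r. ennreal (exp (- ((l + e) * s))) * ?p s j i * (ennreal (exp (- (e * r))) * ?p r i k) \<partial>lborel) \<partial>lborel)"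
    by (rule nn_integral_suminf[symmetric]) (measurable; simp)
  also have "\<dots> = (\<integral>\<^sup>+s. \<integral>\<^sup>+r. (\<Sum>i. ennreal (exp (- ((l + e) * s))) * ?p s j i * (ennreal (exp (- (e * r))) * ?p r i k)) \<partial>lborel \<partial>lborel)"
    by (intro nn_integral_cong nn_integral_suminf[symmetric]) measurable
  also have "\<dots> = (\<integral>\<^sup>+s. \<integral>\<^sup>+r. ennreal (exp (- ((l + e) * s))) * ennreal (exp (- (e * r))) * 
      (indicator {0..} s * indicator {0..} r * ennreal (transition P X (s + r) j k)) \<partial>lborel \<partial>lborel)"
  proof (intro nn_integral_cong)
    fix s r :: real
    show "(\<Sum>i. ennreal (exp (- ((l + e) * s))) * ?p s j i * (ennreal (exp (- (e * r))) * ?p r i k)) =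
      ennreal (exp (- ((l + e) * s))) * ennreal (exp (- (e * r))) * 
      (indicator {0..} s * indicator {0..} r * ennreal (transition P X (s + r) j k))"
    proof (cases "0 \<le> s \<and> 0 \<le> r")
      case True
      then show ?thesis
        by (simp add: chapman_kolmogorov flip: ennreal_suminf_cmult) (simp add: ac_simps)
    qed auto
  qed
  also have "\<dots> = (\<integral>\<^sup>+s. \<integral>\<^sup>+t. ennreal (exp (- (e * t))) * ?p t j k * (ennreal (exp (- (l * s))) * indicator {0..t} s) \<partial>lborel \<partial>lborel)"
  proof (rule nn_integral_cong)
    fix s :: real
    have "(\<integral>\<^sup>+t. ennreal (exp (- (e * t))) * ?p t j k * (ennreal (exp (- (l * s))) * indicator {0..t} s) \<partial>lborel) =
      (\<integral>\<^sup>+r. ennreal (exp (- (e * (s + r)))) * ?p (s + r) j k * (ennreal (exp (- (l * s))) * indicator {0..s + r} s) \<partial>lborel)"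
      by (subst nn_integral_real_affine[where c = 1 and t = s])
         (use measurable_indicator_Icc(2)[of s] in \<open>simp_all add: borel_measurable_times\<close>)
    also have "\<dots> = (\<integral>\<^sup>+r. ennreal (exp (- ((l + e) * s))) * ennreal (exp (- (e * r))) * 
      (indicator {0..} s * indicator {0..} r * ennreal (transition P X (s + r) j k)) \<partial>lborel)"
    proof (rule nn_integral_cong)
      fix r :: real
      have "ennreal (exp (- (e * (s + r)))) * ennreal (exp (- (l * s))) =
          ennreal (exp (- ((l + e) * s))) * ennreal (exp (- (e * r)))"
        by (simp add: ennreal_mult[symmetric] exp_add[symmetric] algebra_simps)
      moreover have "?p (s + r) j k * indicator {0..s + r} s =
          indicator {0..} s * indicator {0..} r * ennreal (transition P X (s + r) j k)"
        by (auto simp: indicator_def)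
      moreover have "ennreal (exp (- (e * (s + r)))) * ?p (s + r) j k * (ennreal (exp (- (l * s))) * indicator {0..s + r} s) =
          (ennreal (exp (- (e * (s + r)))) * ennreal (exp (- (l * s)))) * (?p (s + r) j k * indicator {0..s + r} s)"
        by (simp only: mult.assoc mult.left_commute)
      ultimately show "ennreal (exp (- (e * (s + r)))) * ?p (s + r) j k * (ennreal (exp (- (l * s))) * indicator {0..s + r} s) =
        ennreal (exp (- ((l + e) * s))) * ennreal (exp (- (e * r))) * 
        (indicator {0..} s * indicator {0..} r * ennreal (transition P X (s + r) j k))"
        by (simp only:)
    qed
    finally show "(\<integral>\<^sup>+r. ennreal (exp (- ((l + e) * s))) * ennreal (exp (- (e * r))) * 
      (indicator {0..} s * indicator {0..} r * ennreal (transition P X (s + r) j k)) \<partial>lborel) =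
      (\<integral>\<^sup>+t. ennreal (exp (- (e * t))) * ?p t j k * (ennreal (exp (- (l * s))) * indicator {0..t} s) \<partial>lborel)" ..
  qed
  also have "\<dots> = (\<integral>\<^sup>+t. \<integral>\<^sup>+s. ennreal (exp (- (e * t))) * ?p t j k * (ennreal (exp (- (l * s))) * indicator {0..t} s) \<partial>lborel \<partial>lborel)"
  proof (rule lborel_pair.Fubini')
    show "(\<lambda>(t, s). ennreal (exp (- (e * t))) * ?p t j k * (ennreal (exp (- (l * s))) * indicator {0..t} s))
        \<in> borel_measurable (lborel \<Otimes>\<^sub>M lborel)"
      unfolding split_def
    proof (rule borel_measurable_times_ennreal[OF borel_measurable_times_ennreal borel_measurable_times_ennreal])
      show "(\<lambda>x::real \<times> real. ?p (fst x) j k) \<in> borel_measurable (lborel \<Otimes>\<^sub>M lborel)"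
        by (rule measurable_compose[OF measurable_fst mp])
      show "(\<lambda>x. indicator {0..fst x} (snd x) :: ennreal) \<in> borel_measurable (lborel \<Otimes>\<^sub>M (lborel :: real measure))"
        using measurable_indicator_Icc(1) by (simp add: split_def)
    qed measurable
  qed
  also have "\<dots> = (\<integral>\<^sup>+t. ennreal (exp (- (e * t))) * ?p t j k * ennreal ((1 - exp (- (l * t))) / l) \<partial>lborel)"
  proof (rule nn_integral_cong)
    fix t :: real
    show "(\<integral>\<^sup>+s. ennreal (exp (- (e * t))) * ?p t j k * (ennreal (exp (- (l * s))) * indicator {0..t} s) \<partial>lborel) =
      ennreal (exp (- (e * t))) * ?p t j k * ennreal ((1 - exp (- (l * t))) / l)"
    proof (cases "0 \<le> t")
      case True
      have "(\<integral>\<^sup>+s. ennreal (exp (- (l * s))) * indicator {0..t} s \<partial>lborel) =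
          ennreal (- (exp (- (l * t)) / l) - (- (exp (- (l * 0)) / l)))"
        by (rule nn_integral_FTC_Icc) (use l True in \<open>auto intro!: derivative_eq_intros\<close>)
      also have "- (exp (- (l * t)) / l) - (- (exp (- (l * 0)) / l)) = (1 - exp (- (l * t))) / l"
        by (simp add: diff_divide_distrib)
      finally show ?thesis by (subst nn_integral_cmult) auto
    qed simp
  qed
  finally have *: "(\<Sum>i. resolvent (l + e) j i * resolvent e i k) =
    (\<integral>\<^sup>+t. ennreal (exp (- (e * t))) * ?p t j k * ennreal ((1 - exp (- (l * t))) / l) \<partial>lborel)" .
  have "resolvent (l + e) j k + ennreal l * (\<Sum>i. resolvent (l + e) j i * resolvent e i k) =
    (\<integral>\<^sup>+t. ennreal (exp (- ((l + e) * t))) * ?p t j k + 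
       ennreal l * (ennreal (exp (- (e * t))) * ?p t j k * ennreal ((1 - exp (- (l * t))) / l)) \<partial>lborel)"
    unfolding * unfolding resolvent_def
    by (subst nn_integral_cmult[OF mq, symmetric], rule nn_integral_add[symmetric])
       (intro borel_measurable_times_ennreal mp mq borel_measurable_const; measurable)+
  also have "\<dots> = (\<integral>\<^sup>+t. ennreal (exp (- (e * t))) * ?p t j k \<partial>lborel)"
  proof (rule nn_integral_cong)
    fix t :: real
    show "ennreal (exp (- ((l + e) * t))) * ?p t j k + 
       ennreal l * (ennreal (exp (- (e * t))) * ?p t j k * ennreal ((1 - exp (- (l * t))) / l)) =
       ennreal (exp (- (e * t))) * ?p t j k"
    proof (cases "0 \<le> t")
      case True
      then have x: "exp (- (l * t)) \<le> 1" using l by simp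
      have "ennreal l * (ennreal (exp (- (e * t))) * ennreal ((1 - exp (- (l * t))) / l)) =
         ennreal (exp (- (e * t)) * (1 - exp (- (l * t))))"
        using l x by (simp add: ennreal_mult[symmetric])
      moreover have "ennreal (exp (- ((l + e) * t))) + ennreal (exp (- (e * t)) * (1 - exp (- (l * t)))) = ennreal (exp (- (e * t)))"
        using x by (simp add: ennreal_plus[symmetric] algebra_simps exp_add[symmetric] del: ennreal_plus)
      ultimately have "ennreal (exp (- ((l + e) * t))) + ennreal l * (ennreal (exp (- (e * t))) * ennreal ((1 - exp (- (l * t))) / l)) = ennreal (exp (- (e * t)))"
        by simp
      moreover have "(a + b * (c * d)) * x = a * x + b * (c * x * d)" for a b c d x :: ennreal
        by (simp add: algebra_simps)
      ultimately show ?thesis by metis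
    qed simp
  qed
  finally show ?thesis by (simp add: resolvent_def)
qed

end

section \<open>Schur complements and inverse matrices\<close>

abbreviation fmat :: "nat \<Rightarrow> (nat \<Rightarrow> nat \<Rightarrow> real) \<Rightarrow> real mat" where
  "fmat n C \<equiv> Matrix.mat n n (\<lambda>(i, j). C i j)"

text \<open>Elimination removes the last index, so the remaining index set is again an initial
  segment and nothing has to be renumbered.\<close>

definition schur :: "(nat \<Rightarrow> nat \<Rightarrow> real) \<Rightarrow> nat \<Rightarrow> nat \<Rightarrow> nat \<Rightarrow> real" where
  "schur C n i j = C i j - C i n * C n j / C n n"

fun pivots_pos :: "nat \<Rightarrow> (nat \<Rightarrow> nat \<Rightarrow> real) \<Rightarrow> bool" where
  "pivots_pos 0 C \<longleftrightarrow> True"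
| "pivots_pos (Suc n) C \<longleftrightarrow> 0 < C n n \<and> pivots_pos n (schur C n)"

definition posdef :: "nat \<Rightarrow> (nat \<Rightarrow> nat \<Rightarrow> real) \<Rightarrow> bool" where
  "posdef n C \<longleftrightarrow> (\<forall>i<n. \<forall>j<n. C i j = C j i) \<and>
     (\<forall>x. (\<exists>i<n. x i \<noteq> 0) \<longrightarrow> 0 < (\<Sum>i<n. \<Sum>j<n. x i * x j * C i j))"

lemma det_fmat_0 [simp]: "Determinant.det (fmat 0 C) = 1"
  by (rule det_dim_zero) simp

text \<open>The matrix factors into a unit upper block triangular matrix and a lower block
  triangular one whose diagonal blocks are the Schur complement and the pivot.\<close>

lemma det_fmat_Suc:
  assumes "C n n \<noteq> 0"
  shows "Determinant.det (fmat (Suc n) C) = C n n * Determinant.det (fmat n (schur C n))"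
proof -
  let ?E = "four_block_mat (1\<^sub>m n) (Matrix.mat n 1 (\<lambda>(i, _). C i n / C n n)) (0\<^sub>m 1 n) (1\<^sub>m 1)"
  let ?F = "four_block_mat (fmat n (schur C n)) (0\<^sub>m n 1) (Matrix.mat 1 n (\<lambda>(_, j). C n j)) (Matrix.mat 1 1 (\<lambda>_. C n n))"
  have "fmat (Suc n) C = ?E * ?F"
  proof (subst mult_four_block_mat[where ?nr1.0 = n and ?n1.0 = n and ?n2.0 = 1 and ?nr2.0 = 1 and ?nc1.0 = n and ?nc2.0 = 1])
    show "fmat (Suc n) C = four_block_mat
       (1\<^sub>m n * fmat n (schur C n) + Matrix.mat n 1 (\<lambda>(i, _). C i n / C n n) * Matrix.mat 1 n (\<lambda>(_, j). C n j))
       (1\<^sub>m n * 0\<^sub>m n 1 + Matrix.mat n 1 (\<lambda>(i, _). C i n / C n n) * Matrix.mat 1 1 (\<lambda>_. C n n))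
       (0\<^sub>m 1 n * fmat n (schur C n) + 1\<^sub>m 1 * Matrix.mat 1 n (\<lambda>(_, j). C n j))
       (0\<^sub>m 1 n * 0\<^sub>m n 1 + 1\<^sub>m 1 * Matrix.mat 1 1 (\<lambda>_. C n n))"
    proof (rule eq_matI, goal_cases)
      case (1 i j)
      then have "i \<le> n" "j \<le> n" by auto
      then show ?case using assms
        by (cases "i = n"; cases "j = n") (auto simp: scalar_prod_def schur_def)
    qed auto
  qed auto
  then have "Determinant.det (fmat (Suc n) C) = Determinant.det (?E * ?F)" by simp
  also have "\<dots> = Determinant.det ?E * Determinant.det ?F"
    by (rule det_mult[where n = "n + 1"]) auto
  also have "Determinant.det ?E = 1"
    by (subst det_four_block_mat_lower_left_zero[of _ n _ 1]) auto
  also have "Determinant.det ?F = Determinant.det (fmat n (schur C n)) * C n n"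
    by (subst det_four_block_mat_upper_right_zero[of _ n _ 1]) (auto simp: det_single)
  finally show ?thesis by simp
qed

lemma det_pos: "pivots_pos n C \<Longrightarrow> 0 < Determinant.det (fmat n C)"
  by (induction n arbitrary: C) (auto simp: det_fmat_Suc less_imp_neq[symmetric])

lemma fmat_cong: "(\<And>i j. i < n \<Longrightarrow> j < n \<Longrightarrow> C i j = D i j) \<Longrightarrow> fmat n C = fmat n D"
  by (rule eq_matI) auto

lemma pivots_pos_cong:
  "(\<And>i j. i < n \<Longrightarrow> j < n \<Longrightarrow> C i j = D i j) \<Longrightarrow> pivots_pos n C = pivots_pos n D"
proof (induction n arbitrary: C D)
  case (Suc n)
  have "pivots_pos n (schur C n) = pivots_pos n (schur D n)"
    by (rule Suc.IH) (simp add: schur_def Suc.prems)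
  then show ?case using Suc.prems by simp
qed simp

section \<open>Positive definite forms and their pivots\<close>

lemma quadratic_form_Suc:
  fixes C :: "nat \<Rightarrow> nat \<Rightarrow> real"
  assumes sym: "\<And>i. i < n \<Longrightarrow> C i n = C n i"
  shows "(\<Sum>i<Suc n. \<Sum>j<Suc n. x i * x j * C i j) =
    (\<Sum>i<n. \<Sum>j<n. x i * x j * C i j) + 2 * x n * (\<Sum>i<n. x i * C n i) + (x n)\<^sup>2 * C n n"
proof -
  have "(\<Sum>i<n. x i * x n * C i n) = x n * (\<Sum>i<n. x i * C n i)"
    by (simp add: sym sum_distrib_left ac_simps)
  moreover have "(\<Sum>j<n. x n * x j * C n j) = x n * (\<Sum>i<n. x i * C n i)"
    by (simp add: sum_distrib_left ac_simps)
  ultimately show ?thesis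
    by (simp add: sum.distrib power2_eq_square)
qed

lemma quadratic_form_schur:
  fixes C :: "nat \<Rightarrow> nat \<Rightarrow> real"
  assumes sym: "\<And>i. i < n \<Longrightarrow> C i n = C n i"
  shows "(\<Sum>i<n. \<Sum>j<n. x i * x j * schur C n i j) =
    (\<Sum>i<n. \<Sum>j<n. x i * x j * C i j) - (\<Sum>i<n. x i * C n i)\<^sup>2 / C n n"
proof -
  have "(\<Sum>i<n. \<Sum>j<n. x i * x j * schur C n i j) =
      (\<Sum>i<n. \<Sum>j<n. x i * x j * C i j - (x i * C n i) * (x j * C n j) / C n n)"
    by (intro sum.cong refl) (auto simp: schur_def sym algebra_simps)
  also have "\<dots> = (\<Sum>i<n. \<Sum>j<n. x i * x j * C i j) - (\<Sum>i<n. \<Sum>j<n. (x i * C n i) * (x j * C n j)) / C n n"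
    by (simp add: sum_subtractf sum_divide_distrib)
  finally show ?thesis by (simp add: power2_eq_square sum_product)
qed

lemma posdef_diag:
  assumes "posdef n C" "k < n"
  shows "0 < C k k"
proof -
  have "0 < (\<Sum>i<n. \<Sum>j<n. (if i = k then 1 else 0) * (if j = k then 1 else 0) * C i j)"
    using assms unfolding posdef_def by (auto dest!: spec[of _ "\<lambda>i. if i = k then 1 else 0"])
  also have "\<dots> = (\<Sum>i<n. \<Sum>j<n. if j = k then if i = k then C i j else 0 else 0)"
    by (intro sum.cong refl) auto
  also have "\<dots> = C k k" using assms(2) by simp
  finally show ?thesis .
qed

text \<open>The form of the Schur complement at \<open>x\<close> is the value of the full form at
  \<open>x\<close> extended by the last coordinate \<open>- b / C n n\<close>, which minimises
  it.\<close>

lemma posdef_schur: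
  assumes C: "posdef (Suc n) C"
  shows "posdef n (schur C n)"
proof -
  have c: "0 < C n n" using posdef_diag[OF C] by simp
  have sym: "C i j = C j i" if "i < Suc n" "j < Suc n" for i j
    using C that by (auto simp: posdef_def)
  have "0 < (\<Sum>i<n. \<Sum>j<n. x i * x j * schur C n i j)" if x: "\<exists>i<n. x i \<noteq> 0" for x
  proof -
    define b where "b = (\<Sum>i<n. x i * C n i)"
    define y where "y = x(n := - b / C n n)"
    have "\<exists>i<Suc n. y i \<noteq> 0" using x unfolding y_def by (metis fun_upd_other less_SucI nat_neq_iff)
    then have "0 < (\<Sum>i<Suc n. \<Sum>j<Suc n. y i * y j * C i j)"
      using C by (simp only: posdef_def)
    also have "\<dots> = (\<Sum>i<n. \<Sum>j<n. y i * y j * C i j) + 2 * y n * (\<Sum>i<n. y i * C n i) + (y n)\<^sup>2 * C n n"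
      by (rule quadratic_form_Suc) (simp add: sym)
    also have "(\<Sum>i<n. \<Sum>j<n. y i * y j * C i j) = (\<Sum>i<n. \<Sum>j<n. x i * x j * C i j)"
      by (intro sum.cong refl) (simp add: y_def)
    also have "(\<Sum>i<n. y i * C n i) = b"
      unfolding b_def by (intro sum.cong refl) (simp add: y_def)
    also have "(\<Sum>i<n. \<Sum>j<n. x i * x j * C i j) + 2 * y n * b + (y n)\<^sup>2 * C n n =
        (\<Sum>i<n. \<Sum>j<n. x i * x j * C i j) - b\<^sup>2 / C n n"
      using c by (simp add: y_def power2_eq_square field_simps)
    also have "\<dots> = (\<Sum>i<n. \<Sum>j<n. x i * x j * schur C n i j)"
      unfolding b_def by (rule quadratic_form_schur[symmetric]) (simp add: sym)
    finally show ?thesis .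
  qed
  then show ?thesis by (auto simp: posdef_def schur_def sym ac_simps)
qed

lemma posdef_pivots_pos: "posdef n C \<Longrightarrow> pivots_pos n C"
  by (induction n arbitrary: C) (auto simp: posdef_diag posdef_schur)

lemma posdef_det_pos: "posdef n C \<Longrightarrow> 0 < Determinant.det (fmat n C)"
  by (rule det_pos) (rule posdef_pivots_pos)

text \<open>Elimination from the last index down to index 1 produces exactly the pivots of the
  matrix without row and column 0. The one pivot left, at index 0, has the sign of the determinant.
  This serves the bordered matrix, which need not be symmetric and to which \<open>posdef\<close>
  therefore does not apply.\<close>

lemma pivots_pos_shift:
  assumes "pivots_pos n (\<lambda>i j. C (Suc i) (Suc j))" "0 < Determinant.det (fmat (Suc n) C)"
  shows "pivots_pos (Suc n) C"
  using assms
proof (induction n arbitrary: C)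
  case 0
  then have "0 < C 0 0" by (simp add: det_single)
  then show ?case by simp
next
  case (Suc n)
  have c: "0 < C (Suc n) (Suc n)" using Suc.prems(1) by simp
  have "0 < Determinant.det (fmat (Suc n) (schur C (Suc n)))"
    using Suc.prems(2) c by (subst (asm) det_fmat_Suc) (auto simp: zero_less_mult_iff)
  moreover have "pivots_pos n (\<lambda>i j. schur C (Suc n) (Suc i) (Suc j))"
    using Suc.prems(1) by (simp add: schur_def[abs_def])
  ultimately have "pivots_pos (Suc n) (schur C (Suc n))" by (rule Suc.IH[rotated])
  then show ?case using c by simp
qed

lemma inv_entry_fmat:
  assumes d: "Determinant.det (fmat n C) \<noteq> 0"
  shows inv_entry_right: "\<And>i j. i < n \<Longrightarrow> j < n \<Longrightarrow>
      (\<Sum>k<n. C i k * inv_entry (fmat n C) k j) = (if i = j then 1 else 0)"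
    and inv_entry_left: "\<And>i j. i < n \<Longrightarrow> j < n \<Longrightarrow>
      (\<Sum>k<n. inv_entry (fmat n C) i k * C k j) = (if i = j then 1 else 0)"
    and inv_entry_cofactor: "\<And>i j. i < n \<Longrightarrow> j < n \<Longrightarrow>
      inv_entry (fmat n C) i j = cofactor (fmat n C) j i / Determinant.det (fmat n C)"
proof -
  let ?M = "fmat n C"
  have M: "?M \<in> carrier_mat n n" by simp
  obtain B where B: "mat_inverse ?M = Some B"
    using mat_inverse(1)[OF M, of "()"] det_non_zero_imp_unit[OF M d, of "()"]
    by (cases "mat_inverse ?M") auto
  have 1: "?M * B = 1\<^sub>m n" and 2: "B * ?M = 1\<^sub>m n" and Bc: "B \<in> carrier_mat n n"
    using mat_inverse(2)[OF M B] by auto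
  have inv: "inv_entry ?M i j = B $$ (i, j)" for i j by (simp add: inv_entry_def B)
  show "(\<Sum>k<n. C i k * inv_entry ?M k j) = (if i = j then 1 else 0)" if "i < n" "j < n" for i j
    using arg_cong[OF 1, of "\<lambda>A. A $$ (i, j)"] that Bc
    by (simp add: scalar_prod_def inv lessThan_atLeast0)
  show "(\<Sum>k<n. inv_entry ?M i k * C k j) = (if i = j then 1 else 0)" if "i < n" "j < n" for i j
    using arg_cong[OF 2, of "\<lambda>A. A $$ (i, j)"] that Bc
    by (simp add: scalar_prod_def inv lessThan_atLeast0)
  have "adj_mat ?M = adj_mat ?M * (?M * B)" using adj_mat(1)[OF M] by (simp add: 1)
  also have "\<dots> = (adj_mat ?M * ?M) * B" by (rule assoc_mult_mat[OF adj_mat(1)[OF M] M Bc, symmetric])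
  also have "\<dots> = Determinant.det ?M \<cdot>\<^sub>m B" using Bc by (simp add: adj_mat(3)[OF M] mult_smult_assoc_mat[where n = n and nr = n and nc = n])
  finally have "adj_mat ?M $$ (i, j) = Determinant.det ?M * B $$ (i, j)" if "i < n" "j < n" for i j
    using that Bc by simp
  then show "inv_entry ?M i j = cofactor ?M j i / Determinant.det ?M" if "i < n" "j < n" for i j
    using that d by (simp add: inv adj_mat_def)
qed

section \<open>Continuity of determinants and inverses\<close>

lemma tendsto_det:
  fixes M :: "nat \<Rightarrow> real mat"
  assumes M: "\<And>N. M N \<in> carrier_mat n n" "L \<in> carrier_mat n n"
    and lim: "\<And>i j. i < n \<Longrightarrow> j < n \<Longrightarrow> (\<lambda>N. M N $$ (i, j)) \<longlonglongrightarrow> L $$ (i, j)"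
  shows "(\<lambda>N. Determinant.det (M N)) \<longlonglongrightarrow> Determinant.det L"
  unfolding det_def'[OF M(1)] det_def'[OF M(2)]
proof (intro tendsto_sum tendsto_mult tendsto_const tendsto_prod lim)
  fix p i assume p: "p \<in> {p. p permutes {0..<n}}" and i: "i \<in> {0..<n}"
  show "i < n" using i by simp
  show "p i < n" using p i permutes_in_image[of p "{0..<n}" i] by simp
qed

text \<open>By Cramer's rule an entry of the inverse is a cofactor divided by the determinant, and
  both are polynomials in the entries of the matrix.\<close>

lemma tendsto_inv_entry:
  assumes lim: "\<And>i j. i < n \<Longrightarrow> j < n \<Longrightarrow> (\<lambda>N. C N i j) \<longlonglongrightarrow> D i j"
    and d: "Determinant.det (fmat n D) \<noteq> 0"
    and i: "i < n" and j: "j < n"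
  shows "(\<lambda>N. inv_entry (fmat n (C N)) i j) \<longlonglongrightarrow> inv_entry (fmat n D) i j"
    and "\<forall>\<^sub>F N in sequentially. Determinant.det (fmat n (C N)) \<noteq> 0"
proof -
  have det: "(\<lambda>N. Determinant.det (fmat n (C N))) \<longlonglongrightarrow> Determinant.det (fmat n D)"
    by (rule tendsto_det) (auto simp: lim)
  show ev: "\<forall>\<^sub>F N in sequentially. Determinant.det (fmat n (C N)) \<noteq> 0"
    by (rule tendsto_imp_eventually_ne[OF det d])
  have "(\<lambda>N. cofactor (fmat n (C N)) j i) \<longlonglongrightarrow> cofactor (fmat n D) j i"
    unfolding cofactor_def
  proof (intro tendsto_mult tendsto_const tendsto_det[where n = "n - 1"])
    show "mat_delete (fmat n (C N)) j i \<in> carrier_mat (n - 1) (n - 1)" for N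
      by (simp add: mat_delete_dim carrier_matI)
    show "mat_delete (fmat n D) j i \<in> carrier_mat (n - 1) (n - 1)"
      by (simp add: mat_delete_dim carrier_matI)
  qed (use i j in \<open>auto simp: mat_delete_def intro!: lim\<close>)
  then have "(\<lambda>N. cofactor (fmat n (C N)) j i / Determinant.det (fmat n (C N))) \<longlonglongrightarrow>
      cofactor (fmat n D) j i / Determinant.det (fmat n D)"
    using det d by (rule tendsto_divide)
  then show "(\<lambda>N. inv_entry (fmat n (C N)) i j) \<longlonglongrightarrow> inv_entry (fmat n D) i j"
    unfolding inv_entry_cofactor[OF d i j]
    by (rule Lim_transform_eventually)
       (use ev in eventually_elim, simp add: inv_entry_cofactor i j)
qed

section \<open>The potential restricted to a finite set\<close>

lemma sums_enn2real:
  assumes "(\<Sum>k. a k) = ennreal b" "\<And>k. a k = ennreal (c k)" "\<And>k. 0 \<le> c k" "0 \<le> b"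
  shows "c sums b"
proof -
  have "summable c" by (rule summable_suminf_not_top) (use assms in auto)
  moreover have "ennreal (\<Sum>k. c k) = ennreal b"
    using assms by (subst suminf_ennreal_eq[symmetric]) (auto intro: summable_sums calculation)
  then have "(\<Sum>k. c k) = b"
    using assms(3,4) suminf_nonneg[OF calculation] by (simp add: ennreal_inj)
  ultimately show ?thesis by (auto simp: sums_iff)
qed

context borel_right_process begin

lemma excessiveD:
  assumes f: "excessive P X f" and t: "0 < t"
  shows "semigroup_op P X t f j \<le> f j"
proof (rule tendsto_lowerbound)
  show "((\<lambda>s. semigroup_op P X s f j) \<longlongrightarrow> f j) (at_right 0)"
    using f by (auto simp: excessive_def)
  have "antimono_on {0<..} (\<lambda>t. semigroup_op P X t f j)" using f by (auto simp: excessive_def)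
  then have "semigroup_op P X t f j \<le> semigroup_op P X s f j" if "s \<in> {0<..<t}" for s
    using that t by (auto simp: monotone_on_def)
  then show "\<forall>\<^sub>F s in at_right 0. semigroup_op P X t f j \<le> semigroup_op P X s f j"
    using t eventually_at_right_real by (force elim: eventually_mono)
qed simp

lemma resolvent_finite: "0 < u \<Longrightarrow> resolvent u j k = ennreal (enn2real (resolvent u j k))"
  using le_less_trans[OF resolvent_le[of u j k] ennreal_less_top] by (simp add: ennreal_enn2real)

text \<open>This is \<open>contraction_comparison\<close> for the process, with
  \<open>R = l V_(l+e)\<close> and \<open>G = I + l V_e\<close>. The resolvent equation says
  \<open>G = I + R G\<close>, and the rows of \<open>R\<close> sum to at most
  \<open>l / (l + e)\<close>. The matrix in the hypotheses is a block of \<open>G / l\<close>, which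
  is why the charge enters as \<open>m' = m / l\<close>, moved to the states
  \<open>a, ..., a + n - 1\<close>.\<close>

lemma charge_nonneg:
  assumes lam: "0 < l" and e: "0 < e"
    and v: "\<And>j. 0 \<le> v j" "\<And>t j. 0 < t \<Longrightarrow> semigroup_op P X t (\<lambda>k. ennreal (v k)) j \<le> ennreal (v j)"
    and le: "\<And>i. i < n \<Longrightarrow>
      (\<Sum>k<n. (enn2real (resolvent e (a + i) (a + k)) + (if i = k then 1 / l else 0)) * m k) \<le> v (a + i)"
    and eq: "j < n"
      "(\<Sum>k<n. (enn2real (resolvent e (a + j) (a + k)) + (if j = k then 1 / l else 0)) * m k) = v (a + j)"
  shows "0 \<le> m j"
proof -
  let ?V = "\<lambda>u j k. enn2real (resolvent u j k)"
  define R where "R j k = l * ?V (l + e) j k" for j k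
  define G where "G j k = (if j = k then 1 else 0) + l * ?V e j k" for j k
  have le0: "0 < l + e" using lam e by simp
  have V: "resolvent u j k = ennreal (?V u j k)" if "0 < u" for u j k
    using resolvent_finite[OF that] .
  have row: "summable (?V u j)" "(\<Sum>k. ?V u j k) \<le> 1 / u" if u: "0 < u" for u j
  proof -
    have r: "(\<Sum>k. ennreal (?V u j k)) \<le> ennreal (1 / u)"
      using resolvent_row[OF u, of j] by (simp only: V[OF u, symmetric])
    show s: "summable (?V u j)"
      by (rule summable_suminf_not_top) (use r in \<open>auto simp: top_unique\<close>)
    have "ennreal (\<Sum>k. ?V u j k) \<le> ennreal (1 / u)"
      using r by (subst (asm) suminf_ennreal_eq[OF _ summable_sums[OF s]]) auto
    then show "(\<Sum>k. ?V u j k) \<le> 1 / u" using u by simp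
  qed
  have Vle: "?V u j k \<le> 1 / u" if u: "0 < u" for u j k
    using resolvent_le[OF u, of j k] u by (simp add: enn2real_leI)
  have exc: "(\<lambda>k. ?V u j k * v k) sums (\<Sum>k. ?V u j k * v k)" "u * (\<Sum>k. ?V u j k * v k) \<le> v j" if u: "0 < u" for u j
  proof -
    have r: "(\<Sum>k. ennreal (?V u j k * v k)) \<le> ennreal (1 / u * v j)"
    proof -
      have "ennreal (1 / u * v j) = ennreal (1 / u) * ennreal (v j)"
        using u v(1) by (intro ennreal_mult) auto
      then show ?thesis using resolvent_excessive[OF u v(2), of j]
        by (simp only: ennreal_mult[OF enn2real_nonneg v(1)] V[OF u, symmetric])
    qed
    have s: "summable (\<lambda>k. ?V u j k * v k)"
      by (rule summable_suminf_not_top) (use r v(1) in \<open>auto simp: top_unique\<close>)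
    then show "(\<lambda>k. ?V u j k * v k) sums (\<Sum>k. ?V u j k * v k)" by (rule summable_sums)
    have "ennreal (\<Sum>k. ?V u j k * v k) \<le> ennreal (1 / u * v j)"
      using r v(1) by (subst (asm) suminf_ennreal_eq[OF _ summable_sums[OF s]]) auto
    then have "(\<Sum>k. ?V u j k * v k) \<le> 1 / u * v j" using u v(1) by (subst (asm) ennreal_le_iff) auto
    then show "u * (\<Sum>k. ?V u j k * v k) \<le> v j" using u by (simp add: field_simps)
  qed
  have res: "(\<lambda>i. ?V (l + e) j i * ?V e i k) sums ((?V e j k - ?V (l + e) j k) / l)" for j k
  proof (rule sums_enn2real[OF _ refl])
    define x where "x = (\<Sum>i. ennreal (?V (l + e) j i * ?V e i k))"
    have eq: "ennreal (?V e j k) = ennreal (?V (l + e) j k) + ennreal l * x"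
      unfolding x_def ennreal_mult[OF enn2real_nonneg enn2real_nonneg] V[OF e, symmetric] V[OF le0, symmetric]
      by (rule resolvent_equation[OF lam e])
    \<comment> \<open>The series may be taken to the reals once it is known to be finite, and it is:
      \<open>l * x\<close> is a summand of a finite number.\<close>
    have "ennreal l * x \<noteq> \<top>"
    proof
      assume "ennreal l * x = \<top>"
      with eq show False by simp
    qed
    then have "x \<noteq> \<top>" using lam by (auto simp: ennreal_mult_eq_top_iff)
    then obtain y where y: "x = ennreal y" "0 \<le> y" by (cases x) auto
    then have "ennreal (?V e j k) = ennreal (?V (l + e) j k + l * y)"
      using eq lam by (simp add: ennreal_mult)
    then have "?V e j k = ?V (l + e) j k + l * y"
      using lam y by (subst (asm) ennreal_inj) auto
    then have "y = (?V e j k - ?V (l + e) j k) / l" using lam by (simp add: field_simps)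
    then show "x = ennreal ((?V e j k - ?V (l + e) j k) / l)" "0 \<le> (?V e j k - ?V (l + e) j k) / l"
      using y by auto
  qed simp_all
  define m' where "m' k = m (k - a) / l" for k
  have Gm: "(\<Sum>k\<in>{a..<a + n}. G (a + i) k * m' k) =
      (\<Sum>k<n. (?V e (a + i) (a + k) + (if i = k then 1 / l else 0)) * m k)" for i
  proof -
    have "(\<Sum>k\<in>{a..<a + n}. G (a + i) k * m' k) = (\<Sum>k<n. G (a + i) (a + k) * m' (a + k))"
      by (subst sum.atLeastLessThan_shift_0) (simp add: lessThan_atLeast0)
    also have "\<dots> = (\<Sum>k<n. (?V e (a + i) (a + k) + (if i = k then 1 / l else 0)) * m k)"
      using lam by (intro sum.cong refl) (auto simp: G_def m'_def field_simps)
    finally show ?thesis .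
  qed
  have "0 \<le> m' (a + j)"
  proof (rule contraction_comparison[where R = R and G = G and r = "l / (l + e)" and B = "1 + l / e" and v = v and S = "{a..<a + n}"])
    show "0 \<le> R j k" for j k using lam by (simp add: R_def)
    show "summable (R j)" for j unfolding R_def by (rule summable_mult[OF row(1)[OF le0]])
    show "(\<Sum>k. R j k) \<le> l / (l + e)" for j
      unfolding R_def suminf_mult[OF row(1)[OF le0]]
      using mult_left_mono[OF row(2)[OF le0, of j], of l] lam by simp
    show "l / (l + e) < 1" using lam e by simp
    show "0 \<le> G j i" for j i using lam by (simp add: G_def)
    show "G j i \<le> 1 + l / e" for j i
    proof -
      have "l * ?V e j i \<le> l * (1 / e)" using Vle[OF e] lam by (intro mult_left_mono) auto
      then show ?thesis using lam e by (auto simp: G_def)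
    qed
    show "G j i = (if j = i then 1 else 0) + (\<Sum>k. R j k * G k i)" for j i
    proof -
      have s1: "(\<lambda>k. if k = i then R j k else 0) sums R j i"
        using sums_single[of i "R j"] by simp
      have s2: "(\<lambda>k. l * l * (?V (l + e) j k * ?V e k i)) sums (l * l * ((?V e j i - ?V (l + e) j i) / l))"
        by (rule sums_mult[OF res])
      have "(\<lambda>k. R j k * G k i) = (\<lambda>k. (if k = i then R j k else 0) + l * l * (?V (l + e) j k * ?V e k i))"
        by (auto simp: R_def G_def fun_eq_iff algebra_simps)
      then have "(\<Sum>k. R j k * G k i) = R j i + l * l * ((?V e j i - ?V (l + e) j i) / l)"
        using sums_unique[OF sums_add[OF s1 s2]] by simp
      also have "\<dots> = l * ?V e j i" using lam by (simp add: R_def field_simps)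
      finally show ?thesis by (simp add: G_def)
    qed
    show "0 \<le> v j" for j by (rule v(1))
    show sv: "summable (\<lambda>k. R j k * v k)" for j
      unfolding R_def using summable_mult[OF sums_summable[OF exc(1)[OF le0, of j]], of l]
      by (simp add: mult.assoc)
    show "(\<Sum>k. R j k * v k) \<le> v j" for j
    proof -
      have S: "0 \<le> (\<Sum>k. ?V (l + e) j k * v k)"
        by (rule suminf_nonneg[OF sums_summable[OF exc(1)[OF le0]]]) (simp add: v(1))
      have "(\<Sum>k. R j k * v k) = l * (\<Sum>k. ?V (l + e) j k * v k)"
        unfolding R_def mult.assoc by (rule suminf_mult[OF sums_summable[OF exc(1)[OF le0]]])
      also have "\<dots> \<le> (l + e) * (\<Sum>k. ?V (l + e) j k * v k)"
        using S e by (intro mult_right_mono) auto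
      also have "\<dots> \<le> v j" by (rule exc(2)[OF le0])
      finally show ?thesis .
    qed
    show "(\<Sum>k\<in>{a..<a + n}. G i k * m' k) \<le> v i" if "i \<in> {a..<a + n}" for i
      using le[of "i - a"] Gm[of "i - a"] that by auto
    show "(\<Sum>k\<in>{a..<a + n}. G (a + j) k * m' k) = v (a + j)"
      using Gm eq(2) by simp
  qed (use eq(1) in auto)
  then show ?thesis using lam by (simp add: m'_def zero_le_divide_iff)
qed

lemma tendsto_resolvent:
  assumes tr: "transient_process P X"
  shows "(\<lambda>N. enn2real (resolvent (1 / real (Suc N)) j k)) \<longlonglongrightarrow> potential_density P X j k"
proof -
  have "(\<lambda>N. resolvent (1 / real (Suc N)) j k) \<longlonglongrightarrow> potential_ennreal P X j k"
    unfolding resolvent_def potential_ennreal_def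
  proof (rule nn_integral_LIMSEQ)
    show "incseq (\<lambda>N t. ennreal (exp (- (1 / real (Suc N) * t))) * (indicator {0..} t * ennreal (transition P X t j k)))"
    proof (rule incseq_SucI, rule le_funI)
      fix N and t :: real
      show "ennreal (exp (- (1 / real (Suc N) * t))) * (indicator {0..} t * ennreal (transition P X t j k))
        \<le> ennreal (exp (- (1 / real (Suc (Suc N)) * t))) * (indicator {0..} t * ennreal (transition P X t j k))"
      proof (cases "0 \<le> t")
        case True
        then have "1 / real (Suc (Suc N)) * t \<le> 1 / real (Suc N) * t"
          by (intro mult_right_mono) (auto simp: field_simps)
        then show ?thesis by (intro mult_right_mono) auto
      qed simp
    qed
    show "(\<lambda>N. ennreal (exp (- (1 / real (Suc N) * t))) * (indicator {0..} t * ennreal (transition P X t j k)))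
       \<longlonglongrightarrow> ennreal (transition P X t j k) * indicator {0..} t" for t
    proof -
      have "(\<lambda>N. exp (- (1 / real (Suc N) * t))) \<longlonglongrightarrow> exp (- (0 * t))"
        by (intro tendsto_intros LIMSEQ_Suc[OF lim_1_over_n])
      then have "(\<lambda>N. ennreal (exp (- (1 / real (Suc N) * t)) * (indicator {0..} t * transition P X t j k)))
         \<longlonglongrightarrow> ennreal (exp (- (0 * t)) * (indicator {0..} t * transition P X t j k))"
        by (intro tendsto_ennrealI tendsto_mult tendsto_const)
      then show ?thesis
        by (cases "0 \<le> t") (simp_all add: ennreal_mult transition_nonneg)
    qed
    show "(\<lambda>t. ennreal (exp (- (1 / real (Suc N) * t))) * (indicator {0..} t * ennreal (transition P X t j k))) \<in> borel_measurable lborel" for N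
      by measurable
  qed
  then show ?thesis
    unfolding potential_density_def using tr
    by (intro tendsto_enn2real) (auto simp: transient_process_def less_top)
qed

lemma potential_integral:
  assumes tr: "transient_process P X"
  shows "has_bochner_integral lborel (\<lambda>t. indicator {0..} t * transition P X t j k) (potential_density P X j k)"
proof (rule has_bochner_integral_nn_integral)
  have "(\<integral>\<^sup>+t. ennreal (indicator {0..} t * transition P X t j k) \<partial>lborel) = potential_ennreal P X j k"
    unfolding potential_ennreal_def by (intro nn_integral_cong) (auto simp: indicator_def)
  also have "\<dots> = ennreal (potential_density P X j k)"
    using tr by (simp add: potential_density_def transient_process_def)
  finally show "(\<integral>\<^sup>+t. ennreal (indicator {0..} t * transition P X t j k) \<partial>lborel) = ennreal (potential_density P X j k)" .
qed (auto simp: transition_nonneg potential_density_def)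

text \<open>By symmetry and Chapman-Kolmogorov the quadratic form of \<open>p_t\<close> is a sum
  over \<open>k\<close> of the squares \<open>(\<Sum>i x i p_(t/2)(i,k))\<^sup>2\<close>, hence
  non-negative. Its integral over \<open>t\<close> is strictly positive because the form is right
  continuous at 0, where it equals \<open>\<Sum>i (x i)\<^sup>2\<close>.\<close>

lemma posdef_potential:
  assumes tr: "transient_process P X" and sym: "symmetric_process P X"
  shows "posdef n (\<lambda>i j. potential_density P X (a + i) (a + j))"
proof -
  let ?U = "potential_density P X" and ?p = "transition P X"
  have p_sym: "?p t j k = ?p t k j" if "0 \<le> t" for t j k
    using sym that by (auto simp: symmetric_process_def)
  have "?U j k = ?U k j" for j k
    unfolding potential_density_def potential_ennreal_def
    by (intro arg_cong[where f = enn2real] nn_integral_cong) (auto simp: indicator_def p_sym)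
  moreover have "0 < (\<Sum>i<n. \<Sum>j<n. x i * x j * ?U (a + i) (a + j))" if x: "\<exists>i<n. x i \<noteq> 0" for x
  proof -
    define q where "q t = (\<Sum>i<n. \<Sum>j<n. x i * x j * ?p t (a + i) (a + j))" for t
    have q0: "0 \<le> q t" if t: "0 \<le> t" for t
    proof -
      have ck: "(\<lambda>k. ?p (t / 2) i k * ?p (t / 2) j k) sums ?p t i j" for i j
      proof (rule sums_enn2real[OF _ refl])
        have "ennreal (?p (t / 2 + t / 2) i j) = (\<Sum>k. ennreal (?p (t / 2) i k) * ennreal (?p (t / 2) k j))"
          using t by (intro chapman_kolmogorov) auto
        then show "(\<Sum>k. ennreal (?p (t / 2) i k * ?p (t / 2) j k)) = ennreal (?p t i j)"
          using t by (simp add: ennreal_mult transition_nonneg p_sym[of "t / 2" j])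
      qed (auto simp: transition_nonneg)
      have "(\<lambda>k. \<Sum>i<n. \<Sum>j<n. x i * x j * (?p (t / 2) (a + i) k * ?p (t / 2) (a + j) k)) sums q t"
        unfolding q_def by (intro sums_sum sums_mult ck)
      moreover have "(\<Sum>i<n. \<Sum>j<n. x i * x j * (?p (t / 2) (a + i) k * ?p (t / 2) (a + j) k)) =
          (\<Sum>i<n. x i * ?p (t / 2) (a + i) k)\<^sup>2" for k
        by (simp add: power2_eq_square sum_product ac_simps)
      ultimately have "(\<lambda>k. (\<Sum>i<n. x i * ?p (t / 2) (a + i) k)\<^sup>2) sums q t" by simp
      from sums_le[OF _ sums_zero this] show ?thesis by simp
    qed
    have q_int: "has_bochner_integral lborel (\<lambda>t. indicator {0..} t * q t)
       (\<Sum>i<n. \<Sum>j<n. x i * x j * ?U (a + i) (a + j))"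
    proof -
      have "has_bochner_integral lborel
          (\<lambda>t. \<Sum>i<n. \<Sum>j<n. x i * x j * (indicator {0..} t * ?p t (a + i) (a + j)))
          (\<Sum>i<n. \<Sum>j<n. x i * x j * ?U (a + i) (a + j))"
        by (intro has_bochner_integral_sum has_bochner_integral_mult_right potential_integral[OF tr])
      then show ?thesis unfolding q_def by (simp add: sum_distrib_left ac_simps)
    qed
    have "(q \<longlongrightarrow> q 0) (at_right 0)"
      unfolding q_def by (intro tendsto_sum tendsto_mult tendsto_const transition_right_continuous) simp
    moreover have "q 0 = (\<Sum>i<n. (x i)\<^sup>2)"
      unfolding q_def
    proof (rule sum.cong[OF refl])
      fix i assume "i \<in> {..<n}"
      have "(\<Sum>j<n. x i * x j * ?p 0 (a + i) (a + j)) = (\<Sum>j<n. if i = j then x i * x j else 0)"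
        by (intro sum.cong refl) (auto simp: transition_0)
      then show "(\<Sum>j<n. x i * x j * ?p 0 (a + i) (a + j)) = (x i)\<^sup>2"
        using \<open>i \<in> {..<n}\<close> by (simp add: power2_eq_square)
    qed
    moreover have "0 < (\<Sum>i<n. (x i)\<^sup>2)"
      using x by (auto intro!: sum_pos2)
    ultimately have "\<forall>\<^sub>F t in at_right 0. q 0 / 2 < q t" and q00: "0 < q 0"
      using order_tendstoD(1)[of q "q 0" "at_right 0" "q 0 / 2"] by auto
    then obtain d where d: "0 < d" "\<And>t. 0 < t \<Longrightarrow> t < d \<Longrightarrow> q 0 / 2 < q t"
      by (auto simp: eventually_at_right_field)
    have "0 < q 0 / 2 * d" using q00 d by simp
    also have "\<dots> = (\<integral>t. q 0 / 2 * indicator {0<..<d} t \<partial>lborel)"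
      using d by simp
    also have "\<dots> \<le> (\<integral>t. indicator {0..} t * q t \<partial>lborel)"
    proof (rule integral_mono)
      show "integrable lborel (\<lambda>t. q 0 / 2 * indicator {0<..<d} t)"
        using d(1) by (intro integrable_mult_right integrable_real_indicator) auto
      show "integrable lborel (\<lambda>t. indicator {0..} t * q t)"
        using q_int by (simp add: has_bochner_integral_iff)
      show "q 0 / 2 * indicator {0<..<d} t \<le> indicator {0..} t * q t" for t
        using d(2)[of t] q0[of t] by (auto simp: indicator_def)
    qed
    finally show ?thesis using q_int by (simp add: has_bochner_integral_iff)
  qed
  ultimately show ?thesis by (auto simp: posdef_def)
qed

text \<open>Both signs hold for the approximating blocks \<open>C N\<close>, in which
  \<open>l = N + 1\<close> and \<open>e = 1 / (N + 1)\<close>, and pass to the limit. For the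
  off-diagonal entries the charge is minus the column \<open>j\<close> of the inverse and the
  excessive function is 0: the potential of this charge is minus the unit vector at
  \<open>j\<close>, which is at most 0, with equality at every \<open>i \<noteq> j\<close>.\<close>

lemma inverse_potential:
  fixes a n :: nat
  assumes tr: "transient_process P X" and sym: "symmetric_process P X"
  defines "A \<equiv> inv_entry (block (potential_density P X) a n)"
  shows inverse_potential_excessive:
      "\<And>v j. (\<And>k. 0 \<le> v k) \<Longrightarrow>
        (\<And>t k. 0 < t \<Longrightarrow> semigroup_op P X t (\<lambda>k. ennreal (v k)) k \<le> ennreal (v k)) \<Longrightarrow>
        j < n \<Longrightarrow> 0 \<le> (\<Sum>k<n. A j k * v (a + k))"
    and inverse_potential_offdiag: "\<And>i j. i < n \<Longrightarrow> j < n \<Longrightarrow> i \<noteq> j \<Longrightarrow> A i j \<le> 0"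
proof -
  define U where "U = (\<lambda>i j. potential_density P X (a + i) (a + j))"
  define C where "C N i j = enn2real (resolvent (1 / real (Suc N)) (a + i) (a + j)) +
    (if i = j then 1 / real (Suc N) else 0)" for N i j
  have A: "A = inv_entry (fmat n U)"
    by (simp add: A_def block_def U_def)
  have lim: "(\<lambda>N. C N i j) \<longlonglongrightarrow> U i j" for i j
  proof -
    have "(\<lambda>N. if i = j then 1 / real (Suc N) else 0) \<longlonglongrightarrow> 0"
      using LIMSEQ_Suc[OF lim_1_over_n] by (cases "i = j") auto
    from tendsto_add[OF tendsto_resolvent[OF tr] this] show ?thesis
      unfolding C_def U_def by simp
  qed
  have d: "Determinant.det (fmat n U) \<noteq> 0"
    using posdef_det_pos[OF posdef_potential[OF tr sym, of n a]] by (simp add: U_def)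
  have A_lim: "(\<lambda>N. inv_entry (fmat n (C N)) i j) \<longlonglongrightarrow> A i j" if "i < n" "j < n" for i j
    unfolding A using tendsto_inv_entry(1)[OF lim d that] .
  have ev: "\<forall>\<^sub>F N in sequentially. Determinant.det (fmat n (C N)) \<noteq> 0" if "0 < n"
    using tendsto_inv_entry(2)[OF lim d that that] .
  show "0 \<le> (\<Sum>k<n. A j k * v (a + k))"
    if v: "\<And>k. 0 \<le> v k" "\<And>t k. 0 < t \<Longrightarrow> semigroup_op P X t (\<lambda>k. ennreal (v k)) k \<le> ennreal (v k)"
      and j: "j < n" for v j
  proof (rule tendsto_lowerbound)
    show "(\<lambda>N. \<Sum>k<n. inv_entry (fmat n (C N)) j k * v (a + k)) \<longlonglongrightarrow> (\<Sum>k<n. A j k * v (a + k))"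
      by (intro tendsto_sum tendsto_mult tendsto_const A_lim j) auto
    have "0 < n" using j by simp
    from ev[OF this] show "\<forall>\<^sub>F N in sequentially. 0 \<le> (\<Sum>k<n. inv_entry (fmat n (C N)) j k * v (a + k))"
    proof eventually_elim
      case (elim N)
      let ?m = "\<lambda>j. \<Sum>k<n. inv_entry (fmat n (C N)) j k * v (a + k)"
      have sol: "(\<Sum>k<n. C N i k * ?m k) = v (a + i)" if i: "i < n" for i
      proof -
        have "(\<Sum>k<n. C N i k * ?m k) = (\<Sum>l<n. (\<Sum>k<n. C N i k * inv_entry (fmat n (C N)) k l) * v (a + l))"
          unfolding sum_distrib_left sum_distrib_right mult.assoc by (rule sum.swap)
        also have "\<dots> = (\<Sum>l<n. if i = l then v (a + l) else 0)"
          by (intro sum.cong refl) (simp add: inv_entry_right[OF elim i])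
        finally show ?thesis using i by simp
      qed
      show ?case
        by (rule charge_nonneg[where l = "real (Suc N)" and e = "1 / real (Suc N)" and n = n and a = a, OF _ _ v _ j])
           (use sol j in \<open>simp_all add: C_def\<close>)
    qed
  qed simp
  show "A i j \<le> 0" if ij: "i < n" "j < n" "i \<noteq> j" for i j
  proof (rule tendsto_upperbound)
    show "(\<lambda>N. inv_entry (fmat n (C N)) i j) \<longlonglongrightarrow> A i j" by (rule A_lim[OF ij(1,2)])
    have "0 < n" using ij by simp
    from ev[OF this] show "\<forall>\<^sub>F N in sequentially. inv_entry (fmat n (C N)) i j \<le> 0"
    proof eventually_elim
      case (elim N)
      let ?m = "\<lambda>i. - inv_entry (fmat n (C N)) i j"
      have sol: "(\<Sum>k<n. C N i k * ?m k) = - (if i = j then 1 else 0)" if i: "i < n" for i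
        using inv_entry_right[OF elim i ij(2)] by (simp add: sum_negf)
      have "0 \<le> ?m i"
        by (rule charge_nonneg[where l = "real (Suc N)" and e = "1 / real (Suc N)" and n = n and a = a and v = "\<lambda>_. 0"])
           (use sol ij in \<open>simp_all add: C_def semigroup_op_def\<close>)
      then show ?case by simp
    qed
  qed simp
qed

end

section \<open>Laplace transforms of measures on sequences\<close>

text \<open>One space of infinite sequences serves all block lengths; \<open>laplace_of n\<close>
  looks at the first \<open>n\<close> coordinates.\<close>

abbreviation seqM :: "(nat \<Rightarrow> real) measure" where
  "seqM \<equiv> Pi\<^sub>M UNIV (\<lambda>_. borel)"

text \<open>The absolute values spare the assumption that \<open>M\<close> lives on non-negative sequences.\<close>

definition laplace_of :: "nat \<Rightarrow> (nat \<Rightarrow> real) measure \<Rightarrow> ((nat \<Rightarrow> real) \<Rightarrow> real) \<Rightarrow> bool" where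
  "laplace_of n M L \<longleftrightarrow> sets M = sets seqM \<and>
    (\<forall>s. (\<forall>i. 0 \<le> s i) \<longrightarrow> 0 \<le> L s \<and>
      (\<integral>\<^sup>+z. ennreal (exp (- (\<Sum>i<n. s i * \<bar>z i\<bar>))) \<partial>M) = ennreal (L s))"

text \<open>In the elimination these functions take the place of non-negative numbers: they are
  closed under sums, products and convergent series. In addition they are largest at
  \<open>s = 0\<close>, so that positivity of a pivot has to be checked there only.\<close>

definition is_laplace :: "nat \<Rightarrow> ((nat \<Rightarrow> real) \<Rightarrow> real) \<Rightarrow> bool" where
  "is_laplace n L \<longleftrightarrow> (\<exists>M. laplace_of n M L)"

lemma laplace_ofD:
  assumes "laplace_of n M L"
  shows "sets M = sets seqM" "\<And>s. \<forall>i. 0 \<le> s i \<Longrightarrow> 0 \<le> L s"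
    "\<And>s. \<forall>i. 0 \<le> s i \<Longrightarrow> (\<integral>\<^sup>+z. ennreal (exp (- (\<Sum>i<n. s i * \<bar>z i\<bar>))) \<partial>M) = ennreal (L s)"
  using assms by (auto simp: laplace_of_def)

lemma laplace_of_space: "laplace_of n M L \<Longrightarrow> space M = UNIV"
  using sets_eq_imp_space_eq[OF laplace_ofD(1)] by (simp add: space_PiM)

lemma laplace_of_emeasure: "laplace_of n M L \<Longrightarrow> emeasure M (space M) = ennreal (L (\<lambda>_. 0))"
  using laplace_ofD(3)[of n M L "\<lambda>_. 0"] by simp

lemma laplace_of_finite: "laplace_of n M L \<Longrightarrow> finite_measure M"
  by (rule finite_measureI) (simp add: laplace_of_emeasure)

lemma laplace_of_cong:
  assumes "laplace_of n M L" "\<And>s. \<forall>i. 0 \<le> s i \<Longrightarrow> L s = L' s"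
  shows "laplace_of n M L'"
  using assms by (simp add: laplace_of_def)

lemma is_laplace_cong:
  assumes "is_laplace n L" "\<And>s. \<forall>i. 0 \<le> s i \<Longrightarrow> L s = L' s"
  shows "is_laplace n L'"
  using assms laplace_of_cong unfolding is_laplace_def by blast

lemma is_laplace_nonneg: "is_laplace n L \<Longrightarrow> \<forall>i. 0 \<le> s i \<Longrightarrow> 0 \<le> L s"
  using laplace_ofD(2) unfolding is_laplace_def by blast

lemma is_laplace_le_0:
  assumes "is_laplace n L" "\<forall>i. 0 \<le> s i"
  shows "L s \<le> L (\<lambda>_. 0)"
proof -
  obtain M where M: "laplace_of n M L" using assms(1) by (auto simp: is_laplace_def)
  have "ennreal (L s) = (\<integral>\<^sup>+z. ennreal (exp (- (\<Sum>i<n. s i * \<bar>z i\<bar>))) \<partial>M)"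
    by (rule laplace_ofD(3)[OF M assms(2), symmetric])
  also have "\<dots> \<le> (\<integral>\<^sup>+z. 1 \<partial>M)"
    using assms(2) by (intro nn_integral_mono) (simp add: sum_nonneg)
  also have "\<dots> = ennreal (L (\<lambda>_. 0))" using laplace_of_emeasure[OF M] by simp
  finally show ?thesis using laplace_ofD(2)[OF M, of "\<lambda>_. 0"] by simp
qed

section \<open>Series and products of Laplace transforms\<close>

lemma measurable_laplace_kernel [measurable]:
  "(\<lambda>z. ennreal (exp (- (\<Sum>i<n. s i * \<bar>z i\<bar>)))) \<in> borel_measurable seqM"
  by measurable

text \<open>The sum over \<open>k\<close> is written as an integral over the counting measure, so
  that countable additivity is an interchange of an integral with a series.\<close>

definition sum_measure :: "'a measure \<Rightarrow> (nat \<Rightarrow> 'a measure) \<Rightarrow> 'a measure" where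
  "sum_measure S M = measure_of (space S) (sets S) (\<lambda>A. \<integral>\<^sup>+k. emeasure (M k) A \<partial>count_space UNIV)"

lemma
  assumes M: "\<And>k. sets (M k) = sets S"
  shows sets_sum_measure: "sets (sum_measure S M) = sets S"
    and emeasure_sum_measure: "\<And>A. A \<in> sets S \<Longrightarrow> emeasure (sum_measure S M) A = (\<Sum>k. emeasure (M k) A)"
proof -
  show s: "sets (sum_measure S M) = sets S"
    by (simp add: sum_measure_def)
  show "emeasure (sum_measure S M) A = (\<Sum>k. emeasure (M k) A)" if A: "A \<in> sets S" for A
  proof -
    have "emeasure (sum_measure S M) A = (\<integral>\<^sup>+k. emeasure (M k) A \<partial>count_space UNIV)"
    proof (rule emeasure_measure_of[OF sum_measure_def])
      show "sets S \<subseteq> Pow (space S)" by (rule sets.space_closed)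
      show "A \<in> sets (sum_measure S M)" using A s by simp
      show "positive (sets (sum_measure S M)) (\<lambda>A. \<integral>\<^sup>+k. emeasure (M k) A \<partial>count_space UNIV)"
        by (simp add: positive_def)
      show "countably_additive (sets (sum_measure S M)) (\<lambda>A. \<integral>\<^sup>+k. emeasure (M k) A \<partial>count_space UNIV)"
      proof (rule countably_additiveI)
        fix B :: "nat \<Rightarrow> _" assume B: "range B \<subseteq> sets (sum_measure S M)" "disjoint_family B"
        have "(\<Sum>i. \<integral>\<^sup>+k. emeasure (M k) (B i) \<partial>count_space UNIV) =
            (\<integral>\<^sup>+k. (\<Sum>i. emeasure (M k) (B i)) \<partial>count_space UNIV)"
          by (rule nn_integral_suminf[symmetric]) simp
        also have "\<dots> = (\<integral>\<^sup>+k. emeasure (M k) (\<Union>i. B i) \<partial>count_space UNIV)"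
          by (intro nn_integral_cong suminf_emeasure) (use B s M in auto)
        finally show "(\<Sum>i. \<integral>\<^sup>+k. emeasure (M k) (B i) \<partial>count_space UNIV) =
            (\<integral>\<^sup>+k. emeasure (M k) (\<Union>i. B i) \<partial>count_space UNIV)" .
      qed
    qed
    then show ?thesis by (simp add: nn_integral_count_space_nat)
  qed
qed

lemma nn_integral_sum_measure:
  assumes M: "\<And>k. sets (M k) = sets S" and f: "f \<in> borel_measurable S"
  shows "(\<integral>\<^sup>+x. f x \<partial>sum_measure S M) = (\<Sum>k. \<integral>\<^sup>+x. f x \<partial>M k)"
  using f
proof (induction f rule: borel_measurable_induct)
  have [simp]: "g \<in> borel_measurable (sum_measure S M) \<longleftrightarrow> g \<in> borel_measurable S" for g :: "_ \<Rightarrow> ennreal"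
    by (rule arg_cong2[where f = "(\<in>)", OF refl measurable_cong_sets]) (simp_all add: sets_sum_measure[OF M])
  have [simp]: "g \<in> borel_measurable (M k) \<longleftrightarrow> g \<in> borel_measurable S" for g :: "_ \<Rightarrow> ennreal" and k
    by (rule arg_cong2[where f = "(\<in>)", OF refl measurable_cong_sets]) (simp_all add: M)
  have sp: "space (sum_measure S M) = space S" "space (M k) = space S" for k
    using sets_eq_imp_space_eq[OF sets_sum_measure[OF M]] sets_eq_imp_space_eq[OF M] by auto
  {
    case (cong f g)
    have "(\<integral>\<^sup>+x. g x \<partial>sum_measure S M) = (\<integral>\<^sup>+x. f x \<partial>sum_measure S M)"
      by (intro nn_integral_cong) (use cong sp in auto)
    moreover have "(\<integral>\<^sup>+x. g x \<partial>M k) = (\<integral>\<^sup>+x. f x \<partial>M k)" for k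
      by (intro nn_integral_cong) (use cong sp in auto)
    ultimately show ?case using cong(4) by simp
  next
    case (set A)
    then show ?case
      using emeasure_sum_measure[OF M] by (simp add: nn_integral_indicator sets_sum_measure[OF M] M)
  next
    case (mult u c)
    then show ?case by (simp add: nn_integral_cmult)
  next
    case (add u v)
    then show ?case by (simp add: nn_integral_add suminf_add)
  next
    case (seq U)
    have "(\<integral>\<^sup>+x. (SUP i. U i) x \<partial>sum_measure S M) = (SUP i. \<integral>\<^sup>+x. U i x \<partial>sum_measure S M)"
      unfolding SUP_apply by (rule nn_integral_monotone_convergence_SUP) (use seq in auto)
    also have "\<dots> = (SUP i. \<integral>\<^sup>+k. (\<integral>\<^sup>+x. U i x \<partial>M k) \<partial>count_space UNIV)"
      using seq by (simp add: nn_integral_count_space_nat)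
    also have "\<dots> = (\<integral>\<^sup>+k. (SUP i. \<integral>\<^sup>+x. U i x \<partial>M k) \<partial>count_space UNIV)"
      by (rule nn_integral_monotone_convergence_SUP[symmetric])
         (use seq in \<open>auto simp: incseq_def le_fun_def intro!: nn_integral_mono\<close>)
    also have "\<dots> = (\<integral>\<^sup>+k. (\<integral>\<^sup>+x. (SUP i. U i) x \<partial>M k) \<partial>count_space UNIV)"
      unfolding SUP_apply
      by (intro nn_integral_cong nn_integral_monotone_convergence_SUP[symmetric]) (use seq in auto)
    finally show ?case by (simp add: nn_integral_count_space_nat)
  }
qed

lemma is_laplace_sums:
  assumes "\<And>k. is_laplace n (L k)" "\<And>s. \<forall>i. 0 \<le> s i \<Longrightarrow> (\<lambda>k. L k s) sums L' s"
  shows "is_laplace n L'"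
proof -
  obtain M where M: "\<And>k. laplace_of n (M k) (L k)"
    using assms(1) unfolding is_laplace_def by metis
  have "laplace_of n (sum_measure seqM M) L'"
    unfolding laplace_of_def
  proof (intro conjI allI impI)
    show "sets (sum_measure seqM M) = sets seqM"
      by (rule sets_sum_measure) (rule laplace_ofD(1)[OF M])
    fix s :: "nat \<Rightarrow> real" assume s: "\<forall>i. 0 \<le> s i"
    then have L: "0 \<le> L k s" for k using laplace_ofD(2)[OF M] by simp
    show "0 \<le> L' s"
      using sums_le[OF _ sums_zero assms(2)[of s]] L s by simp
    have "(\<integral>\<^sup>+z. ennreal (exp (- (\<Sum>i<n. s i * \<bar>z i\<bar>))) \<partial>sum_measure seqM M) =
        (\<Sum>k. \<integral>\<^sup>+z. ennreal (exp (- (\<Sum>i<n. s i * \<bar>z i\<bar>))) \<partial>M k)"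
      by (rule nn_integral_sum_measure[OF laplace_ofD(1)[OF M]]) measurable
    also have "\<dots> = (\<Sum>k. ennreal (L k s))"
      using s by (intro suminf_cong laplace_ofD(3)[OF M]) auto
    also have "\<dots> = ennreal (L' s)"
      using assms(2)[of s] s L by (intro suminf_ennreal_eq) auto
    finally show "(\<integral>\<^sup>+z. ennreal (exp (- (\<Sum>i<n. s i * \<bar>z i\<bar>))) \<partial>sum_measure seqM M) = ennreal (L' s)" .
  qed
  then show ?thesis by (auto simp: is_laplace_def)
qed

lemma is_laplace_const:
  assumes "0 \<le> c"
  shows "is_laplace n (\<lambda>_. c)"
proof -
  have "laplace_of n (density (return seqM (\<lambda>_. 0)) (\<lambda>_. ennreal c)) (\<lambda>_. c)"
    using assms
    by (auto simp: laplace_of_def nn_integral_density nn_integral_return space_PiM)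
  then show ?thesis by (auto simp: is_laplace_def)
qed

lemma is_laplace_add:
  assumes "is_laplace n L1" "is_laplace n L2"
  shows "is_laplace n (\<lambda>s. L1 s + L2 s)"
proof (rule is_laplace_sums)
  show "is_laplace n ((\<lambda>k. if k = 0 then L1 else if k = 1 then L2 else (\<lambda>_. 0)) k)" for k :: nat
    using assms is_laplace_const[of 0] by auto
  show "(\<lambda>k. (if k = 0 then L1 else if k = 1 then L2 else (\<lambda>_. 0)) s) sums (L1 s + L2 s)" for s
    using sums_finite[of "{0, 1::nat}" "\<lambda>k. (if k = 0 then L1 else if k = 1 then L2 else (\<lambda>_. 0)) s"] by auto
qed

text \<open>With absolute values in both arguments the Laplace kernel at the sum is exactly the
  product of the kernels, whatever the signs of the coordinates.\<close>

definition convol :: "(nat \<Rightarrow> real) measure \<Rightarrow> (nat \<Rightarrow> real) measure \<Rightarrow> (nat \<Rightarrow> real) measure" where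
  "convol M1 M2 = distr (M1 \<Otimes>\<^sub>M M2) seqM (\<lambda>(x, y) i. \<bar>x i\<bar> + \<bar>y i\<bar>)"

lemma measurable_convol:
  assumes "sets M1 = sets seqM" "sets M2 = sets seqM"
  shows "(\<lambda>(x, y) i. \<bar>x i\<bar> + \<bar>y i :: real\<bar>) \<in> M1 \<Otimes>\<^sub>M M2 \<rightarrow>\<^sub>M seqM"
proof -
  have "(\<lambda>(x, y) i. \<bar>x i\<bar> + \<bar>y i :: real\<bar>) \<in> seqM \<Otimes>\<^sub>M seqM \<rightarrow>\<^sub>M seqM"
    unfolding split_def by (rule measurable_PiM_single') (auto simp: space_PiM)
  then show ?thesis by (simp add: measurable_cong_sets[OF sets_pair_measure_cong[OF assms] refl])
qed

lemma laplace_of_convol: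
  assumes 1: "laplace_of n M1 L1" and 2: "laplace_of n M2 L2"
  shows "laplace_of n (convol M1 M2) (\<lambda>s. L1 s * L2 s)"
  unfolding laplace_of_def
proof (intro conjI allI impI)
  show "sets (convol M1 M2) = sets seqM" by (simp add: convol_def)
  fix s :: "nat \<Rightarrow> real" assume s: "\<forall>i. 0 \<le> s i"
  then have nn: "0 \<le> L1 s" "0 \<le> L2 s" using laplace_ofD(2)[OF 1] laplace_ofD(2)[OF 2] by auto
  then show "0 \<le> L1 s * L2 s" by simp
  interpret M2: finite_measure M2 by (rule laplace_of_finite[OF 2])
  let ?e = "\<lambda>z. ennreal (exp (- (\<Sum>i<n. s i * \<bar>z i\<bar>)))"
  have m1: "?e \<in> borel_measurable M1" and m2: "?e \<in> borel_measurable M2"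
    using measurable_cong_sets[OF laplace_ofD(1)[OF 1] refl] measurable_cong_sets[OF laplace_ofD(1)[OF 2] refl]
      measurable_laplace_kernel by blast+
  have m: "(\<lambda>(x, y) i. \<bar>x i\<bar> + \<bar>y i :: real\<bar>) \<in> M1 \<Otimes>\<^sub>M M2 \<rightarrow>\<^sub>M seqM"
    by (rule measurable_convol[OF laplace_ofD(1)[OF 1] laplace_ofD(1)[OF 2]])
  have "(\<integral>\<^sup>+z. ?e z \<partial>convol M1 M2) = (\<integral>\<^sup>+p. ?e (\<lambda>i. \<bar>fst p i\<bar> + \<bar>snd p i\<bar>) \<partial>(M1 \<Otimes>\<^sub>M M2))"
    unfolding convol_def by (subst nn_integral_distr[OF m]) (auto simp: split_def)
  also have "\<dots> = (\<integral>\<^sup>+p. ?e (fst p) * ?e (snd p) \<partial>(M1 \<Otimes>\<^sub>M M2))"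
    by (intro nn_integral_cong)
       (simp add: ennreal_mult[symmetric] exp_add[symmetric] distrib_left sum.distrib)
  also have "\<dots> = (\<integral>\<^sup>+x. \<integral>\<^sup>+y. ?e x * ?e y \<partial>M2 \<partial>M1)"
    by (subst M2.nn_integral_fst[symmetric])
       (auto intro!: borel_measurable_times_ennreal measurable_compose[OF measurable_fst m1] measurable_compose[OF measurable_snd m2])
  also have "\<dots> = (\<integral>\<^sup>+x. ?e x * ennreal (L2 s) \<partial>M1)"
    using laplace_ofD(3)[OF 2] s by (simp add: nn_integral_cmult[OF m2])
  also have "\<dots> = ennreal (L1 s) * ennreal (L2 s)"
    using laplace_ofD(3)[OF 1] s by (simp add: nn_integral_multc[OF m1])
  finally show "(\<integral>\<^sup>+z. ?e z \<partial>convol M1 M2) = ennreal (L1 s * L2 s)"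
    using nn by (simp add: ennreal_mult)
qed

lemma is_laplace_mult:
  "is_laplace n L1 \<Longrightarrow> is_laplace n L2 \<Longrightarrow> is_laplace n (\<lambda>s. L1 s * L2 s)"
  using laplace_of_convol unfolding is_laplace_def by blast

lemma is_laplace_power: "is_laplace n L \<Longrightarrow> is_laplace n (\<lambda>s. L s ^ k)"
  by (induction k) (auto intro: is_laplace_mult is_laplace_const)

section \<open>Gamma measures and the binomial series\<close>

lemma nn_integral_gamma_kernel:
  fixes c g :: real
  assumes c: "0 < c" and g: "0 < g"
  shows "(\<integral>\<^sup>+t. ennreal (indicator {0..} t * t powr (g - 1) * exp (- (c * t))) \<partial>lborel) = ennreal (Gamma g * c powr (- g))"
proof -
  have "ennreal (Gamma g) = (\<integral>\<^sup>+t. ennreal (indicator {0..} t * t powr (g - 1) / exp t) \<partial>lborel)"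
    by (simp add: Gamma_conv_nn_integral_real[OF g])
  also have "\<dots> = ennreal c * (\<integral>\<^sup>+t. ennreal (indicator {0..} (c * t) * (c * t) powr (g - 1) / exp (c * t)) \<partial>lborel)"
    using c by (subst nn_integral_real_affine[where c = c and t = 0]) auto
  also have "\<dots> = ennreal c * (\<integral>\<^sup>+t. ennreal (c powr (g - 1)) * ennreal (indicator {0..} t * t powr (g - 1) * exp (- (c * t))) \<partial>lborel)"
    using c
    by (intro arg_cong2[where f = "(*)"] nn_integral_cong refl)
       (auto simp: ennreal_mult[symmetric] powr_mult exp_minus field_simps zero_le_mult_iff split: split_indicator)
  also have "\<dots> = ennreal (c * c powr (g - 1)) * (\<integral>\<^sup>+t. ennreal (indicator {0..} t * t powr (g - 1) * exp (- (c * t))) \<partial>lborel)"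
    using c by (subst nn_integral_cmult) (auto simp: ennreal_mult mult.assoc)
  also have "c * c powr (g - 1) = c powr g" using c by (simp add: powr_diff)
  finally have *: "ennreal (Gamma g) = ennreal (c powr g) * (\<integral>\<^sup>+t. ennreal (indicator {0..} t * t powr (g - 1) * exp (- (c * t))) \<partial>lborel)" .
  have "ennreal (c powr (- g)) * ennreal (Gamma g) = ennreal (c powr (- g)) * ennreal (c powr g) *
      (\<integral>\<^sup>+t. ennreal (indicator {0..} t * t powr (g - 1) * exp (- (c * t))) \<partial>lborel)"
    by (subst *) (simp add: mult.assoc)
  also have "ennreal (c powr (- g)) * ennreal (c powr g) = 1"
    using c by (simp add: ennreal_mult[symmetric] powr_add[symmetric])
  finally show ?thesis using g by (simp add: ennreal_mult Gamma_real_pos less_imp_le mult.commute)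
qed

text \<open>The measure lives on the \<open>i\<close>-th axis and has density
  \<open>t powr (g - 1) * exp (- (a * t)) / Gamma g\<close> there; its total mass is
  \<open>a powr (- g)\<close>.\<close>

lemma is_laplace_gamma:
  assumes a: "0 < a" and g: "0 < g" and i: "i < n"
  shows "is_laplace n (\<lambda>s. (a + s i) powr (- g))"
proof -
  define D where "D = density lborel (\<lambda>t. ennreal (indicator {0..} t * t powr (g - 1) * exp (- (a * t)) / Gamma g))"
  define M where "M = distr D seqM (\<lambda>t j. if j = i then t else 0)"
  have m: "(\<lambda>t j. if j = i then t else 0) \<in> D \<rightarrow>\<^sub>M seqM"
    by (rule measurable_PiM_single') (auto simp: space_PiM D_def)
  have G: "0 < Gamma g" by (rule Gamma_real_pos[OF g])
  have "laplace_of n M (\<lambda>s. (a + s i) powr (- g))"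
    unfolding laplace_of_def
  proof (intro conjI allI impI)
    show "sets M = sets seqM" by (simp add: M_def)
    fix s :: "nat \<Rightarrow> real" assume s: "\<forall>i. 0 \<le> s i"
    have as: "0 < a + s i" using a s by (simp add: add_pos_nonneg)
    have "(\<integral>\<^sup>+z. ennreal (exp (- (\<Sum>i<n. s i * \<bar>z i\<bar>))) \<partial>M) =
        (\<integral>\<^sup>+t. ennreal (exp (- (\<Sum>j<n. s j * \<bar>if j = i then t else 0\<bar>))) \<partial>D)"
      unfolding M_def by (subst nn_integral_distr[OF m]) auto
    also have "\<dots> = (\<integral>\<^sup>+t. ennreal (exp (- (s i * \<bar>t\<bar>))) \<partial>D)"
    proof (intro nn_integral_cong)
      fix t :: real
      have "(\<Sum>j<n. s j * \<bar>if j = i then t else 0\<bar>) = (\<Sum>j<n. if j = i then s j * \<bar>t\<bar> else 0)"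
        by (intro sum.cong) auto
      then show "ennreal (exp (- (\<Sum>j<n. s j * \<bar>if j = i then t else 0\<bar>))) = ennreal (exp (- (s i * \<bar>t\<bar>)))"
        using i by simp
    qed
    also have "\<dots> = (\<integral>\<^sup>+t. ennreal (1 / Gamma g) * ennreal (indicator {0..} t * t powr (g - 1) * exp (- ((a + s i) * t))) \<partial>lborel)"
      unfolding D_def
      by (subst nn_integral_density)
         (use G in \<open>auto intro!: nn_integral_cong simp: ennreal_mult[symmetric] distrib_right exp_add exp_diff exp_minus field_simps split: split_indicator\<close>)
    also have "\<dots> = ennreal (1 / Gamma g) * ennreal (Gamma g * (a + s i) powr (- g))"
      by (subst nn_integral_cmult) (simp_all add: nn_integral_gamma_kernel[OF as g])
    also have "\<dots> = ennreal ((a + s i) powr (- g))"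
      using G by (simp add: ennreal_mult[symmetric])
    finally show "(\<integral>\<^sup>+z. ennreal (exp (- (\<Sum>i<n. s i * \<bar>z i\<bar>))) \<partial>M) = ennreal ((a + s i) powr (- g))" .
  qed simp
  then show ?thesis by (auto simp: is_laplace_def)
qed

text \<open>With \<open>x = a + s i\<close>, expand \<open>(x - q) powr (- \<alpha>)\<close> in
  powers of \<open>q\<close>: the term of order \<open>k\<close> is \<open>pochhammer \<alpha> k /
  fact k * q ^ k * x powr (- (\<alpha> + k))\<close>, since the sign of the binomial coefficient
  cancels that of \<open>(- q) ^ k\<close>. Every term is a Laplace transform, and the series
  converges because \<open>0 \<le> q s \<le> q 0 < a\<close>. The second claim leaves out the term
  \<open>k = 0\<close>.\<close>

lemma is_laplace_binomial:
  assumes q: "is_laplace n q" "q (\<lambda>_. 0) < a" and al: "0 < \<alpha>" and i: "i < n"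
  shows "is_laplace n (\<lambda>s. (a + s i - q s) powr (- \<alpha>))"
    and "is_laplace n (\<lambda>s. (a + s i - q s) powr (- \<alpha>) - (a + s i) powr (- \<alpha>))"
proof -
  have q0: "0 \<le> q (\<lambda>_. 0)" using is_laplace_nonneg[OF q(1)] by simp
  then have a: "0 < a" using q(2) by simp
  define T where "T k s = pochhammer \<alpha> k / fact k * q s ^ k * (a + s i) powr (- (\<alpha> + real k))" for k s
  have T: "is_laplace n (T k)" for k
    unfolding T_def[abs_def] using al a
    by (intro is_laplace_mult is_laplace_const is_laplace_power is_laplace_gamma q i)
       (auto intro!: divide_nonneg_nonneg pochhammer_nonneg)
  have sums: "(\<lambda>k. T k s) sums (a + s i - q s) powr (- \<alpha>)" if s: "\<forall>i. 0 \<le> s i" for s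
  proof -
    have "\<bar>- q s\<bar> < a + s i"
      using is_laplace_nonneg[OF q(1) s] is_laplace_le_0[OF q(1) s] q(2) spec[OF s, of i] by simp
    from gen_binomial_real'[OF this, of "- \<alpha>"]
    have "(\<lambda>k. (- \<alpha> gchoose k) * (- q s) ^ k * (a + s i) powr (- \<alpha> - real k)) sums (- q s + (a + s i)) powr (- \<alpha>)" .
    moreover have "(- \<alpha> gchoose k) * (- q s) ^ k * (a + s i) powr (- \<alpha> - real k) = T k s" for k
    proof -
      have "(-1) ^ k * (-1 :: real) ^ k = 1" by (simp flip: power_mult_distrib)
      then show ?thesis
        unfolding T_def gbinomial_pochhammer power_minus[of "q s"] by (simp add: algebra_simps)
    qed
    ultimately show ?thesis by (simp add: algebra_simps)
  qed
  show "is_laplace n (\<lambda>s. (a + s i - q s) powr (- \<alpha>))"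
    by (rule is_laplace_sums[OF T sums])
  show "is_laplace n (\<lambda>s. (a + s i - q s) powr (- \<alpha>) - (a + s i) powr (- \<alpha>))"
  proof (rule is_laplace_sums[where L = "\<lambda>k. T (Suc k)", OF T])
    fix s :: "nat \<Rightarrow> real" assume "\<forall>i. 0 \<le> s i"
    from sums[OF this] show "(\<lambda>k. T (Suc k) s) sums ((a + s i - q s) powr (- \<alpha>) - (a + s i) powr (- \<alpha>))"
      by (subst sums_Suc_iff) (simp add: T_def)
  qed
qed

section \<open>Gaussian elimination with Laplace transforms as entries\<close>

definition perturbed :: "(nat \<Rightarrow> real) \<Rightarrow> (nat \<Rightarrow> nat \<Rightarrow> (nat \<Rightarrow> real) \<Rightarrow> real) \<Rightarrow> (nat \<Rightarrow> real) \<Rightarrow> nat \<Rightarrow> nat \<Rightarrow> real" where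
  "perturbed a q s i j = (if i = j then a i + s i else 0) - q i j s"

text \<open>The shape \<open>diag (a + s) - q\<close> survives an elimination step: \<open>a\<close>
  and \<open>s\<close> stay, and \<open>q i j\<close> becomes
  \<open>q i j + q i n * q n j / pivot\<close>, where the reciprocal of the pivot is a Laplace
  transform by the binomial series with exponent 1. Such corrections also reach the diagonal, so
  \<open>q\<close> has to be allowed there.\<close>

lemma perturbed_schur:
  assumes q: "\<And>i j. i \<le> n \<Longrightarrow> j \<le> n \<Longrightarrow> is_laplace N (q i j)" and n: "n < N"
    and p: "0 < perturbed a q (\<lambda>_. 0) n n"
  obtains q' where "\<And>i j. i < n \<Longrightarrow> j < n \<Longrightarrow> is_laplace N (q' i j)"
    "\<And>s i j. \<forall>i. 0 \<le> s i \<Longrightarrow> i < n \<Longrightarrow> j < n \<Longrightarrow> schur (perturbed a q s) n i j = perturbed a q' s i j"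
    "\<And>s. \<forall>i. 0 \<le> s i \<Longrightarrow> 0 < perturbed a q s n n"
    "\<And>\<alpha>. 0 < \<alpha> \<Longrightarrow> is_laplace N (\<lambda>s. perturbed a q s n n powr (- \<alpha>))"
proof -
  have qa: "q n n (\<lambda>_. 0) < a n" using p by (simp add: perturbed_def)
  have pos: "0 < perturbed a q s n n" if "\<forall>i. 0 \<le> s i" for s
  proof -
    have "0 \<le> s n" using that by simp
    moreover have "q n n s \<le> q n n (\<lambda>_. 0)" using is_laplace_le_0[OF q, of n n s] that by simp
    ultimately show ?thesis using qa by (simp add: perturbed_def)
  qed
  have pw: "is_laplace N (\<lambda>s. perturbed a q s n n powr (- \<alpha>))" if "0 < \<alpha>" for \<alpha>
    using is_laplace_binomial(1)[OF q qa that n] by (simp add: perturbed_def)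
  define q' where "q' i j s = q i j s + q i n s * q n j s * perturbed a q s n n powr (- 1)" for i j s
  have q': "is_laplace N (q' i j)" if "i < n" "j < n" for i j
    unfolding q'_def[abs_def] using that
    by (intro is_laplace_add is_laplace_mult q pw) auto
  have sc: "schur (perturbed a q s) n i j = perturbed a q' s i j" if "\<forall>i. 0 \<le> s i" "i < n" "j < n" for s i j
    using pos[OF that(1)] that(2,3)
    by (simp add: schur_def perturbed_def[of a q s i] perturbed_def[of a q s n j] perturbed_def[of a q' s] q'_def powr_minus_divide)
  show thesis by (rule that[OF q' sc pos pw])
qed

text \<open>The determinant is the product of the pivots, and each pivot raised to the power
  \<open>- \<alpha>\<close> is a Laplace transform.\<close>

lemma is_laplace_det:
  assumes "\<And>i j. i < n \<Longrightarrow> j < n \<Longrightarrow> is_laplace N (q i j)" "n \<le> N"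
    and "pivots_pos n (perturbed a q (\<lambda>_. 0))" and al: "0 < \<alpha>"
  shows "is_laplace N (\<lambda>s. Determinant.det (fmat n (perturbed a q s)) powr (- \<alpha>)) \<and>
    (\<forall>s. (\<forall>i. 0 \<le> s i) \<longrightarrow> pivots_pos n (perturbed a q s))"
  using assms(1-3)
proof (induction n arbitrary: q)
  case 0
  then show ?case by (simp add: is_laplace_const)
next
  case (Suc n)
  have p: "0 < perturbed a q (\<lambda>_. 0) n n" using Suc.prems(3) by simp
  obtain q' where q': "\<And>i j. i < n \<Longrightarrow> j < n \<Longrightarrow> is_laplace N (q' i j)"
    and sc: "\<And>s i j. \<forall>i. 0 \<le> s i \<Longrightarrow> i < n \<Longrightarrow> j < n \<Longrightarrow> schur (perturbed a q s) n i j = perturbed a q' s i j"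
    and pos: "\<And>s. \<forall>i. 0 \<le> s i \<Longrightarrow> 0 < perturbed a q s n n"
    and pw: "is_laplace N (\<lambda>s. perturbed a q s n n powr (- \<alpha>))"
    using perturbed_schur[of n N q a] Suc.prems(1,2) p al by (metis Suc_le_eq less_Suc_eq_le)
  have fm: "fmat n (schur (perturbed a q s) n) = fmat n (perturbed a q' s)"
    and pp: "pivots_pos n (schur (perturbed a q s) n) = pivots_pos n (perturbed a q' s)" if "\<forall>i. 0 \<le> s i" for s
    by (rule fmat_cong, rule sc[OF that], assumption+) (rule pivots_pos_cong, rule sc[OF that], assumption+)
  have IH: "is_laplace N (\<lambda>s. Determinant.det (fmat n (perturbed a q' s)) powr (- \<alpha>))"
      "\<And>s. \<forall>i. 0 \<le> s i \<Longrightarrow> pivots_pos n (perturbed a q' s)"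
    using Suc.IH[OF q'] Suc.prems(2,3) pp by auto
  have "is_laplace N (\<lambda>s. perturbed a q s n n powr (- \<alpha>) * Determinant.det (fmat n (perturbed a q' s)) powr (- \<alpha>))"
    by (intro is_laplace_mult pw IH)
  moreover have "perturbed a q s n n powr (- \<alpha>) * Determinant.det (fmat n (perturbed a q' s)) powr (- \<alpha>) =
      Determinant.det (fmat (Suc n) (perturbed a q s)) powr (- \<alpha>)" if s: "\<forall>i. 0 \<le> s i" for s
    using det_fmat_Suc[of "perturbed a q s" n] pos[OF s] det_pos[OF IH(2)[OF s]] fm[OF s]
    by (simp add: powr_mult)
  ultimately have "is_laplace N (\<lambda>s. Determinant.det (fmat (Suc n) (perturbed a q s)) powr (- \<alpha>))"
    by (rule is_laplace_cong)
  then show ?case using pos pp IH(2) by simp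
qed

text \<open>Eliminating the indices down to 1 divides both determinants by the same pivots, whose
  powers are Laplace transforms. At index 0 the difference \<open>(a 0 + s 0 - q) powr (- \<alpha>)
  - (a 0 + s 0) powr (- \<alpha>)\<close> remains, which is the binomial series without its first
  term.\<close>

lemma is_laplace_det_border:
  assumes "\<And>i j. i < Suc n \<Longrightarrow> j < Suc n \<Longrightarrow> is_laplace N (q i j)" "Suc n \<le> N"
    and "pivots_pos (Suc n) (perturbed a q (\<lambda>_. 0))" and al: "0 < \<alpha>"
  shows "is_laplace N (\<lambda>s. Determinant.det (fmat (Suc n) (perturbed a q s)) powr (- \<alpha>) -
    (a 0 + s 0) powr (- \<alpha>) * Determinant.det (fmat n (\<lambda>i j. perturbed a q s (Suc i) (Suc j))) powr (- \<alpha>))"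
  using assms(1-3)
proof (induction n arbitrary: q)
  case 0
  have "is_laplace N (\<lambda>s. (a 0 + s 0 - q 0 0 s) powr (- \<alpha>) - (a 0 + s 0) powr (- \<alpha>))"
    using 0 al by (intro is_laplace_binomial(2)) (auto simp: perturbed_def)
  then show ?case by (simp add: det_single perturbed_def)
next
  case (Suc n)
  have p: "0 < perturbed a q (\<lambda>_. 0) (Suc n) (Suc n)" using Suc.prems(3) by simp
  obtain q' where q': "\<And>i j. i < Suc n \<Longrightarrow> j < Suc n \<Longrightarrow> is_laplace N (q' i j)"
    and sc: "\<And>s i j. \<forall>i. 0 \<le> s i \<Longrightarrow> i < Suc n \<Longrightarrow> j < Suc n \<Longrightarrow>
      schur (perturbed a q s) (Suc n) i j = perturbed a q' s i j"
    and pos: "\<And>s. \<forall>i. 0 \<le> s i \<Longrightarrow> 0 < perturbed a q s (Suc n) (Suc n)"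
    and pw: "is_laplace N (\<lambda>s. perturbed a q s (Suc n) (Suc n) powr (- \<alpha>))"
    using perturbed_schur[of "Suc n" N q a] Suc.prems(1,2) p al by (metis Suc_le_eq less_Suc_eq_le)
  have fm: "fmat (Suc n) (schur (perturbed a q s) (Suc n)) = fmat (Suc n) (perturbed a q' s)"
    and pp: "pivots_pos (Suc n) (schur (perturbed a q s) (Suc n)) = pivots_pos (Suc n) (perturbed a q' s)"
    and fm': "fmat n (schur (\<lambda>i j. perturbed a q s (Suc i) (Suc j)) n) =
      fmat n (\<lambda>i j. perturbed a q' s (Suc i) (Suc j))"
    if "\<forall>i. 0 \<le> s i" for s
  proof -
    show "fmat (Suc n) (schur (perturbed a q s) (Suc n)) = fmat (Suc n) (perturbed a q' s)"
      by (rule fmat_cong) (rule sc[OF that])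
    show "pivots_pos (Suc n) (schur (perturbed a q s) (Suc n)) = pivots_pos (Suc n) (perturbed a q' s)"
      by (rule pivots_pos_cong) (rule sc[OF that])
    show "fmat n (schur (\<lambda>i j. perturbed a q s (Suc i) (Suc j)) n) =
      fmat n (\<lambda>i j. perturbed a q' s (Suc i) (Suc j))"
      by (rule fmat_cong) (simp add: sc[OF that, symmetric] schur_def)
  qed
  have pp0: "pivots_pos (Suc n) (perturbed a q' (\<lambda>_. 0))" using pp[of "\<lambda>_. 0"] Suc.prems(3) by simp
  let ?D = "\<lambda>q s. Determinant.det (fmat (Suc n) (perturbed a q s)) powr (- \<alpha>) -
    (a 0 + s 0) powr (- \<alpha>) * Determinant.det (fmat n (\<lambda>i j. perturbed a q s (Suc i) (Suc j))) powr (- \<alpha>)"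
  have IH: "is_laplace N (?D q')"
    using Suc.IH[OF q'] Suc.prems(2) pp0 by simp
  have pp': "pivots_pos (Suc n) (perturbed a q' s)" if "\<forall>i. 0 \<le> s i" for s
    using is_laplace_det[OF q' _ pp0 al] Suc.prems(2) that by simp
  have "is_laplace N (\<lambda>s. perturbed a q s (Suc n) (Suc n) powr (- \<alpha>) * ?D q' s)"
    by (intro is_laplace_mult pw IH)
  then show ?case
  proof (rule is_laplace_cong)
    fix s :: "nat \<Rightarrow> real" assume s: "\<forall>i. 0 \<le> s i"
    let ?c = "perturbed a q s (Suc n) (Suc n)"
    have 1: "Determinant.det (fmat (Suc (Suc n)) (perturbed a q s)) = ?c * Determinant.det (fmat (Suc n) (perturbed a q' s))"
      using det_fmat_Suc[of "perturbed a q s" "Suc n"] pos[OF s] fm[OF s] by simp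
    have 2: "Determinant.det (fmat (Suc n) (\<lambda>i j. perturbed a q s (Suc i) (Suc j))) =
        ?c * Determinant.det (fmat n (\<lambda>i j. perturbed a q' s (Suc i) (Suc j)))"
      using det_fmat_Suc[of "\<lambda>i j. perturbed a q s (Suc i) (Suc j)" n] pos[OF s] fm'[OF s] by simp
    show "?c powr (- \<alpha>) * ?D q' s = Determinant.det (fmat (Suc (Suc n)) (perturbed a q s)) powr (- \<alpha>) -
      (a 0 + s 0) powr (- \<alpha>) * Determinant.det (fmat (Suc n) (\<lambda>i j. perturbed a q s (Suc i) (Suc j))) powr (- \<alpha>)"
      unfolding 1 2 by (simp add: powr_mult algebra_simps)
  qed
qed

text \<open>Setting the variable of the border to 0 corresponds to dropping the first coordinate of
  the measure.\<close>

lemma is_laplace_case_nat: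
  assumes "is_laplace (Suc n) L"
  shows "is_laplace n (\<lambda>s. L (case_nat 0 s))"
proof -
  obtain M where M: "laplace_of (Suc n) M L" using assms by (auto simp: is_laplace_def)
  have m: "(\<lambda>z i. z (Suc i)) \<in> M \<rightarrow>\<^sub>M seqM"
    unfolding measurable_cong_sets[OF laplace_ofD(1)[OF M] refl]
    by (rule measurable_PiM_single') (auto simp: space_PiM)
  have "laplace_of n (distr M seqM (\<lambda>z i. z (Suc i))) (\<lambda>s. L (case_nat 0 s))"
    unfolding laplace_of_def
  proof (intro conjI allI impI)
    fix s :: "nat \<Rightarrow> real" assume "\<forall>i. 0 \<le> s i"
    then have s: "\<forall>i. 0 \<le> case_nat 0 s i" by (auto split: nat.split)
    show "0 \<le> L (case_nat 0 s)" by (rule laplace_ofD(2)[OF M s])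
    show "(\<integral>\<^sup>+z. ennreal (exp (- (\<Sum>i<n. s i * \<bar>z i\<bar>))) \<partial>distr M seqM (\<lambda>z i. z (Suc i))) =
        ennreal (L (case_nat 0 s))"
      using laplace_ofD(3)[OF M s]
      by (subst nn_integral_distr[OF m]) (auto simp: sum.lessThan_Suc_shift simp del: sum.lessThan_Suc)
  qed simp
  then show ?thesis by (auto simp: is_laplace_def)
qed

section \<open>Laplace transforms and characteristic functions determine rectangle probabilities\<close>

text \<open>Equality of the integrals against two finite measures passes through each of these
  rules. For the last one this is dominated convergence, to which the common bound \<open>B\<close>
  is tailored.\<close>

inductive blim :: "(real \<Rightarrow> complex) set \<Rightarrow> (real \<Rightarrow> complex) \<Rightarrow> bool" for C where
  blim_base: "g \<in> C \<Longrightarrow> blim C g"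
| blim_add: "blim C f \<Longrightarrow> blim C g \<Longrightarrow> blim C (\<lambda>x. f x + g x)"
| blim_scale: "blim C g \<Longrightarrow> blim C (\<lambda>x. c * g x)"
| blim_lim: "(\<And>k. blim C (g k)) \<Longrightarrow> (\<And>k x. norm (g k x) \<le> B) \<Longrightarrow>
    (\<And>x. (\<lambda>k::nat. g k x) \<longlonglongrightarrow> h x) \<Longrightarrow> blim C h"

lemma blim_bounded_measurable:
  assumes "blim C g" and C: "\<And>g. g \<in> C \<Longrightarrow> g \<in> borel_measurable borel \<and> (\<exists>B. \<forall>x. norm (g x) \<le> B)"
  shows "g \<in> borel_measurable borel \<and> (\<exists>B. \<forall>x. norm (g x) \<le> B)"
  using assms(1)
proof induction
  case (blim_base g)
  then show ?case by (rule C)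
next
  case (blim_add f g)
  then obtain A B where "\<forall>x. norm (f x) \<le> A" "\<forall>x. norm (g x) \<le> B" by blast
  then have "\<forall>x. norm (f x + g x) \<le> A + B" by (meson norm_triangle_mono)
  then show ?case using blim_add by auto
next
  case (blim_scale g c)
  then obtain B where "\<forall>x. norm (g x) \<le> B" by blast
  then have "\<forall>x. norm (c * g x) \<le> norm c * B" by (simp add: norm_mult mult_left_mono)
  then show ?case using blim_scale by auto
next
  case (blim_lim g B h)
  have "h \<in> borel_measurable borel"
    by (rule borel_measurable_LIMSEQ_metric[where f = g]) (use blim_lim in auto)
  moreover have "norm (h x) \<le> B" for x
    by (rule tendsto_upperbound[OF tendsto_norm[OF blim_lim(3)[of x]]]) (auto simp: blim_lim(2))
  ultimately show ?case by blast
qed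

text \<open>Two inductions, one for each factor: the first keeps a factor in \<open>C\<close>, the
  second keeps an arbitrary factor in \<open>blim C\<close>.\<close>

lemma blim_mult:
  assumes C: "\<And>g. g \<in> C \<Longrightarrow> g \<in> borel_measurable borel \<and> (\<exists>B. \<forall>x. norm (g x) \<le> B)"
    and mult: "\<And>f g. f \<in> C \<Longrightarrow> g \<in> C \<Longrightarrow> (\<lambda>x. f x * g x) \<in> C"
    and f: "blim C f" and g: "blim C g"
  shows "blim C (\<lambda>x. f x * g x)"
proof -
  have base: "blim C (\<lambda>x. e x * g x)" if e: "e \<in> C" "blim C g" for e g
    using e(2)
  proof induction
    case (blim_base g)
    then show ?case using mult[OF e(1)] blim.blim_base by blast
  next
    case (blim_add f g)
    then show ?case using blim.blim_add by (simp add: distrib_left)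
  next
    case (blim_scale g c)
    then show ?case using blim.blim_scale[of C "\<lambda>x. e x * g x" c] by (simp add: mult.left_commute)
  next
    case (blim_lim g B h)
    obtain A where A: "\<forall>x. norm (e x) \<le> A" using C[OF e(1)] by blast
    show ?case
    proof (rule blim.blim_lim[where g = "\<lambda>k x. e x * g k x" and B = "A * B"])
      show "blim C (\<lambda>x. e x * g k x)" for k by (rule blim_lim)
      have "0 \<le> A" using A norm_ge_zero order_trans by blast
      then show "norm (e x * g k x) \<le> A * B" for k x
        using A blim_lim(2) by (simp add: norm_mult mult_mono)
      show "(\<lambda>k. e x * g k x) \<longlonglongrightarrow> e x * h x" for x
        by (intro tendsto_mult tendsto_const blim_lim)
    qed
  qed
  obtain A where A: "\<forall>x. norm (g x) \<le> A" using blim_bounded_measurable[OF g C] by blast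
  have A0: "0 \<le> A" using A norm_ge_zero order_trans by blast
  show ?thesis using f
  proof induction
    case (blim_base e)
    then show ?case using base g by blast
  next
    case (blim_add f h)
    then show ?case using blim.blim_add by (simp add: distrib_right)
  next
    case (blim_scale f c)
    then show ?case using blim.blim_scale[of C "\<lambda>x. f x * g x" c] by (simp add: mult.assoc)
  next
    case (blim_lim f B h)
    show ?case
    proof (rule blim.blim_lim[where g = "\<lambda>k x. f k x * g x" and B = "B * A"])
      show "blim C (\<lambda>x. f k x * g x)" for k by (rule blim_lim)
      have "0 \<le> B" using blim_lim(2) norm_ge_zero order_trans by blast
      then show "norm (f k x * g x) \<le> B * A" for k x
        using A blim_lim(2) by (simp add: norm_mult mult_mono)
      show "(\<lambda>k. f k x * g x) \<longlonglongrightarrow> h x * g x" for x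
        by (intro tendsto_mult tendsto_const blim_lim)
    qed
  qed
qed

lemma blim_polynomial:
  fixes p y :: "real \<Rightarrow> real"
  assumes C: "\<And>g. g \<in> C \<Longrightarrow> g \<in> borel_measurable borel \<and> (\<exists>B. \<forall>x. norm (g x) \<le> B)"
    and mult: "\<And>f g. f \<in> C \<Longrightarrow> g \<in> C \<Longrightarrow> (\<lambda>x. f x * g x) \<in> C"
    and one: "blim C (\<lambda>_. 1)" and y: "blim C (\<lambda>x. of_real (y x))" and p: "real_polynomial_function p"
  shows "blim C (\<lambda>x. of_real (p (y x)))"
  using p
proof induction
  case (linear f)
  then obtain c where "f = (\<lambda>x. x * c)" by (auto simp: real_bounded_linear)
  then show ?case using blim_scale[OF y, of "of_real c"] by (simp add: mult.commute)
next
  case (const c)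
  then show ?case using blim_scale[OF one, of "of_real c"] by simp
next
  case (add f g)
  from blim_add[OF add.IH] show ?case by simp
next
  case (mult f g)
  have "blim C (\<lambda>x. of_real (f (y x)) * of_real (g (y x)))"
    by (rule blim_mult[OF C assms(2) mult.IH])
  then show ?case by simp
qed

text \<open>The coordinates are treated one at a time: \<open>k\<close> counts the factors already
  allowed to lie in \<open>blim C\<close>. In the step all factors but the one at \<open>k\<close>
  are frozen in \<open>W\<close>, and an inner induction over \<open>blim\<close> runs in the
  coordinate \<open>k\<close>.\<close>

lemma integral_prod_blim_eq:
  fixes M1 M2 :: "(nat \<Rightarrow> real) measure"
  assumes M: "finite_measure M1" "finite_measure M2" "sets M1 = sets seqM" "sets M2 = sets seqM"
    and C: "\<And>g. g \<in> C \<Longrightarrow> g \<in> borel_measurable borel \<and> (\<exists>B. \<forall>x. norm (g x) \<le> B)"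
    and eq: "\<And>g. (\<And>i. i < n \<Longrightarrow> g i \<in> C) \<Longrightarrow>
      (\<integral>z. (\<Prod>i<n. g i (z i)) \<partial>M1) = (\<integral>z. (\<Prod>i<n. g i (z i)) \<partial>M2)"
    and g: "\<And>i. i < n \<Longrightarrow> blim C (g i)"
  shows "(\<integral>z. (\<Prod>i<n. g i (z i)) \<partial>M1) = (\<integral>z. (\<Prod>i<n. g i (z i)) \<partial>M2)"
proof -
  interpret M1: finite_measure M1 by fact
  interpret M2: finite_measure M2 by fact
  have "(\<integral>z. (\<Prod>i<n. g i (z i)) \<partial>M1) = (\<integral>z. (\<Prod>i<n. g i (z i)) \<partial>M2)"
    if "k \<le> n" "\<And>i. i < k \<Longrightarrow> blim C (g i)" "\<And>i. k \<le> i \<Longrightarrow> i < n \<Longrightarrow> g i \<in> C" for k g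
    using that
  proof (induction k arbitrary: g)
    case 0
    then show ?case by (intro eq) auto
  next
    case (Suc k)
    define W where "W z = (\<Prod>i\<in>{..<n} - {k}. g i (z i))" for z
    have gi: "g i \<in> borel_measurable borel \<and> (\<exists>B. \<forall>x. norm (g i x) \<le> B)" if "i < n" for i
    proof (cases "i < Suc k")
      case True
      show ?thesis by (rule blim_bounded_measurable[OF Suc.prems(2)[OF True] C])
    next
      case False
      then show ?thesis using Suc.prems(3)[of i] that C[of "g i"] by simp
    qed
    then have "\<forall>i. \<exists>B. i < n \<longrightarrow> (\<forall>x. norm (g i x) \<le> B)" by blast
    from choice[OF this] obtain B where B: "\<And>i x. i < n \<Longrightarrow> norm (g i x) \<le> B i" by blast
    have Wb: "norm (W z) \<le> (\<Prod>i\<in>{..<n} - {k}. B i)" for z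
      unfolding W_def prod_norm[symmetric] by (intro prod_mono) (auto simp: B)
    have Wm: "W \<in> borel_measurable seqM"
      unfolding W_def using gi
      by (intro borel_measurable_prod measurable_compose[OF measurable_component_singleton]) auto
    have prod: "(\<Prod>i<n. (g(k := h)) i (z i)) = h (z k) * W z" for h z
      using Suc.prems(1) unfolding W_def
      by (subst prod.remove[of _ k]) (auto intro!: prod.cong arg_cong2[where f = "(*)"])
    have "(\<lambda>z. z k) \<in> seqM \<rightarrow>\<^sub>M borel" by (rule measurable_component_singleton) simp
    then have meas: "(\<lambda>z. h (z k) * W z) \<in> borel_measurable seqM" if "h \<in> borel_measurable borel" for h
      using measurable_compose[of _ _ _ h, OF _ that] Wm by (intro borel_measurable_times) blast+
    have m12: "u \<in> borel_measurable M1 \<longleftrightarrow> u \<in> borel_measurable seqM"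
      "u \<in> borel_measurable M2 \<longleftrightarrow> u \<in> borel_measurable seqM" for u :: "_ \<Rightarrow> complex"
      using measurable_cong_sets[OF M(3) refl] measurable_cong_sets[OF M(4) refl] by auto
    have bnd: "norm (h (z k) * W z) \<le> b * (\<Prod>i\<in>{..<n} - {k}. B i)" if "\<forall>x. norm (h x) \<le> b" for h b z
    proof -
      have "0 \<le> b" using that norm_ge_zero order_trans by blast
      then show ?thesis using that Wb by (simp add: norm_mult mult_mono)
    qed
    have int: "integrable M1 (\<lambda>z. h (z k) * W z)" "integrable M2 (\<lambda>z. h (z k) * W z)" if h: "blim C h" for h
    proof -
      obtain b where b: "\<forall>x. norm (h x) \<le> b" and hm: "h \<in> borel_measurable borel"
        using blim_bounded_measurable[OF h C] by blast
      show "integrable M1 (\<lambda>z. h (z k) * W z)"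
        by (rule M1.integrable_const_bound[where B = "b * (\<Prod>i\<in>{..<n} - {k}. B i)"])
           (use bnd[OF b] meas[OF hm] m12 in auto)
      show "integrable M2 (\<lambda>z. h (z k) * W z)"
        by (rule M2.integrable_const_bound[where B = "b * (\<Prod>i\<in>{..<n} - {k}. B i)"])
           (use bnd[OF b] meas[OF hm] m12 in auto)
    qed
    have "(\<integral>z. h (z k) * W z \<partial>M1) = (\<integral>z. h (z k) * W z \<partial>M2)" if "blim C h" for h
      using that
    proof induction
      case (blim_base h)
      have "(\<integral>z. (\<Prod>i<n. (g(k := h)) i (z i)) \<partial>M1) = (\<integral>z. (\<Prod>i<n. (g(k := h)) i (z i)) \<partial>M2)"
        using Suc.prems blim_base by (intro Suc.IH) auto
      then show ?case by (simp only: prod)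
    next
      case (blim_add u v)
      then show ?case
        by (simp add: distrib_right Bochner_Integration.integral_add[OF int(1)[OF blim_add.hyps(1)] int(1)[OF blim_add.hyps(2)]]
            Bochner_Integration.integral_add[OF int(2)[OF blim_add.hyps(1)] int(2)[OF blim_add.hyps(2)]])
    next
      case (blim_scale u c)
      then show ?case by (simp add: mult.assoc)
    next
      case (blim_lim u b h)
      have h: "blim C h" by (rule blim.blim_lim) (use blim_lim in auto)
      have hm: "h \<in> borel_measurable borel" using blim_bounded_measurable[OF h C] by blast
      have ub: "\<forall>x. norm (u j x) \<le> b" for j using blim_lim(2) by blast
      have um: "u j \<in> borel_measurable borel" for j using blim_bounded_measurable[OF blim_lim(1) C] by blast
      have "(\<lambda>j. \<integral>z. u j (z k) * W z \<partial>M1) \<longlonglongrightarrow> (\<integral>z. h (z k) * W z \<partial>M1)"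
      proof (rule integral_dominated_convergence[where w = "\<lambda>_. b * (\<Prod>i\<in>{..<n} - {k}. B i)"])
        show "AE z in M1. (\<lambda>j. u j (z k) * W z) \<longlonglongrightarrow> h (z k) * W z"
          by (intro AE_I2 tendsto_mult tendsto_const blim_lim(3))
        show "AE z in M1. norm (u j (z k) * W z) \<le> b * (\<Prod>i\<in>{..<n} - {k}. B i)" for j
          by (intro AE_I2 bnd ub)
      qed (simp_all add: m12 meas um hm)
      moreover have "(\<lambda>j. \<integral>z. u j (z k) * W z \<partial>M2) \<longlonglongrightarrow> (\<integral>z. h (z k) * W z \<partial>M2)"
      proof (rule integral_dominated_convergence[where w = "\<lambda>_. b * (\<Prod>i\<in>{..<n} - {k}. B i)"])
        show "AE z in M2. (\<lambda>j. u j (z k) * W z) \<longlonglongrightarrow> h (z k) * W z"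
          by (intro AE_I2 tendsto_mult tendsto_const blim_lim(3))
        show "AE z in M2. norm (u j (z k) * W z) \<le> b * (\<Prod>i\<in>{..<n} - {k}. B i)" for j
          by (intro AE_I2 bnd ub)
      qed (simp_all add: m12 meas um hm)
      ultimately show ?case unfolding blim_lim.IH by (rule LIMSEQ_unique)
    qed
    from this[OF Suc.prems(2)[of k]] show ?case
      using prod[of "g k"] by simp
  qed
  from this[of n g] g show ?thesis by simp
qed

text \<open>By the Weierstrass theorem \<open>p k\<close> is within \<open>1 / (k + 1)\<close> of
  the ramp that falls from 1 to 0 on \<open>[0, 1 / (k + 1)\<^sup>2]\<close>. The square matters
  when \<open>sin ((x - c) / (k + 1))\<close> is inserted: for fixed \<open>x > c\<close> this is of
  order \<open>1 / (k + 1)\<close> and must eventually lie beyond the ramp.\<close>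

lemma step_polynomials:
  obtains p :: "nat \<Rightarrow> real \<Rightarrow> real" where "\<And>k. real_polynomial_function (p k)"
    "\<And>k y. \<bar>y\<bar> \<le> 1 \<Longrightarrow> \<bar>p k y\<bar> \<le> 2"
    "\<And>k y. \<bar>y\<bar> \<le> 1 \<Longrightarrow> y \<le> 0 \<Longrightarrow> \<bar>p k y - 1\<bar> \<le> 1 / real (Suc k)"
    "\<And>k y. \<bar>y\<bar> \<le> 1 \<Longrightarrow> 1 / (real (Suc k))\<^sup>2 \<le> y \<Longrightarrow> \<bar>p k y\<bar> \<le> 1 / real (Suc k)"
proof -
  define r where "r k y = max 0 (min 1 (1 - y * (real (Suc k))\<^sup>2))" for k and y :: real
  have "\<exists>p. real_polynomial_function p \<and> (\<forall>y\<in>{-1..1}. \<bar>r k y - p y\<bar> < 1 / real (Suc k))" for k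
  proof -
    have c: "continuous_on {-1..1} (r k)" unfolding r_def by (intro continuous_intros)
    have e: "0 < 1 / real (Suc k)" by simp
    obtain p where "real_polynomial_function p" "\<And>y. y \<in> {-1..1} \<Longrightarrow> \<bar>r k y - p y\<bar> < 1 / real (Suc k)"
      using Stone_Weierstrass_real_polynomial_function[OF compact_Icc c e] by blast
    then show ?thesis by blast
  qed
  then have "\<forall>k. \<exists>p. real_polynomial_function p \<and> (\<forall>y\<in>{-1..1}. \<bar>r k y - p y\<bar> < 1 / real (Suc k))"
    by blast
  from choice[OF this] obtain p where p': "\<forall>k. real_polynomial_function (p k) \<and>
    (\<forall>y\<in>{-1..1}. \<bar>r k y - p k y\<bar> < 1 / real (Suc k))" by blast
  have p: "real_polynomial_function (p k)" for k using p' by blast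
  have pr: "\<bar>r k y - p k y\<bar> < 1 / real (Suc k)" if "\<bar>y\<bar> \<le> 1" for k y
  proof -
    have "y \<in> {-1..1}" using that by (simp add: abs_le_iff)
    then show ?thesis using p' by blast
  qed
  show thesis
  proof (rule that[OF p])
    fix k and y :: real assume y: "\<bar>y\<bar> \<le> 1"
    have "1 / real (Suc k) \<le> 1" by simp
    moreover have "0 \<le> r k y" "r k y \<le> 1" by (auto simp: r_def)
    ultimately show "\<bar>p k y\<bar> \<le> 2" using pr[OF y, of k] by linarith
    show "\<bar>p k y - 1\<bar> \<le> 1 / real (Suc k)" if "y \<le> 0"
    proof -
      have "y * (real (Suc k))\<^sup>2 \<le> 0" using that by (simp add: mult_nonpos_nonneg)
      then have "r k y = 1" by (simp add: r_def)
      then show ?thesis using pr[OF y, of k] by linarith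
    qed
    show "\<bar>p k y\<bar> \<le> 1 / real (Suc k)" if "1 / (real (Suc k))\<^sup>2 \<le> y"
    proof -
      have "1 \<le> y * (real (Suc k))\<^sup>2" using that by (simp add: divide_le_eq del: of_nat_Suc)
      then have "r k y = 0" by (simp add: r_def)
      then show ?thesis using pr[OF y, of k] by linarith
    qed
  qed
qed

lemma step_limit:
  fixes p :: "nat \<Rightarrow> real \<Rightarrow> real" and y :: "nat \<Rightarrow> real"
  assumes p: "\<And>k y. \<bar>y\<bar> \<le> 1 \<Longrightarrow> y \<le> 0 \<Longrightarrow> \<bar>p k y - 1\<bar> \<le> 1 / real (Suc k)"
    "\<And>k y. \<bar>y\<bar> \<le> 1 \<Longrightarrow> 1 / (real (Suc k))\<^sup>2 \<le> y \<Longrightarrow> \<bar>p k y\<bar> \<le> 1 / real (Suc k)"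
    and y: "\<And>k. \<bar>y k\<bar> \<le> 1"
    "b \<Longrightarrow> \<forall>\<^sub>F k in sequentially. y k \<le> 0"
    "\<not> b \<Longrightarrow> \<forall>\<^sub>F k in sequentially. 1 / (real (Suc k))\<^sup>2 \<le> y k"
  shows "(\<lambda>k. complex_of_real (p k (y k))) \<longlonglongrightarrow> (if b then 1 else 0)"
proof -
  have lim: "(\<lambda>k. 1 / real (Suc k)) \<longlonglongrightarrow> 0" by (rule LIMSEQ_Suc[OF lim_1_over_n])
  have "(\<lambda>k. p k (y k) - (if b then 1 else 0)) \<longlonglongrightarrow> 0"
  proof (rule tendsto_0_le[OF lim, where K = 1])
    show "\<forall>\<^sub>F k in sequentially. norm (p k (y k) - (if b then 1 else 0)) \<le> norm (1 / real (Suc k)) * 1"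
    proof (cases b)
      case True
      from y(2)[OF True] show ?thesis
        by eventually_elim (use p(1)[OF y(1)] True in simp)
    next
      case False
      from y(3)[OF False] show ?thesis
        by eventually_elim (use p(2)[OF y(1)] False in simp)
    qed
  qed
  then have "(\<lambda>k. p k (y k)) \<longlonglongrightarrow> (if b then 1 else 0)" by (rule LIM_zero_cancel)
  from tendsto_of_real[OF this] show ?thesis by (cases b) auto
qed

section \<open>Indicators as bounded limits of polynomials in characters\<close>

definition exp_chars :: "(real \<Rightarrow> complex) set" where
  "exp_chars = {g. \<exists>s>0. g = (\<lambda>x. of_real (exp (- (s * \<bar>x\<bar>))))}"

definition cis_chars :: "(real \<Rightarrow> complex) set" where
  "cis_chars = range (\<lambda>t x. cis (t * x))"

lemma exp_chars_bounded: "g \<in> exp_chars \<Longrightarrow> g \<in> borel_measurable borel \<and> (\<exists>B. \<forall>x. norm (g x) \<le> B)"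
  unfolding exp_chars_def by (auto intro!: exI[of _ 1])

lemma cis_chars_bounded: "g \<in> cis_chars \<Longrightarrow> g \<in> borel_measurable borel \<and> (\<exists>B. \<forall>x. norm (g x) \<le> B)"
  unfolding cis_chars_def
  by (auto intro!: exI[of _ 1] borel_measurable_continuous_onI continuous_intros)

lemma blim_exp_indicator:
  assumes c: "0 \<le> c"
  shows "blim exp_chars (\<lambda>x. if \<bar>x\<bar> \<le> c then 1 else 0)"
proof -
  have ch: "blim exp_chars (\<lambda>x. of_real (exp (- (s * \<bar>x\<bar>))))" if "0 < s" for s
    using that by (intro blim_base) (auto simp: exp_chars_def)
  have mult: "(\<lambda>x. f x * g x) \<in> exp_chars" if fg: "f \<in> exp_chars" "g \<in> exp_chars" for f g
  proof -
    obtain s t where "0 < s" "0 < t" "f = (\<lambda>x. of_real (exp (- (s * \<bar>x\<bar>))))" "g = (\<lambda>x. of_real (exp (- (t * \<bar>x\<bar>))))"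
      using fg by (auto simp: exp_chars_def)
    then have "(\<lambda>x. f x * g x) = (\<lambda>x. of_real (exp (- ((s + t) * \<bar>x\<bar>))))" "0 < s + t"
      by (auto simp: fun_eq_iff exp_add[symmetric] algebra_simps simp flip: of_real_mult)
    then show ?thesis by (auto simp: exp_chars_def)
  qed
  \<comment> \<open>The constant 1 is not in \<open>exp_chars\<close>, where \<open>s > 0\<close> as
    in the definition of permanental sequences; it is the limit of characters as \<open>s\<close>
    tends to 0.\<close>
  have one: "blim exp_chars (\<lambda>_. 1)"
  proof (rule blim_lim[where B = 1])
    show "blim exp_chars (\<lambda>x. of_real (exp (- (1 / real (Suc k) * \<bar>x\<bar>))))" for k by (rule ch) simp
    show "(\<lambda>k. complex_of_real (exp (- (1 / real (Suc k) * \<bar>x\<bar>)))) \<longlonglongrightarrow> 1" for x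
    proof -
      have "(\<lambda>k. complex_of_real (exp (- (1 / real (Suc k) * \<bar>x\<bar>)))) \<longlonglongrightarrow> complex_of_real (exp (- (0 * \<bar>x\<bar>)))"
        by (intro tendsto_intros LIMSEQ_Suc[OF lim_1_over_n])
      then show ?thesis by simp
    qed
  qed auto
  obtain p :: "nat \<Rightarrow> real \<Rightarrow> real" where p: "\<And>k. real_polynomial_function (p k)"
    "\<And>k y. \<bar>y\<bar> \<le> 1 \<Longrightarrow> \<bar>p k y\<bar> \<le> 2"
    "\<And>k y. \<bar>y\<bar> \<le> 1 \<Longrightarrow> y \<le> 0 \<Longrightarrow> \<bar>p k y - 1\<bar> \<le> 1 / real (Suc k)"
    "\<And>k y. \<bar>y\<bar> \<le> 1 \<Longrightarrow> 1 / (real (Suc k))\<^sup>2 \<le> y \<Longrightarrow> \<bar>p k y\<bar> \<le> 1 / real (Suc k)"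
    using step_polynomials by blast
  \<comment> \<open>\<open>y x \<le> 0\<close> holds exactly when
    \<open>\<bar>x\<bar> \<le> c\<close>.\<close>
  define y where "y x = exp (- c) - exp (- \<bar>x\<bar>)" for x :: real
  have y1: "\<bar>y x\<bar> \<le> 1" for x
  proof -
    have "0 < exp (- c)" "exp (- c) \<le> 1" "0 < exp (- \<bar>x\<bar>)" "exp (- \<bar>x\<bar>) \<le> 1" using c by auto
    then show ?thesis unfolding y_def abs_le_iff by linarith
  qed
  have y: "blim exp_chars (\<lambda>x. of_real (y x))"
    using blim_add[OF blim_scale[OF one, of "of_real (exp (- c))"] blim_scale[OF ch[of 1], of "-1"]]
    by (simp add: y_def)
  show ?thesis
  proof (rule blim_lim[where B = 2])
    show "blim exp_chars (\<lambda>x. of_real (p k (y x)))" for k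
      by (rule blim_polynomial[OF exp_chars_bounded mult one y p(1)])
    show "norm (complex_of_real (p k (y x))) \<le> 2" for k x using p(2)[OF y1] by simp
    show "(\<lambda>k. complex_of_real (p k (y x))) \<longlonglongrightarrow> (if \<bar>x\<bar> \<le> c then 1 else 0)" for x
    proof (rule step_limit[OF p(3,4) y1])
      assume "\<not> \<bar>x\<bar> \<le> c"
      then have "0 < y x" by (simp add: y_def)
      moreover have "(\<lambda>k. 1 / (real (Suc k))\<^sup>2) \<longlonglongrightarrow> 0" by real_asymp
      ultimately have "\<forall>\<^sub>F k in sequentially. 1 / (real (Suc k))\<^sup>2 < y x"
        using order_tendstoD(2) by blast
      then show "\<forall>\<^sub>F k in sequentially. 1 / (real (Suc k))\<^sup>2 \<le> y x"
        by eventually_elim simp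
    qed (auto simp: y_def)
  qed
qed

lemma blim_cis_indicator: "blim cis_chars (\<lambda>x. if x \<le> c then 1 else 0)"
proof -
  have ch: "blim cis_chars (\<lambda>x. cis (t * x))" for t
    by (rule blim_base) (auto simp: cis_chars_def)
  have mult: "(\<lambda>x. f x * g x) \<in> cis_chars" if fg: "f \<in> cis_chars" "g \<in> cis_chars" for f g
    using fg by (auto simp: cis_chars_def cis_mult simp flip: distrib_right)
  have one: "blim cis_chars (\<lambda>_. 1)" using ch[of 0] by simp
  obtain p :: "nat \<Rightarrow> real \<Rightarrow> real" where p: "\<And>k. real_polynomial_function (p k)"
    "\<And>k y. \<bar>y\<bar> \<le> 1 \<Longrightarrow> \<bar>p k y\<bar> \<le> 2"
    "\<And>k y. \<bar>y\<bar> \<le> 1 \<Longrightarrow> y \<le> 0 \<Longrightarrow> \<bar>p k y - 1\<bar> \<le> 1 / real (Suc k)"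
    "\<And>k y. \<bar>y\<bar> \<le> 1 \<Longrightarrow> 1 / (real (Suc k))\<^sup>2 \<le> y \<Longrightarrow> \<bar>p k y\<bar> \<le> 1 / real (Suc k)"
    using step_polynomials by blast
  \<comment> \<open>The period of this sine grows with \<open>k\<close>, so every fixed
    \<open>x\<close> is eventually within half a period of \<open>c\<close>, where the sine has the
    sign of \<open>x - c\<close>.\<close>
  define y where "y k x = sin ((x - c) / real (Suc k))" for k x
  have y1: "\<bar>y k x\<bar> \<le> 1" for k x by (simp add: y_def)
  have y: "blim cis_chars (\<lambda>x. of_real (y k x))" for k
  proof -
    let ?K = "real (Suc k)"
    have "complex_of_real (y k x) = cis (- (c / ?K)) / (2 * \<i>) * cis (1 / ?K * x) +
        - cis (c / ?K) / (2 * \<i>) * cis (- (1 / ?K) * x)" for x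
    proof -
      have 1: "cis ((x - c) / ?K) = cis (- (c / ?K)) * cis (1 / ?K * x)"
        and 2: "cis (- ((x - c) / ?K)) = cis (c / ?K) * cis (- (1 / ?K) * x)"
        by (simp_all add: cis_mult diff_divide_distrib)
      have "complex_of_real (y k x) = (cis ((x - c) / ?K) - cis (- ((x - c) / ?K))) / (2 * \<i>)"
        by (simp add: y_def complex_eq_iff Re_divide Im_divide)
      moreover have "(a * b - c * d) / w = a / w * b + - c / w * d" for a b c d w :: complex
        by (simp add: diff_divide_distrib)
      ultimately show ?thesis unfolding 1 2 by (simp only:)
    qed
    then show ?thesis by (simp only:) (intro blim_add blim_scale ch)
  qed
  show ?thesis
  proof (rule blim_lim[where B = 2])
    show "blim cis_chars (\<lambda>x. of_real (p k (y k x)))" for k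
      by (rule blim_polynomial[OF cis_chars_bounded mult one y p(1)])
    show "norm (complex_of_real (p k (y k x))) \<le> 2" for k x using p(2)[OF y1] by simp
    show "(\<lambda>k. complex_of_real (p k (y k x))) \<longlonglongrightarrow> (if x \<le> c then 1 else 0)" for x
    proof (rule step_limit[OF p(3,4) y1])
      assume x: "x \<le> c"
      have "(\<lambda>k. (c - x) / real (Suc k)) \<longlonglongrightarrow> 0" by real_asymp
      then have "\<forall>\<^sub>F k in sequentially. (c - x) / real (Suc k) < pi"
        using order_tendstoD(2) pi_gt_zero by blast
      then show "\<forall>\<^sub>F k in sequentially. y k x \<le> 0"
      proof eventually_elim
        case (elim k)
        then have "0 \<le> sin ((c - x) / real (Suc k))" using x by (intro sin_ge_zero) auto
        also have "(c - x) / real (Suc k) = - ((x - c) / real (Suc k))" by (simp add: field_simps)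
        finally show ?case by (simp add: y_def del: of_nat_Suc)
      qed
    next
      assume "\<not> x \<le> c"
      then have u: "0 < x - c" by simp
      define u where "u = x - c"
      have "(\<lambda>k. real (Suc k) * sin (u / real (Suc k)) - 1 / real (Suc k)) \<longlonglongrightarrow> u" by real_asymp
      then have "\<forall>\<^sub>F k in sequentially. 0 < real (Suc k) * sin (u / real (Suc k)) - 1 / real (Suc k)"
        using order_tendstoD(1) u unfolding u_def by blast
      then show "\<forall>\<^sub>F k in sequentially. 1 / (real (Suc k))\<^sup>2 \<le> y k x"
        by eventually_elim (simp add: y_def u_def field_simps power2_eq_square del: of_nat_Suc)
    qed
  qed
qed

section \<open>Uniqueness on rectangles\<close>

lemma rect_sets:
  assumes A: "\<And>i. i < n \<Longrightarrow> {x. A i x} \<in> sets borel"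
  shows "{z. \<forall>i<n. A i (z i)} \<in> sets seqM"
proof -
  have "Measurable.pred seqM (\<lambda>z. A i (z i))" if "i < n" for i
  proof -
    have "(\<lambda>z. z i) \<in> seqM \<rightarrow>\<^sub>M borel" by (rule measurable_component_singleton) simp
    from measurable_sets[OF this A[OF that]] show ?thesis by (simp add: pred_def vimage_def space_PiM)
  qed
  then have "Measurable.pred seqM (\<lambda>z. \<forall>i\<in>{..<n}. A i (z i))"
    by (intro pred_intros_finite) auto
  then show ?thesis by (simp add: pred_def space_PiM Ball_def)
qed

lemma measure_rect_eq:
  fixes M1 M2 :: "(nat \<Rightarrow> real) measure"
  assumes M: "finite_measure M1" "finite_measure M2" "sets M1 = sets seqM" "sets M2 = sets seqM"
    and C: "\<And>g. g \<in> C \<Longrightarrow> g \<in> borel_measurable borel \<and> (\<exists>B. \<forall>x. norm (g x) \<le> B)"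
    and eq: "\<And>g. (\<And>i. i < n \<Longrightarrow> g i \<in> C) \<Longrightarrow>
      (\<integral>z. (\<Prod>i<n. g i (z i)) \<partial>M1) = (\<integral>z. (\<Prod>i<n. g i (z i)) \<partial>M2)"
    and A: "\<And>i. i < n \<Longrightarrow> blim C (\<lambda>x. if A i x then 1 else 0)" 
      "\<And>i. i < n \<Longrightarrow> {x. A i x} \<in> sets borel"
  shows "measure M1 {z. \<forall>i<n. A i (z i)} = measure M2 {z. \<forall>i<n. A i (z i)}"
proof -
  have R: "{z. \<forall>i<n. A i (z i)} \<in> sets seqM" by (rule rect_sets) (rule A(2))
  have "complex_of_real (measure M {z. \<forall>i<n. A i (z i)}) = (\<integral>z. (\<Prod>i<n. if A i (z i) then 1 else 0) \<partial>M)"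
    if "sets M = sets seqM" "finite_measure M" for M
  proof -
    interpret finite_measure M by fact
    have sp: "space M = UNIV" using sets_eq_imp_space_eq[OF that(1)] by (simp add: space_PiM)
    have "(\<integral>z. (\<Prod>i<n. if A i (z i) then 1 else 0 :: complex) \<partial>M) = (\<integral>z. of_real (indicator {z. \<forall>i<n. A i (z i)} z) \<partial>M)"
      by (intro Bochner_Integration.integral_cong refl) (auto simp: indicator_def)
    also have "\<dots> = of_real (measure M {z. \<forall>i<n. A i (z i)})"
      using R that(1) by (simp add: sp)
    finally show ?thesis by simp
  qed
  from this[OF M(3,1)] this[OF M(4,2)] integral_prod_blim_eq[OF M C eq, where g = "\<lambda>i x. if A i x then 1 else 0"] A(1)
  show ?thesis by (simp flip: of_real_eq_iff[where ?'a = complex])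
qed

lemma laplace_rect_unique:
  fixes M1 M2 :: "(nat \<Rightarrow> real) measure"
  assumes M: "finite_measure M1" "finite_measure M2" "sets M1 = sets seqM" "sets M2 = sets seqM"
    and eq: "\<And>s. \<forall>i. 0 < s i \<Longrightarrow>
      (\<integral>z. exp (- (\<Sum>i<n. s i * \<bar>z i\<bar>)) \<partial>M1) = (\<integral>z. exp (- (\<Sum>i<n. s i * \<bar>z i\<bar>)) \<partial>M2)"
    and c: "\<And>i. i < n \<Longrightarrow> 0 \<le> c i"
  shows "measure M1 {z. \<forall>i<n. \<bar>z i\<bar> \<le> c i} = measure M2 {z. \<forall>i<n. \<bar>z i\<bar> \<le> c i}"
proof (rule measure_rect_eq[OF M exp_chars_bounded])
  fix g assume "\<And>i. i < n \<Longrightarrow> g i \<in> exp_chars"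
  then have "\<forall>i. \<exists>s. i < n \<longrightarrow> 0 < s \<and> g i = (\<lambda>x. of_real (exp (- (s * \<bar>x\<bar>))))"
    by (auto simp: exp_chars_def)
  from choice[OF this] obtain s' where
    s': "\<And>i. i < n \<Longrightarrow> 0 < s' i \<and> g i = (\<lambda>x. of_real (exp (- (s' i * \<bar>x\<bar>))))" by blast
  \<comment> \<open>Indices from \<open>n\<close> on get the value 1, because the hypothesis
    \<open>eq\<close> speaks of sequences that are positive everywhere.\<close>
  define s where "s i = (if i < n then s' i else 1)" for i
  have s: "\<forall>i. 0 < s i" using s' by (auto simp: s_def)
  have "(\<Prod>i<n. g i (z i)) = of_real (exp (- (\<Sum>i<n. s i * \<bar>z i\<bar>)))" for z
  proof -
    have "(\<Prod>i<n. g i (z i)) = (\<Prod>i<n. of_real (exp (- (s i * \<bar>z i\<bar>))))"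
      by (intro prod.cong refl) (simp add: s' s_def)
    then show ?thesis by (simp add: exp_sum sum_negf[symmetric] flip: of_real_prod)
  qed
  then show "(\<integral>z. (\<Prod>i<n. g i (z i)) \<partial>M1) = (\<integral>z. (\<Prod>i<n. g i (z i)) \<partial>M2)"
    by (simp add: eq[OF s])
qed (auto intro!: blim_exp_indicator c)

lemma cis_rect_unique:
  fixes M1 M2 :: "(nat \<Rightarrow> real) measure"
  assumes M: "finite_measure M1" "finite_measure M2" "sets M1 = sets seqM" "sets M2 = sets seqM"
    and eq: "\<And>t. (\<integral>z. cis (\<Sum>i<n. t i * z i) \<partial>M1) = (\<integral>z. cis (\<Sum>i<n. t i * z i) \<partial>M2)"
  shows "measure M1 {z. \<forall>i<n. z i \<le> c i} = measure M2 {z. \<forall>i<n. z i \<le> c i}"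
proof (rule measure_rect_eq[OF M cis_chars_bounded])
  fix g assume "\<And>i. i < n \<Longrightarrow> g i \<in> cis_chars"
  then have "\<forall>i. \<exists>t. i < n \<longrightarrow> g i = (\<lambda>x. cis (t * x))" by (auto simp: cis_chars_def)
  from choice[OF this] obtain t where t: "\<And>i. i < n \<Longrightarrow> g i = (\<lambda>x. cis (t i * x))" by blast
  have "(\<Prod>i<n. g i (z i)) = cis (\<Sum>i<n. t i * z i)" for z
  proof -
    have "(\<Prod>i<n. g i (z i)) = (\<Prod>i<n. cis (t i * z i))" by (intro prod.cong refl) (simp add: t)
    then show ?thesis by (simp add: cis_conv_exp exp_sum sum_distrib_left)
  qed
  then show "(\<integral>z. (\<Prod>i<n. g i (z i)) \<partial>M1) = (\<integral>z. (\<Prod>i<n. g i (z i)) \<partial>M2)"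
    by (simp add: eq)
qed (auto intro!: blim_cis_indicator)

section \<open>Gaussian sequences\<close>

lemma cis_std_normal:
  "(\<integral>x. cis (t * x) \<partial>std_normal_distribution) = of_real (exp (- (t\<^sup>2) / 2))"
  using fun_cong[OF char_std_normal_distribution, of t] by (simp add: char_def cis_conv_exp)

text \<open>The moments in \<open>centered_gaussian_sequence\<close> are Bochner integrals, whose
  values carry information once integrability is known; it is derived here from the law. In the
  degenerate case a centred variable is almost surely 0, and both sides of the formula for
  \<open>cis\<close> are 1.\<close>

lemma gaussian_variable_moments:
  assumes "prob_space N" "gaussian_variable N Y"
  shows gaussian_integrable: "integrable N Y"
    and gaussian_integrable_square: "integrable N (\<lambda>\<omega>. (Y \<omega>)\<^sup>2)"
    and gaussian_cis: "integral\<^sup>L N Y = 0 \<Longrightarrow>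
      (\<integral>\<omega>. cis (Y \<omega>) \<partial>N) = of_real (exp (- (\<integral>\<omega>. (Y \<omega>)\<^sup>2 \<partial>N) / 2))"
proof -
  interpret N: prob_space N by fact
  have Y: "Y \<in> borel_measurable N" using assms(2) by (simp add: gaussian_variable_def)
  consider (normal) \<mu> \<sigma> where "0 < \<sigma>" "distributed N lborel Y (\<lambda>x. ennreal (normal_density \<mu> \<sigma> x))"
    | (const) \<mu> where "AE \<omega> in N. Y \<omega> = \<mu>"
    using assms(2) by (auto simp: gaussian_variable_def)
  then have "integrable N Y \<and> integrable N (\<lambda>\<omega>. (Y \<omega>)\<^sup>2) \<and> (integral\<^sup>L N Y = 0 \<longrightarrow>
      (\<integral>\<omega>. cis (Y \<omega>) \<partial>N) = of_real (exp (- (\<integral>\<omega>. (Y \<omega>)\<^sup>2 \<partial>N) / 2)))"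
  proof cases
    case normal
    note D = normal(2)
    have 1: "integrable N Y"
      by (rule distributed_integrable_var[OF D]) (use integrable_normal_moment_nz_1[OF normal(1)] in auto)
    have "integrable lborel (\<lambda>x. normal_density \<mu> \<sigma> x * (x - \<mu>)^2 + (2 * \<mu> * (normal_density \<mu> \<sigma> x * x) - \<mu>\<^sup>2 * normal_density \<mu> \<sigma> x))"
      by (intro Bochner_Integration.integrable_add Bochner_Integration.integrable_diff integrable_mult_right
          integrable_normal_moment integrable_normal_moment_nz_1 integrable_normal_density normal(1))
    also have "(\<lambda>x. normal_density \<mu> \<sigma> x * (x - \<mu>)^2 + (2 * \<mu> * (normal_density \<mu> \<sigma> x * x) - \<mu>\<^sup>2 * normal_density \<mu> \<sigma> x)) =
        (\<lambda>x. normal_density \<mu> \<sigma> x * x\<^sup>2)"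
      by (auto simp: fun_eq_iff power2_eq_square algebra_simps)
    finally have 2: "integrable N (\<lambda>\<omega>. (Y \<omega>)\<^sup>2)"
      using distributed_integrable[OF D, of "\<lambda>x. x\<^sup>2"] by simp
    have 3: "(\<integral>\<omega>. cis (Y \<omega>) \<partial>N) = of_real (exp (- (\<integral>\<omega>. (Y \<omega>)\<^sup>2 \<partial>N) / 2))" if "integral\<^sup>L N Y = 0"
    proof -
      have mu: "\<mu> = 0" using N.normal_distributed_expectation[OF normal] that by simp
      have var: "(\<integral>\<omega>. (Y \<omega>)\<^sup>2 \<partial>N) = \<sigma>\<^sup>2"
        using N.normal_distributed_variance[OF normal] that by simp
      have "distributed N lborel (\<lambda>\<omega>. Y \<omega> / \<sigma>) (\<lambda>x. ennreal (std_normal_density x))"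
        using N.normal_standard_normal_convert[OF normal(1), of Y \<mu>] D mu by simp
      then have d: "distr N lborel (\<lambda>\<omega>. Y \<omega> / \<sigma>) = std_normal_distribution"
        by (rule distributed_distr_eq_density)
      have "(\<integral>\<omega>. cis (Y \<omega>) \<partial>N) = (\<integral>\<omega>. cis (\<sigma> * (Y \<omega> / \<sigma>)) \<partial>N)" using normal(1) by simp
      also have "\<dots> = (\<integral>x. cis (\<sigma> * x) \<partial>distr N lborel (\<lambda>\<omega>. Y \<omega> / \<sigma>))"
        by (rule integral_distr[symmetric])
           (use Y in \<open>auto intro!: borel_measurable_continuous_onI continuous_intros\<close>)
      finally show ?thesis by (simp add: d cis_std_normal var)
    qed
    show ?thesis using 1 2 3 by blast
  next
    case const
    have 1: "integrable N Y"
      by (subst integrable_cong_AE[where g = "\<lambda>_. \<mu>"]) (use const Y in auto)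
    have 2: "integrable N (\<lambda>\<omega>. (Y \<omega>)\<^sup>2)"
      by (subst integrable_cong_AE[where g = "\<lambda>_. \<mu>\<^sup>2"]) (use const Y in \<open>auto elim: eventually_mono\<close>)
    have e: "integral\<^sup>L N Y = \<mu>"
      by (subst integral_cong_AE[where g = "\<lambda>_. \<mu>"]) (use const Y in \<open>auto simp: N.prob_space\<close>)
    have 3: "(\<integral>\<omega>. cis (Y \<omega>) \<partial>N) = of_real (exp (- (\<integral>\<omega>. (Y \<omega>)\<^sup>2 \<partial>N) / 2))" if "integral\<^sup>L N Y = 0"
    proof -
      have Y0: "AE \<omega> in N. Y \<omega> = 0" using const e that by simp
      have cm: "cis \<in> borel_measurable borel" by (intro borel_measurable_continuous_onI continuous_intros)
      have "(\<integral>\<omega>. cis (Y \<omega>) \<partial>N) = (\<integral>\<omega>. 1 \<partial>N)"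
        by (rule integral_cong_AE) (use Y0 measurable_compose[OF Y cm] in \<open>auto elim: eventually_mono\<close>)
      moreover have "(\<integral>\<omega>. (Y \<omega>)\<^sup>2 \<partial>N) = (\<integral>\<omega>. 0 \<partial>N)"
        by (rule integral_cong_AE) (use Y0 Y in \<open>auto elim: eventually_mono\<close>)
      ultimately show ?thesis by (simp add: N.prob_space)
    qed
    show ?thesis using 1 2 3 by blast
  qed
  then show "integrable N Y" "integrable N (\<lambda>\<omega>. (Y \<omega>)\<^sup>2)"
    "integral\<^sup>L N Y = 0 \<Longrightarrow> (\<integral>\<omega>. cis (Y \<omega>) \<partial>N) = of_real (exp (- (\<integral>\<omega>. (Y \<omega>)\<^sup>2 \<partial>N) / 2))"
    by auto
qed

lemma centered_gaussian_gaussian: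
  assumes "centered_gaussian_sequence N C \<eta>"
  shows "gaussian_variable N (\<eta> j)"
proof -
  have "gaussian_variable N (\<lambda>\<omega>. \<Sum>k<Suc j. (if k = j then 1 else 0) * \<eta> k \<omega>)"
    using assms by (simp only: centered_gaussian_sequence_def)
  moreover have "(\<Sum>k<Suc j. (if k = j then 1 else 0) * \<eta> k \<omega>) = \<eta> j \<omega>" for \<omega>
    by simp
  ultimately show ?thesis by simp
qed

lemma centered_gaussian_cis:
  assumes G: "centered_gaussian_sequence N C \<eta>"
  shows "(\<integral>\<omega>. cis (\<Sum>j<n. a j * \<eta> j \<omega>) \<partial>N) =
    of_real (exp (- (\<Sum>i<n. \<Sum>j<n. a i * a j * C i j) / 2))"
proof -
  have N: "prob_space N" using G by (simp add: centered_gaussian_sequence_def)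
  interpret N: prob_space N by fact
  note g = centered_gaussian_gaussian[OF G]
  have m: "\<eta> j \<in> borel_measurable N" for j using g by (simp add: gaussian_variable_def)
  have i1: "integrable N (\<eta> j)" and i2: "integrable N (\<lambda>\<omega>. (\<eta> j \<omega>)\<^sup>2)" for j
    using gaussian_integrable[OF N g] gaussian_integrable_square[OF N g] by auto
  have i12: "integrable N (\<lambda>\<omega>. \<eta> j \<omega> * \<eta> k \<omega>)" for j k
  proof (rule Bochner_Integration.integrable_bound[OF Bochner_Integration.integrable_add[OF i2[of j] i2[of k]]])
    show "AE \<omega> in N. norm (\<eta> j \<omega> * \<eta> k \<omega>) \<le> norm ((\<eta> j \<omega>)\<^sup>2 + (\<eta> k \<omega>)\<^sup>2)"
    proof (rule AE_I2)
      fix \<omega>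
      have "2 * \<bar>\<eta> j \<omega> * \<eta> k \<omega>\<bar> \<le> (\<eta> j \<omega>)\<^sup>2 + (\<eta> k \<omega>)\<^sup>2"
        using sum_squares_bound[of "\<bar>\<eta> j \<omega>\<bar>" "\<bar>\<eta> k \<omega>\<bar>"] by (simp add: abs_mult)
      then show "norm (\<eta> j \<omega> * \<eta> k \<omega>) \<le> norm ((\<eta> j \<omega>)\<^sup>2 + (\<eta> k \<omega>)\<^sup>2)" by simp
    qed
  qed (use m in measurable)
  let ?Y = "\<lambda>\<omega>. \<Sum>j<n. a j * \<eta> j \<omega>"
  have Y: "gaussian_variable N ?Y" using G by (simp add: centered_gaussian_sequence_def)
  have E0: "integral\<^sup>L N ?Y = 0"
    using G i1 by (simp add: centered_gaussian_sequence_def)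
  have "(\<integral>\<omega>. (?Y \<omega>)\<^sup>2 \<partial>N) = (\<integral>\<omega>. (\<Sum>i<n. \<Sum>j<n. a i * a j * (\<eta> i \<omega> * \<eta> j \<omega>)) \<partial>N)"
    by (simp add: power2_eq_square sum_product ac_simps)
  also have "\<dots> = (\<Sum>i<n. \<Sum>j<n. a i * a j * C i j)"
    using G i12 by (simp add: centered_gaussian_sequence_def)
  finally show ?thesis using gaussian_cis[OF N Y E0] by simp
qed

lemma centered_gaussian_shift:
  assumes G: "centered_gaussian_sequence N C \<eta>"
  shows "centered_gaussian_sequence N (\<lambda>i j. C (l + i) (l + j)) (\<lambda>j. \<eta> (l + j))"
proof -
  have "gaussian_variable N (\<lambda>\<omega>. \<Sum>j<n. a j * \<eta> (l + j) \<omega>)" for n a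
  proof -
    have "gaussian_variable N (\<lambda>\<omega>. \<Sum>j<l + n. (if j < l then 0 else a (j - l)) * \<eta> j \<omega>)"
      using G by (simp only: centered_gaussian_sequence_def)
    moreover have "(\<Sum>j<l + n. (if j < l then 0 else a (j - l)) * \<eta> j \<omega>) = (\<Sum>j<n. a j * \<eta> (l + j) \<omega>)" for \<omega>
      by (simp add: lessThan_atLeast0 sum.atLeastLessThan_concat[of 0 l "l + n", symmetric]
          sum.atLeastLessThan_shift_0[of _ l "l + n"])
    ultimately show ?thesis by simp
  qed
  then show ?thesis using G by (simp add: centered_gaussian_sequence_def)
qed

section \<open>Gaussian integrals and the Laplace transform of squares\<close>

lemma gaussian_integral_1:
  fixes b c :: real
  assumes c: "0 < c"
  shows "(\<integral>\<^sup>+y. ennreal (exp (- (y * b) - (y\<^sup>2 * (c - 1)) / 2)) \<partial>std_normal_distribution) =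
    ennreal (c powr (- 1 / 2) * exp (b\<^sup>2 / (2 * c)))"
proof -
  define \<sigma> where "\<sigma> = 1 / sqrt c"
  define \<mu> where "\<mu> = - b / c"
  have s: "0 < \<sigma>" using c by (simp add: \<sigma>_def)
  have s2: "\<sigma>\<^sup>2 = 1 / c" using c by (simp add: \<sigma>_def power_divide)
  have k: "c powr (- 1 / 2) = 1 / sqrt c"
    using c by (simp add: powr_minus_divide powr_half_sqrt[symmetric])
  have "std_normal_density y * exp (- (y * b) - (y\<^sup>2 * (c - 1)) / 2) =
      c powr (- 1 / 2) * exp (b\<^sup>2 / (2 * c)) * normal_density \<mu> \<sigma> y" for y
  proof -
    have "exp (- y\<^sup>2 / 2) * exp (- (y * b) - (y\<^sup>2 * (c - 1)) / 2) =
        exp (b\<^sup>2 / (2 * c)) * exp (- (y - \<mu>)\<^sup>2 / (2 * \<sigma>\<^sup>2))"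
      unfolding exp_add[symmetric] s2 \<mu>_def
      by (rule arg_cong[where f = exp]) (use c in \<open>simp add: field_simps power2_eq_square\<close>)
    moreover have "1 / sqrt (2 * pi) = c powr (- 1 / 2) * (1 / sqrt (2 * pi * \<sigma>\<^sup>2))"
      unfolding k s2 using c by (simp add: real_sqrt_divide real_sqrt_mult)
    ultimately show ?thesis by (simp add: normal_density_def mult_ac)
  qed
  then have "(\<integral>\<^sup>+y. ennreal (exp (- (y * b) - (y\<^sup>2 * (c - 1)) / 2)) \<partial>std_normal_distribution) =
      (\<integral>\<^sup>+y. ennreal (c powr (- 1 / 2) * exp (b\<^sup>2 / (2 * c))) * ennreal (normal_density \<mu> \<sigma> y) \<partial>lborel)"
    by (subst nn_integral_density) (auto simp: ennreal_mult[symmetric] normal_density_nonneg)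
  also have "\<dots> = ennreal (c powr (- 1 / 2) * exp (b\<^sup>2 / (2 * c))) * (\<integral>\<^sup>+y. ennreal (normal_density \<mu> \<sigma> y) \<partial>lborel)"
    by (rule nn_integral_cmult) simp
  also have "(\<integral>\<^sup>+y. ennreal (normal_density \<mu> \<sigma> y) \<partial>lborel) = 1"
    using s by (simp add: nn_integral_eq_integral normal_density_nonneg)
  finally show ?thesis by simp
qed

text \<open>The identity is subtracted from \<open>C\<close> because the standard normal density
  already contributes its part of the exponent. Integrating out the last coordinate gives the factor
  \<open>C n n powr (- 1 / 2)\<close> and leaves the Schur complement in the exponent.\<close>

lemma gaussian_integral:
  assumes "posdef n C"
  shows "(\<integral>\<^sup>+x. ennreal (exp (- (\<Sum>i<n. \<Sum>j<n. x i * x j * (C i j - (if i = j then 1 else 0))) / 2))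
      \<partial>(\<Pi>\<^sub>M i\<in>{..<n}. std_normal_distribution)) = ennreal (Determinant.det (fmat n C) powr (- 1 / 2))"
  using assms
proof (induction n arbitrary: C)
  case 0
  then show ?case by (simp add: PiM_empty nn_integral_count_space_finite)
next
  case (Suc n)
  interpret S: real_distribution std_normal_distribution by (rule real_dist_normal_dist)
  interpret product_sigma_finite "\<lambda>_::nat. std_normal_distribution" by standard
  let ?C = "\<lambda>C i j. C i j - (if i = j then 1 else 0 :: real)"
  let ?Q = "\<lambda>n C x. \<Sum>i<n. \<Sum>j<n. x i * x j * ?C C i j"
  have c: "0 < C n n" using posdef_diag[OF Suc.prems] by simp
  have sym: "C i j = C j i" if "i < Suc n" "j < Suc n" for i j
    using Suc.prems that by (auto simp: posdef_def)
  have ins: "{..<Suc n} = insert n {..<n}" by auto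
  have meas: "(\<lambda>x. ennreal (exp (- ?Q (Suc n) C x / 2))) \<in> borel_measurable (\<Pi>\<^sub>M i\<in>{..<Suc n}. std_normal_distribution)"
  proof -
    have "(\<lambda>x. x i) \<in> borel_measurable (\<Pi>\<^sub>M i\<in>{..<Suc n}. std_normal_distribution)" if "i < Suc n" for i
      using measurable_component_singleton[of i "{..<Suc n}" "\<lambda>_. std_normal_distribution"] that by simp
    then show ?thesis by (intro measurable_compose[OF _ measurable_ennreal] borel_measurable_exp
        borel_measurable_divide borel_measurable_uminus borel_measurable_sum borel_measurable_times
        borel_measurable_const measurable_compose[OF _ borel_measurable_exp]) auto
  qed
  have "(\<integral>\<^sup>+x. ennreal (exp (- ?Q (Suc n) C x / 2)) \<partial>(\<Pi>\<^sub>M i\<in>{..<Suc n}. std_normal_distribution)) =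
      (\<integral>\<^sup>+x. \<integral>\<^sup>+y. ennreal (exp (- ?Q (Suc n) C (x(n := y)) / 2)) \<partial>std_normal_distribution
        \<partial>(\<Pi>\<^sub>M i\<in>{..<n}. std_normal_distribution))"
    using meas unfolding ins by (intro product_nn_integral_insert) auto
  also have "\<dots> = (\<integral>\<^sup>+x. ennreal (C n n powr (- 1 / 2)) * ennreal (exp (- ?Q n (schur C n) x / 2))
        \<partial>(\<Pi>\<^sub>M i\<in>{..<n}. std_normal_distribution))"
  proof (rule nn_integral_cong)
    fix x :: "nat \<Rightarrow> real"
    define b where "b = (\<Sum>i<n. x i * C n i)"
    have "?Q (Suc n) C (x(n := y)) = ?Q n C x + 2 * y * b + y\<^sup>2 * (C n n - 1)" for y
    proof -
      have "?Q (Suc n) C (x(n := y)) = (\<Sum>i<n. \<Sum>j<n. (x(n := y)) i * (x(n := y)) j * ?C C i j) +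
          2 * (x(n := y)) n * (\<Sum>i<n. (x(n := y)) i * ?C C n i) + ((x(n := y)) n)\<^sup>2 * ?C C n n"
        by (rule quadratic_form_Suc) (simp add: sym)
      moreover have "(\<Sum>i<n. \<Sum>j<n. (x(n := y)) i * (x(n := y)) j * ?C C i j) = ?Q n C x"
        by (intro sum.cong refl) simp
      moreover have "(\<Sum>i<n. (x(n := y)) i * ?C C n i) = b"
        unfolding b_def by (intro sum.cong refl) simp
      ultimately show ?thesis by simp
    qed
    then have "(\<integral>\<^sup>+y. ennreal (exp (- ?Q (Suc n) C (x(n := y)) / 2)) \<partial>std_normal_distribution) =
        (\<integral>\<^sup>+y. ennreal (exp (- ?Q n C x / 2)) * ennreal (exp (- (y * b) - (y\<^sup>2 * (C n n - 1)) / 2)) \<partial>std_normal_distribution)"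
      by (intro nn_integral_cong) (simp add: ennreal_mult[symmetric] exp_add[symmetric] add_divide_distrib)
    also have "\<dots> = ennreal (exp (- ?Q n C x / 2)) * ennreal (C n n powr (- 1 / 2) * exp (b\<^sup>2 / (2 * C n n)))"
      by (subst nn_integral_cmult) (simp_all add: gaussian_integral_1[OF c])
    also have "\<dots> = ennreal (C n n powr (- 1 / 2)) * ennreal (exp (- ?Q n C x / 2) * exp (b\<^sup>2 / (2 * C n n)))"
      by (simp add: ennreal_mult[symmetric] mult_ac)
    also have "exp (- ?Q n C x / 2) * exp (b\<^sup>2 / (2 * C n n)) = exp (- ?Q n (schur C n) x / 2)"
    proof -
      have "(\<Sum>i<n. \<Sum>j<n. x i * x j * schur C n i j) = (\<Sum>i<n. \<Sum>j<n. x i * x j * C i j) - b\<^sup>2 / C n n"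
        unfolding b_def by (rule quadratic_form_schur) (simp add: sym)
      then have "?Q n (schur C n) x = ?Q n C x - b\<^sup>2 / C n n"
        by (simp add: right_diff_distrib sum_subtractf)
      then show ?thesis by (simp add: exp_add[symmetric] diff_divide_distrib)
    qed
    finally show "(\<integral>\<^sup>+y. ennreal (exp (- ?Q (Suc n) C (x(n := y)) / 2)) \<partial>std_normal_distribution) =
      ennreal (C n n powr (- 1 / 2)) * ennreal (exp (- ?Q n (schur C n) x / 2))" .
  qed
  also have "\<dots> = ennreal (C n n powr (- 1 / 2)) *
      (\<integral>\<^sup>+x. ennreal (exp (- ?Q n (schur C n) x / 2)) \<partial>(\<Pi>\<^sub>M i\<in>{..<n}. std_normal_distribution))"
  proof (rule nn_integral_cmult)
    have "(\<lambda>x. x i) \<in> borel_measurable (\<Pi>\<^sub>M i\<in>{..<n}. std_normal_distribution)" if "i < n" for i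
      using measurable_component_singleton[of i "{..<n}" "\<lambda>_. std_normal_distribution"] that by simp
    then show "(\<lambda>x. ennreal (exp (- ?Q n (schur C n) x / 2))) \<in> borel_measurable (\<Pi>\<^sub>M i\<in>{..<n}. std_normal_distribution)"
      by (intro measurable_compose[OF _ measurable_ennreal] borel_measurable_exp
        borel_measurable_divide borel_measurable_uminus borel_measurable_sum borel_measurable_times
        borel_measurable_const measurable_compose[OF _ borel_measurable_exp]) auto
  qed
  also have "\<dots> = ennreal (C n n powr (- 1 / 2)) * ennreal (Determinant.det (fmat n (schur C n)) powr (- 1 / 2))"
    by (simp only: Suc.IH[OF posdef_schur[OF Suc.prems]])
  also have "\<dots> = ennreal (Determinant.det (fmat (Suc n) C) powr (- 1 / 2))"
    using c posdef_det_pos[OF posdef_schur[OF Suc.prems]]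
    by (simp add: det_fmat_Suc powr_mult ennreal_mult[symmetric])
  finally show ?case .
qed

lemma cis_sum: "finite A \<Longrightarrow> cis (\<Sum>i\<in>A. f i) = (\<Prod>i\<in>A. cis (f i))"
  by (simp add: cis_conv_exp exp_sum sum_distrib_left)

lemma measurable_cis [measurable]: "cis \<in> borel_measurable borel"
  by (intro borel_measurable_continuous_onI continuous_intros)

lemma posdef_nonneg:
  assumes "posdef n C"
  shows "0 \<le> (\<Sum>i<n. \<Sum>j<n. x i * x j * C i j)"
proof (cases "\<exists>i<n. x i \<noteq> 0")
  case True
  then show ?thesis using assms by (auto simp: posdef_def intro: less_imp_le)
qed simp

lemma posdef_one_plus:
  assumes "posdef n C"
  shows "posdef n (\<lambda>i j. (if i = j then 1 else 0) + r i * r j * C i j)"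
proof -
  have "0 < (\<Sum>i<n. \<Sum>j<n. x i * x j * ((if i = j then 1 else 0) + r i * r j * C i j))"
    if x: "\<exists>i<n. x i \<noteq> 0" for x
  proof -
    have "(\<Sum>i<n. \<Sum>j<n. x i * x j * ((if i = j then 1 else 0) + r i * r j * C i j)) =
      (\<Sum>i<n. \<Sum>j<n. (if i = j then x i * x j else 0) + (x i * r i) * (x j * r j) * C i j)"
      by (intro sum.cong refl) (simp add: algebra_simps)
    also have "\<dots> = (\<Sum>i<n. (x i)\<^sup>2) + (\<Sum>i<n. \<Sum>j<n. (x i * r i) * (x j * r j) * C i j)"
      by (simp add: sum.distrib power2_eq_square)
    moreover have "0 < (\<Sum>i<n. (x i)\<^sup>2)" using x by (auto intro!: sum_pos2)
    moreover have "0 \<le> (\<Sum>i<n. \<Sum>j<n. (x i * r i) * (x j * r j) * C i j)"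
      by (rule posdef_nonneg[OF assms])
    ultimately show ?thesis by linarith
  qed
  then show ?thesis using assms by (auto simp: posdef_def ac_simps)
qed

text \<open>With \<open>R = diag (sqrt s)\<close> one has
  \<open>(I + R C R) R = R (I + C R\<^sup>2)\<close>. The left-hand form is symmetric, as
  \<open>gaussian_integral\<close> requires, the right-hand form is that of the permanental
  definition.\<close>

lemma det_sqrt_conj:
  assumes s: "\<And>i. i < n \<Longrightarrow> 0 < s i"
  shows "Determinant.det (fmat n (\<lambda>i j. (if i = j then 1 else 0) + sqrt (s i) * sqrt (s j) * C i j)) =
    Determinant.det (1\<^sub>m n + fmat n C * mat_diag n s)"
proof -
  let ?A = "fmat n (\<lambda>i j. (if i = j then 1 else 0) + sqrt (s i) * sqrt (s j) * C i j)"
  let ?B = "1\<^sub>m n + fmat n C * mat_diag n s" and ?D = "mat_diag n (\<lambda>i. sqrt (s i))"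
  have dd [simp]: "dim_row (mat_diag n f) = n" "dim_col (mat_diag n f) = n" for f :: "nat \<Rightarrow> real"
    by (simp_all add: mat_diag_def)
  have B: "?B \<in> carrier_mat n n" by (intro carrier_matI) auto
  have "?A * ?D = ?D * ?B"
  proof (rule eq_matI)
    fix i j assume "i < dim_row (?D * ?B)" "j < dim_col (?D * ?B)"
    then have ij: "i < n" "j < n" by auto
    have sj: "sqrt (s j) * sqrt (s j) = s j" using s[OF ij(2)] by simp
    have "(?A * ?D) $$ (i, j) = ((if i = j then 1 else 0) + sqrt (s i) * sqrt (s j) * C i j) * sqrt (s j)"
      using ij by (subst mat_diag_mult_right[where nr = n]) auto
    also have "\<dots> = sqrt (s i) * ((if i = j then 1 else 0) + C i j * s j)"
      using sj by (auto simp: algebra_simps)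
    also have "\<dots> = (?D * ?B) $$ (i, j)"
      using ij by (subst mat_diag_mult_left[OF B], subst mat_diag_mult_right[where nr = n]) auto
    finally show "(?A * ?D) $$ (i, j) = (?D * ?B) $$ (i, j)" .
  qed (auto simp: mat_diag_def)
  then have "Determinant.det (?A * ?D) = Determinant.det (?D * ?B)" by (rule arg_cong)
  moreover have "Determinant.det (?A * ?D) = Determinant.det ?A * Determinant.det ?D"
    by (rule det_mult[where n = n]) auto
  moreover have "Determinant.det (?D * ?B) = Determinant.det ?D * Determinant.det ?B"
    by (rule det_mult[OF _ B]) auto
  moreover have "Determinant.det ?D \<noteq> 0"
  proof -
    have "Determinant.det ?D = prod_list (diag_mat ?D)"
      by (rule det_upper_triangular[where n = n]) (auto simp: mat_diag_def upper_triangular_def)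
    moreover have "0 \<notin> set (diag_mat ?D)"
      using s by (auto simp: diag_mat_def mat_diag_def dest!: s)
    ultimately show ?thesis by (simp add: prod_list_zero_iff)
  qed
  ultimately show ?thesis by simp
qed

text \<open>The squares are linearised: \<open>exp (- s y\<^sup>2 / 2)\<close> is the characteristic
  function of an auxiliary standard normal variable at \<open>sqrt s * y\<close>. After Fubini the
  inner integral is a characteristic function of \<open>\<eta>\<close>, so no joint density of
  \<open>\<eta>\<close> enters, and the outer one is \<open>gaussian_integral\<close>.\<close>

lemma centered_gaussian_laplace:
  assumes G: "centered_gaussian_sequence N C \<eta>" and C: "posdef n C" and s: "\<And>j. j < n \<Longrightarrow> 0 < s j"
  shows "(\<integral>\<omega>. exp (- (\<Sum>j<n. s j * ((\<eta> j \<omega>)\<^sup>2 / 2))) \<partial>N) =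
    Determinant.det (1\<^sub>m n + fmat n C * mat_diag n s) powr (- 1 / 2)"
proof -
  interpret N: prob_space N using G by (simp add: centered_gaussian_sequence_def)
  interpret S: real_distribution std_normal_distribution by (rule real_dist_normal_dist)
  interpret P: product_prob_space "\<lambda>_::nat. std_normal_distribution" "{..<n}" ..
  let ?W = "\<Pi>\<^sub>M i\<in>{..<n}. std_normal_distribution"
  interpret NW: pair_prob_space N ?W ..
  have \<eta>: "\<eta> j \<in> borel_measurable N" for j
    using centered_gaussian_gaussian[OF G] by (simp add: gaussian_variable_def)
  let ?F = "\<lambda>\<omega> x. cis (\<Sum>j<n. sqrt (s j) * x j * \<eta> j \<omega>)"
  let ?C = "\<lambda>i j. (if i = j then 1 else 0) + sqrt (s i) * sqrt (s j) * C i j"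
  have 1: "(\<integral>x. ?F \<omega> x \<partial>?W) = of_real (exp (- (\<Sum>j<n. s j * ((\<eta> j \<omega>)\<^sup>2 / 2))))" for \<omega>
  proof -
    have "(\<integral>x. ?F \<omega> x \<partial>?W) = (\<integral>x. (\<Prod>j<n. cis ((sqrt (s j) * \<eta> j \<omega>) * x j)) \<partial>?W)"
      by (simp add: cis_sum mult_ac)
    also have "\<dots> = (\<Prod>j<n. \<integral>x. cis ((sqrt (s j) * \<eta> j \<omega>) * x) \<partial>std_normal_distribution)"
    proof (rule P.product_integral_prod)
      show "integrable std_normal_distribution (\<lambda>x. cis ((sqrt (s i) * \<eta> i \<omega>) * x))" for i
        by (rule S.integrable_const_bound[where B = 1]) auto
    qed simp
    also have "\<dots> = (\<Prod>j<n. of_real (exp (- (s j * ((\<eta> j \<omega>)\<^sup>2 / 2)))))"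
      using s by (intro prod.cong refl) (simp add: cis_std_normal power_mult_distrib less_imp_le)
    also have "\<dots> = of_real (exp (- (\<Sum>j<n. s j * ((\<eta> j \<omega>)\<^sup>2 / 2))))"
      by (simp add: exp_sum sum_negf[symmetric] flip: of_real_prod)
    finally show ?thesis .
  qed
  have comp: "(\<lambda>p. snd p j) \<in> borel_measurable (N \<Otimes>\<^sub>M ?W)" if "j < n" for j
  proof -
    have "(\<lambda>x. x j) \<in> borel_measurable ?W"
      using measurable_component_singleton[of j "{..<n}" "\<lambda>_. std_normal_distribution"] that by simp
    then show ?thesis by (rule measurable_compose[OF measurable_snd])
  qed
  have "(\<lambda>p. \<Sum>j<n. sqrt (s j) * snd p j * \<eta> j (fst p)) \<in> borel_measurable (N \<Otimes>\<^sub>M ?W)"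
    by (intro borel_measurable_sum borel_measurable_times borel_measurable_const comp
        measurable_compose[OF measurable_fst \<eta>]) auto
  from measurable_compose[OF this measurable_cis]
  have Fm: "(\<lambda>(\<omega>, x). ?F \<omega> x) \<in> borel_measurable (N \<Otimes>\<^sub>M ?W)" by (simp add: split_def)
  have Fi: "integrable (N \<Otimes>\<^sub>M ?W) (\<lambda>(\<omega>, x). ?F \<omega> x)"
    by (rule NW.integrable_const_bound[where B = 1, OF _ Fm]) auto
  have "complex_of_real (\<integral>\<omega>. exp (- (\<Sum>j<n. s j * ((\<eta> j \<omega>)\<^sup>2 / 2))) \<partial>N) = (\<integral>\<omega>. (\<integral>x. ?F \<omega> x \<partial>?W) \<partial>N)"
    by (simp add: 1)
  also have "\<dots> = (\<integral>x. (\<integral>\<omega>. ?F \<omega> x \<partial>N) \<partial>?W)"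
    by (rule NW.Fubini_integral[OF Fi, symmetric])
  also have "\<dots> = (\<integral>x. of_real (exp (- (\<Sum>i<n. \<Sum>j<n. x i * x j * (?C i j - (if i = j then 1 else 0))) / 2)) \<partial>?W)"
  proof (intro Bochner_Integration.integral_cong refl)
    fix x
    have "(\<integral>\<omega>. ?F \<omega> x \<partial>N) = of_real (exp (- (\<Sum>i<n. \<Sum>j<n. (sqrt (s i) * x i) * (sqrt (s j) * x j) * C i j) / 2))"
      by (rule centered_gaussian_cis[OF G])
    then show "(\<integral>\<omega>. ?F \<omega> x \<partial>N) = of_real (exp (- (\<Sum>i<n. \<Sum>j<n. x i * x j * (?C i j - (if i = j then 1 else 0))) / 2))"
      by (simp add: mult_ac)
  qed
  also have "\<dots> = of_real (enn2real (\<integral>\<^sup>+x. ennreal (exp (- (\<Sum>i<n. \<Sum>j<n. x i * x j * (?C i j - (if i = j then 1 else 0))) / 2)) \<partial>?W))"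
  proof (subst integral_complex_of_real, rule arg_cong[where f = of_real], rule integral_eq_nn_integral)
    have "(\<lambda>x. x i) \<in> borel_measurable ?W" if "i < n" for i
      using measurable_component_singleton[of i "{..<n}" "\<lambda>_. std_normal_distribution"] that by simp
    then show "(\<lambda>x. exp (- (\<Sum>i<n. \<Sum>j<n. x i * x j * (?C i j - (if i = j then 1 else 0))) / 2)) \<in> borel_measurable ?W"
      by (intro borel_measurable_divide borel_measurable_uminus borel_measurable_sum borel_measurable_times
        borel_measurable_const measurable_compose[OF _ borel_measurable_exp]) auto
  qed auto
  also have "\<dots> = of_real (Determinant.det (fmat n ?C) powr (- 1 / 2))"
    by (subst gaussian_integral[OF posdef_one_plus[OF C]]) simp
  also have "Determinant.det (fmat n ?C) = Determinant.det (1\<^sub>m n + fmat n C * mat_diag n s)"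
    by (rule det_sqrt_conj[OF s])
  finally show ?thesis by (simp only: of_real_eq_iff)
qed

section \<open>Independent copies, rotations and tails\<close>

lemma copies_laplace:
  assumes G: "centered_gaussian_sequence N C \<eta>" and C: "posdef n C" and s: "\<And>j. j < n \<Longrightarrow> 0 < s j"
  shows "(\<integral>\<omega>. exp (- (\<Sum>j<n. s j * (\<Sum>i<m. (\<eta> j (\<omega> i))\<^sup>2 / 2))) \<partial>(\<Pi>\<^sub>M i\<in>{..<m}. N)) =
    Determinant.det (1\<^sub>m n + fmat n C * mat_diag n s) powr (- real m / 2)"
proof -
  interpret N: prob_space N using G by (simp add: centered_gaussian_sequence_def)
  interpret P: product_prob_space "\<lambda>_::nat. N" "{..<m}" ..
  have \<eta>: "\<eta> j \<in> borel_measurable N" for j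
    using centered_gaussian_gaussian[OF G] by (simp add: gaussian_variable_def)
  have "(\<integral>\<omega>. exp (- (\<Sum>j<n. s j * (\<Sum>i<m. (\<eta> j (\<omega> i))\<^sup>2 / 2))) \<partial>(\<Pi>\<^sub>M i\<in>{..<m}. N)) =
    (\<integral>\<omega>. (\<Prod>i<m. exp (- (\<Sum>j<n. s j * ((\<eta> j (\<omega> i))\<^sup>2 / 2)))) \<partial>(\<Pi>\<^sub>M i\<in>{..<m}. N))"
  proof (intro Bochner_Integration.integral_cong refl)
    fix \<omega> :: "nat \<Rightarrow> 'a"
    have "(\<Sum>j<n. s j * (\<Sum>i<m. (\<eta> j (\<omega> i))\<^sup>2 / 2)) = (\<Sum>i<m. \<Sum>j<n. s j * ((\<eta> j (\<omega> i))\<^sup>2 / 2))"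
      unfolding sum_distrib_left by (rule sum.swap)
    then show "exp (- (\<Sum>j<n. s j * (\<Sum>i<m. (\<eta> j (\<omega> i))\<^sup>2 / 2))) =
        (\<Prod>i<m. exp (- (\<Sum>j<n. s j * ((\<eta> j (\<omega> i))\<^sup>2 / 2))))"
      by (simp add: exp_sum sum_negf[symmetric] del: sum_negf)
  qed
  also have "\<dots> = (\<Prod>i<m. \<integral>\<omega>. exp (- (\<Sum>j<n. s j * ((\<eta> j \<omega>)\<^sup>2 / 2))) \<partial>N)"
  proof (rule P.product_integral_prod)
    show "integrable N (\<lambda>\<omega>. exp (- (\<Sum>j<n. s j * ((\<eta> j \<omega>)\<^sup>2 / 2))))" for i :: nat
    proof (rule N.integrable_const_bound[where B = 1])
      show "AE \<omega> in N. norm (exp (- (\<Sum>j<n. s j * ((\<eta> j \<omega>)\<^sup>2 / 2)))) \<le> 1"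
        using s by (intro AE_I2) (auto intro!: sum_nonneg simp: less_imp_le)
      show "(\<lambda>\<omega>. exp (- (\<Sum>j<n. s j * ((\<eta> j \<omega>)\<^sup>2 / 2)))) \<in> borel_measurable N"
        using \<eta> by measurable
    qed
  qed simp
  also have "\<dots> = (Determinant.det (1\<^sub>m n + fmat n C * mat_diag n s) powr (- 1 / 2)) ^ m"
    by (simp only: centered_gaussian_laplace[OF G C s] prod_constant card_lessThan)
  also have "\<dots> = Determinant.det (1\<^sub>m n + fmat n C * mat_diag n s) powr (- real m / 2)"
  proof -
    have "0 < Determinant.det (1\<^sub>m n + fmat n C * mat_diag n s)"
      using posdef_det_pos[OF posdef_one_plus[OF C, of "\<lambda>i. sqrt (s i)"]] by (simp only: det_sqrt_conj[OF s])
    then show ?thesis by (simp add: powr_power mult.commute)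
  qed
  finally show ?thesis .
qed

lemma measure_distr_rect:
  assumes Y: "\<And>j. Y j \<in> borel_measurable M" and A: "\<And>i. i < n \<Longrightarrow> {x. A i x} \<in> sets borel"
  shows "measure (distr M seqM (\<lambda>\<omega> j. Y j \<omega>)) {z. \<forall>i<n. A i (z i)} = measure M {\<omega> \<in> space M. \<forall>i<n. A i (Y i \<omega>)}"
    and "(\<lambda>\<omega> j. Y j \<omega>) \<in> M \<rightarrow>\<^sub>M seqM"
proof -
  show m: "(\<lambda>\<omega> j. Y j \<omega>) \<in> M \<rightarrow>\<^sub>M seqM"
    by (rule measurable_PiM_single') (auto simp: space_PiM Y)
  show "measure (distr M seqM (\<lambda>\<omega> j. Y j \<omega>)) {z. \<forall>i<n. A i (z i)} = measure M {\<omega> \<in> space M. \<forall>i<n. A i (Y i \<omega>)}"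
    by (subst measure_distr[OF m rect_sets[OF A]]) (auto intro!: arg_cong[where f = "measure M"])
qed

text \<open>The combination of independent copies of \<open>\<eta>\<close> with coefficients
  \<open>u\<close> has covariance \<open>\<Sum>i (u i)\<^sup>2\<close> times \<open>C\<close>, that
  is \<open>C\<close>, hence the same characteristic functions as \<open>\<eta>\<close>.\<close>

lemma copies_rotate:
  fixes m :: nat
  assumes G: "centered_gaussian_sequence N C \<eta>" and u: "(\<Sum>i<m. (u i)\<^sup>2) = 1"
  shows "measure (\<Pi>\<^sub>M i\<in>{..<m}. N) {\<omega> \<in> space (\<Pi>\<^sub>M i\<in>{..<m}. N). \<forall>j<n. (\<Sum>i<m. u i * \<eta> j (\<omega> i)) \<le> c j} =
    measure N {\<omega> \<in> space N. \<forall>j<n. \<eta> j \<omega> \<le> c j}"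
proof -
  interpret N: prob_space N using G by (simp add: centered_gaussian_sequence_def)
  interpret P: product_prob_space "\<lambda>_::nat. N" "{..<m}" ..
  let ?M = "\<Pi>\<^sub>M i\<in>{..<m}. N"
  let ?Y = "\<lambda>j \<omega>. \<Sum>i<m. u i * \<eta> j (\<omega> i)"
  have \<eta>: "\<eta> j \<in> borel_measurable N" for j
    using centered_gaussian_gaussian[OF G] by (simp add: gaussian_variable_def)
  have "(\<lambda>\<omega>. \<omega> i) \<in> ?M \<rightarrow>\<^sub>M N" if "i < m" for i
    by (rule measurable_component_singleton) (use that in simp)
  from measurable_compose[OF this \<eta>] have Y: "?Y j \<in> borel_measurable ?M" for j
    by (intro borel_measurable_sum borel_measurable_times borel_measurable_const) auto
  have mY: "(\<lambda>\<omega> j. ?Y j \<omega>) \<in> ?M \<rightarrow>\<^sub>M seqM" and m\<eta>: "(\<lambda>\<omega> j. \<eta> j \<omega>) \<in> N \<rightarrow>\<^sub>M seqM"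
    by (rule measurable_PiM_single'; auto simp: space_PiM Y \<eta>)+
  have cm: "(\<lambda>z. cis (\<Sum>j<n. t j * z j)) \<in> borel_measurable seqM" for t :: "nat \<Rightarrow> real"
    by measurable
  have "measure (distr ?M seqM (\<lambda>\<omega> j. ?Y j \<omega>)) {z. \<forall>j<n. z j \<le> c j} =
      measure (distr N seqM (\<lambda>\<omega> j. \<eta> j \<omega>)) {z. \<forall>j<n. z j \<le> c j}"
  proof (rule cis_rect_unique)
    show "finite_measure (distr ?M seqM (\<lambda>\<omega> j. ?Y j \<omega>))" by (rule P.finite_measure_distr[OF mY])
    show "finite_measure (distr N seqM (\<lambda>\<omega> j. \<eta> j \<omega>))" by (rule N.finite_measure_distr[OF m\<eta>])
    fix t :: "nat \<Rightarrow> real"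
    have "(\<integral>z. cis (\<Sum>j<n. t j * z j) \<partial>distr ?M seqM (\<lambda>\<omega> j. ?Y j \<omega>)) = (\<integral>\<omega>. cis (\<Sum>j<n. t j * ?Y j \<omega>) \<partial>?M)"
      by (rule integral_distr[OF mY cm])
    also have "\<dots> = (\<integral>\<omega>. (\<Prod>i<m. cis (\<Sum>j<n. (u i * t j) * \<eta> j (\<omega> i))) \<partial>?M)"
    proof (intro Bochner_Integration.integral_cong refl)
      fix \<omega> :: "nat \<Rightarrow> 'a"
      have "(\<Sum>j<n. t j * ?Y j \<omega>) = (\<Sum>i<m. \<Sum>j<n. (u i * t j) * \<eta> j (\<omega> i))"
        unfolding sum_distrib_left by (subst sum.swap) (simp add: mult_ac)
      then show "cis (\<Sum>j<n. t j * ?Y j \<omega>) = (\<Prod>i<m. cis (\<Sum>j<n. (u i * t j) * \<eta> j (\<omega> i)))"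
        by (simp add: cis_sum)
    qed
    also have "\<dots> = (\<Prod>i<m. \<integral>\<omega>. cis (\<Sum>j<n. (u i * t j) * \<eta> j \<omega>) \<partial>N)"
    proof (rule P.product_integral_prod)
      show "integrable N (\<lambda>\<omega>. cis (\<Sum>j<n. (u i * t j) * \<eta> j \<omega>))" for i
        by (rule N.integrable_const_bound[where B = 1]) (use \<eta> in auto)
    qed simp
    also have "\<dots> = (\<Prod>i<m. of_real (exp (- (\<Sum>k<n. \<Sum>j<n. (u i * t k) * (u i * t j) * C k j) / 2)))"
      by (simp only: centered_gaussian_cis[OF G])
    also have "\<dots> = of_real (exp (\<Sum>i<m. (u i)\<^sup>2 * (- (\<Sum>k<n. \<Sum>j<n. t k * t j * C k j) / 2)))"
      unfolding exp_sum[OF finite_lessThan] of_real_prod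
      by (intro prod.cong refl arg_cong[where f = "\<lambda>x. complex_of_real (exp x)"])
         (simp add: sum_distrib_left power2_eq_square mult_ac)
    also have "\<dots> = (\<integral>\<omega>. cis (\<Sum>j<n. t j * \<eta> j \<omega>) \<partial>N)"
      by (simp only: centered_gaussian_cis[OF G] sum_distrib_right[symmetric] u mult_1)
    also have "\<dots> = (\<integral>z. cis (\<Sum>j<n. t j * z j) \<partial>distr N seqM (\<lambda>\<omega> j. \<eta> j \<omega>))"
      by (rule integral_distr[OF m\<eta> cm, symmetric])
    finally show "(\<integral>z. cis (\<Sum>j<n. t j * z j) \<partial>distr ?M seqM (\<lambda>\<omega> j. ?Y j \<omega>)) =
      (\<integral>z. cis (\<Sum>j<n. t j * z j) \<partial>distr N seqM (\<lambda>\<omega> j. \<eta> j \<omega>))" .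
  qed simp_all
  then show ?thesis
    using measure_distr_rect(1)[of ?Y ?M n "\<lambda>j x. x \<le> c j", OF Y] measure_distr_rect(1)[of \<eta> N n "\<lambda>j x. x \<le> c j", OF \<eta>]
    by simp
qed

text \<open>\<open>F\<close> consists of normalised non-zero integer vectors with entries in
  \<open>{- K..K}\<close>. For \<open>y\<close> of length \<open>q\<close> the vector
  \<open>k\<close> of the integer parts of \<open>K y / q\<close> differs from
  \<open>K y / q\<close> by at most 1 in each coordinate. Hence the inner product of
  \<open>k\<close> and \<open>y\<close> is at least \<open>(K - m) q\<close>, while the length of
  \<open>k\<close> is at most \<open>K + m\<close>.\<close>

lemma sphere_net:
  fixes e :: real and m :: nat
  assumes e: "0 < e"
  obtains F :: "(nat \<Rightarrow> real) set" where "finite F" "\<And>u. u \<in> F \<Longrightarrow> (\<Sum>i<m. (u i)\<^sup>2) = 1"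
    "\<And>y r. 0 < r \<Longrightarrow> ((1 + e) * r)\<^sup>2 < (\<Sum>i<m. (y i)\<^sup>2) \<Longrightarrow> \<exists>u\<in>F. r < (\<Sum>i<m. u i * y i)"
proof -
  \<comment> \<open>This is the choice that makes \<open>K + m \<le> (1 + e) (K - m)\<close>, which
    is fact \<open>Ke\<close>.\<close>
  obtain K :: nat where K: "real m * (2 + e) / e < real K" using reals_Archimedean2 by blast
  then have K': "real m * (2 + e) < real K * e" by (simp only: pos_divide_less_eq[OF e])
  have "real m * e \<le> real m * (2 + e)" by (rule mult_left_mono) simp_all
  then have Km: "real m < real K" using mult_less_cancel_right_pos[OF e, THEN iffD1, OF le_less_trans] K' by blast
  have Ke: "real K + real m \<le> (1 + e) * (real K - real m)"
  proof -
    have "real m * 2 + real m * e < real K * e" using K' by (simp only: distrib_left)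
    moreover have "(1 + e) * (real K - real m) = real K - real m + (real K * e - real m * e)"
      by (simp add: algebra_simps)
    ultimately show ?thesis by linarith
  qed
  let ?L = "\<lambda>y. L2_set y {..<m}"
  define T where "T = {k \<in> (\<Pi>\<^sub>E i\<in>{..<m}. real_of_int ` {- int K..int K}). ?L k \<noteq> 0}"
  have sq: "(?L y)\<^sup>2 = (\<Sum>i<m. (y i)\<^sup>2)" for y
    unfolding L2_set_def by (rule real_sqrt_pow2) (rule sum_nonneg, simp)
  show thesis
  proof (rule that[of "(\<lambda>k i. k i / ?L k) ` T"])
    have "finite (\<Pi>\<^sub>E i\<in>{..<m}. real_of_int ` {- int K..int K})" by (intro finite_PiE) auto
    then have "finite T" by (rule rev_finite_subset) (auto simp only: T_def)
    then show "finite ((\<lambda>k i. k i / ?L k) ` T)" by (rule finite_imageI)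
    show "(\<Sum>i<m. (u i)\<^sup>2) = 1" if u: "u \<in> (\<lambda>k i. k i / ?L k) ` T" for u
    proof -
      obtain k where k: "u = (\<lambda>i. k i / ?L k)" and "k \<in> T" using u by blast
      then have k0: "?L k \<noteq> 0" by (simp add: T_def)
      have "(\<Sum>i<m. (u i)\<^sup>2) = (\<Sum>i<m. (k i)\<^sup>2) / (?L k)\<^sup>2"
        unfolding k power_divide by (rule sum_divide_distrib[symmetric])
      also have "\<dots> = (?L k)\<^sup>2 / (?L k)\<^sup>2" by (simp only: sq)
      also have "\<dots> = 1" using k0 by simp
      finally show ?thesis .
    qed
  next
    fix y :: "nat \<Rightarrow> real" and r :: real
    assume r: "0 < r" and y: "((1 + e) * r)\<^sup>2 < (\<Sum>i<m. (y i)\<^sup>2)"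
    define q where "q = ?L y"
    have q: "(1 + e) * r < q"
    proof (rule power2_less_imp_less)
      show "((1 + e) * r)\<^sup>2 < q\<^sup>2" using y by (simp only: q_def sq)
    qed (simp add: q_def)
    have q0: "0 < q" using q mult_pos_pos[of "1 + e" r] r e by linarith
    have yq: "\<bar>y i\<bar> \<le> q" if "i < m" for i
    proof -
      have "(y i)\<^sup>2 \<le> (\<Sum>i<m. (y i)\<^sup>2)" by (rule member_le_sum) (use that in auto)
      then have "sqrt ((y i)\<^sup>2) \<le> q" unfolding q_def L2_set_def by (rule real_sqrt_le_mono)
      then show ?thesis by simp
    qed
    \<comment> \<open>The value \<open>undefined\<close> outside \<open>{..<m}\<close> puts
      \<open>k\<close> into the extensional product, which is what makes \<open>T\<close>
      finite.\<close>
    define k where "k i = (if i < m then real_of_int \<lfloor>real K * y i / q\<rfloor> else undefined)" for i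
    define d where "d i = k i - real K * y i / q" for i
    have d: "\<bar>d i\<bar> \<le> 1" if "i < m" for i
      using that unfolding d_def k_def by (simp add: abs_le_iff) linarith
    have kT: "k \<in> (\<Pi>\<^sub>E i\<in>{..<m}. real_of_int ` {- int K..int K})"
    proof (rule PiE_I)
      fix i assume i: "i \<in> {..<m}"
      have "\<bar>real K * y i / q\<bar> \<le> real K"
        using yq[of i] i q0 by (simp add: abs_mult divide_le_eq mult_left_mono)
      then have "- real K \<le> real K * y i / q" "real K * y i / q \<le> real K"
        by (simp_all only: abs_le_iff) linarith
      then have "- int K \<le> \<lfloor>real K * y i / q\<rfloor>" "\<lfloor>real K * y i / q\<rfloor> \<le> int K"
        by (auto simp: le_floor_iff floor_le_iff)
      then show "k i \<in> real_of_int ` {- int K..int K}" using i by (simp add: k_def)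
    qed (simp add: k_def)
    have "(\<Sum>i<m. k i * y i) = (\<Sum>i<m. real K / q * (y i)\<^sup>2 + d i * y i)"
      by (intro sum.cong refl) (simp add: d_def power2_eq_square algebra_simps)
    also have "\<dots> = real K / q * q\<^sup>2 + (\<Sum>i<m. d i * y i)"
      by (simp only: sum.distrib sum_distrib_left[symmetric] sq q_def)
    also have "real K / q * q\<^sup>2 = real K * q" using q0 by (simp add: power2_eq_square)
    finally have k1: "(\<Sum>i<m. k i * y i) = real K * q + (\<Sum>i<m. d i * y i)" .
    have dy: "\<bar>\<Sum>i<m. d i * y i\<bar> \<le> (\<Sum>i<m. q)"
    proof (rule order_trans[OF sum_abs], rule sum_mono)
      fix i assume "i \<in> {..<m}"
      then have "\<bar>d i\<bar> * \<bar>y i\<bar> \<le> 1 * q" by (intro mult_mono d yq) auto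
      then show "\<bar>d i * y i\<bar> \<le> q" by (simp add: abs_mult)
    qed
    have k2: "(real K - real m) * q \<le> (\<Sum>i<m. k i * y i)"
    proof -
      have "- (real m * q) \<le> (\<Sum>i<m. d i * y i)"
        using dy by simp
      then show ?thesis unfolding k1 left_diff_distrib by linarith
    qed
    have "?L k = ?L (\<lambda>i. real K / q * y i + d i)" by (simp add: d_def)
    also have "\<dots> \<le> ?L (\<lambda>i. real K / q * y i) + ?L d" by (rule L2_set_triangle_ineq)
    also have "?L (\<lambda>i. real K / q * y i) = real K / q * q"
      using q0 by (subst L2_set_right_distrib[symmetric]) (simp_all add: q_def[symmetric])
    also have "?L d \<le> (\<Sum>i<m. \<bar>d i\<bar>)" by (rule L2_set_le_sum_abs)
    also have "\<dots> \<le> (\<Sum>i<m. 1)" by (intro sum_mono) (simp add: d)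
    finally have k3: "?L k \<le> real K + real m" using q0 by simp
    have pos: "0 < (\<Sum>i<m. k i * y i)" using k2 mult_pos_pos[of "real K - real m" q] Km q0 by linarith
    have Lk0: "?L k \<noteq> 0"
    proof
      assume "?L k = 0"
      then have "\<forall>i<m. k i = 0" by (simp add: L2_set_eq_0_iff)
      then show False using pos by simp
    qed
    have kT': "k \<in> T" unfolding T_def by (rule CollectI, rule conjI, rule kT, rule Lk0)
    have Lk: "0 < ?L k" using L2_set_nonneg[of k "{..<m}"] Lk0 by linarith
    have "r * ?L k \<le> r * ((1 + e) * (real K - real m))"
      using k3 Ke r by (intro mult_left_mono) auto
    also have "\<dots> = ((1 + e) * r) * (real K - real m)" by simp
    also have "\<dots> < q * (real K - real m)" using q Km by (intro mult_strict_right_mono) auto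
    also have "\<dots> \<le> (\<Sum>i<m. k i * y i)" using k2 by (simp add: mult.commute)
    finally have "r < (\<Sum>i<m. k i * y i) / ?L k" using Lk by (simp add: pos_less_divide_eq)
    also have "\<dots> = (\<Sum>i<m. k i / ?L k * y i)" by (simp add: sum_divide_distrib)
    finally have *: "r < (\<Sum>i<m. k i / ?L k * y i)" .
    show "\<exists>u\<in>(\<lambda>k i. k i / ?L k) ` T. r < (\<Sum>i<m. u i * y i)"
      by (rule bexI[where x = "\<lambda>i. k i / ?L k"]) (rule *, rule imageI[OF kT'])
  qed
qed

text \<open>If the vector of the copies at \<open>j\<close> is too long, some direction of the net
  detects it; in each direction the copies have the law of \<open>\<eta>\<close>, and a union bound
  gives the factor \<open>card F\<close>. Directions of both signs occur in the net, so one-sided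
  bounds on \<open>\<eta>\<close> control the squares. \<open>B\<close> must not depend on the block
  or the thresholds, hence the order of the quantifiers.\<close>

lemma copies_tail:
  fixes N :: "'a measure" and m :: nat
  assumes N: "prob_space N" and e: "0 < e"
  shows "\<exists>B\<ge>0. \<forall>C \<eta> n c. centered_gaussian_sequence N C \<eta> \<and> (\<forall>j<n. 0 < c j) \<longrightarrow>
    measure (\<Pi>\<^sub>M i\<in>{..<m}. N) {\<omega> \<in> space (\<Pi>\<^sub>M i\<in>{..<m}. N).
        \<not> (\<forall>j<n. (\<Sum>i<m. (\<eta> j (\<omega> i))\<^sup>2) \<le> ((1 + e) * c j)\<^sup>2)}
      \<le> B * measure N {\<omega> \<in> space N. \<not> (\<forall>j<n. \<eta> j \<omega> \<le> c j)}"
proof -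
  interpret N: prob_space N by fact
  interpret P: product_prob_space "\<lambda>_::nat. N" "{..<m}" ..
  let ?M = "\<Pi>\<^sub>M i\<in>{..<m}. N"
  obtain F :: "(nat \<Rightarrow> real) set" where F: "finite F" "\<And>u. u \<in> F \<Longrightarrow> (\<Sum>i<m. (u i)\<^sup>2) = 1"
    "\<And>y r. 0 < r \<Longrightarrow> ((1 + e) * r)\<^sup>2 < (\<Sum>i<m. (y i)\<^sup>2) \<Longrightarrow> \<exists>u\<in>F. r < (\<Sum>i<m. u i * y i)"
    using sphere_net[OF e] by blast
  have "measure ?M {\<omega> \<in> space ?M. \<not> (\<forall>j<n. (\<Sum>i<m. (\<eta> j (\<omega> i))\<^sup>2) \<le> ((1 + e) * c j)\<^sup>2)}
      \<le> real (card F) * measure N {\<omega> \<in> space N. \<not> (\<forall>j<n. \<eta> j \<omega> \<le> c j)}"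
    if G: "centered_gaussian_sequence N C \<eta>" and c: "\<forall>j<n. 0 < c j" for C \<eta> n c
  proof -
    have \<eta>: "\<eta> j \<in> borel_measurable N" for j
      using centered_gaussian_gaussian[OF G] by (simp add: gaussian_variable_def)
    have "(\<lambda>\<omega>. \<omega> i) \<in> ?M \<rightarrow>\<^sub>M N" if "i < m" for i
      by (rule measurable_component_singleton) (use that in simp)
    from measurable_compose[OF this \<eta>]
    have Y: "(\<lambda>\<omega>. \<Sum>i<m. u i * \<eta> j (\<omega> i)) \<in> borel_measurable ?M" for u :: "nat \<Rightarrow> real" and j
      by (intro borel_measurable_sum borel_measurable_times borel_measurable_const) auto
    define G where "G u = {\<omega> \<in> space ?M. \<not> (\<forall>j<n. (\<Sum>i<m. u i * \<eta> j (\<omega> i)) \<le> c j)}" for u :: "nat \<Rightarrow> real"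
    have Gc: "G u = space ?M - {\<omega> \<in> space ?M. \<forall>j<n. (\<Sum>i<m. u i * \<eta> j (\<omega> i)) \<le> c j}" for u
      by (auto simp: G_def)
    have s1: "{\<omega> \<in> space ?M. \<forall>j<n. (\<Sum>i<m. u i * \<eta> j (\<omega> i)) \<le> c j} \<in> sets ?M" for u
      using Y by measurable
    have s2: "{\<omega> \<in> space N. \<forall>j<n. \<eta> j \<omega> \<le> c j} \<in> sets N"
      using \<eta> by measurable
    have Gs: "G u \<in> sets ?M" for u unfolding Gc by (rule sets.compl_sets[OF s1])
    have Gm: "measure ?M (G u) = measure N {\<omega> \<in> space N. \<not> (\<forall>j<n. \<eta> j \<omega> \<le> c j)}" if "u \<in> F" for u
    proof -
      have "measure ?M (G u) = 1 - measure N {\<omega> \<in> space N. \<forall>j<n. \<eta> j \<omega> \<le> c j}"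
        unfolding Gc using P.prob_compl[OF s1] copies_rotate[OF G F(2)[OF that]] by simp
      also have "\<dots> = measure N (space N - {\<omega> \<in> space N. \<forall>j<n. \<eta> j \<omega> \<le> c j})"
        by (rule N.prob_compl[OF s2, symmetric])
      also have "space N - {\<omega> \<in> space N. \<forall>j<n. \<eta> j \<omega> \<le> c j} = {\<omega> \<in> space N. \<not> (\<forall>j<n. \<eta> j \<omega> \<le> c j)}"
        by auto
      finally show ?thesis .
    qed
    have "measure ?M {\<omega> \<in> space ?M. \<not> (\<forall>j<n. (\<Sum>i<m. (\<eta> j (\<omega> i))\<^sup>2) \<le> ((1 + e) * c j)\<^sup>2)} \<le> measure ?M (\<Union>u\<in>F. G u)"
    proof (rule P.finite_measure_mono)
      show "{\<omega> \<in> space ?M. \<not> (\<forall>j<n. (\<Sum>i<m. (\<eta> j (\<omega> i))\<^sup>2) \<le> ((1 + e) * c j)\<^sup>2)} \<subseteq> (\<Union>u\<in>F. G u)"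
      proof
        fix \<omega> assume "\<omega> \<in> {\<omega> \<in> space ?M. \<not> (\<forall>j<n. (\<Sum>i<m. (\<eta> j (\<omega> i))\<^sup>2) \<le> ((1 + e) * c j)\<^sup>2)}"
        then obtain j where \<omega>: "\<omega> \<in> space ?M" and j: "j < n" "((1 + e) * c j)\<^sup>2 < (\<Sum>i<m. (\<eta> j (\<omega> i))\<^sup>2)"
          by (auto simp only: mem_Collect_eq not_all not_imp not_le)
        from F(3)[OF _ j(2)] c j(1) obtain u where "u \<in> F" "c j < (\<Sum>i<m. u i * \<eta> j (\<omega> i))" by blast
        then show "\<omega> \<in> (\<Union>u\<in>F. G u)" using \<omega> j(1) unfolding G_def by (auto simp: not_le)
      qed
      show "(\<Union>u\<in>F. G u) \<in> sets ?M" using F(1) Gs by (intro sets.finite_UN) auto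
    qed
    also have "\<dots> \<le> (\<Sum>u\<in>F. measure ?M (G u))"
      using F(1) Gs by (intro P.finite_measure_subadditive_finite) auto
    also have "\<dots> = real (card F) * measure N {\<omega> \<in> space N. \<not> (\<forall>j<n. \<eta> j \<omega> \<le> c j)}"
      by (simp add: Gm)
    finally show ?thesis .
  qed
  then show ?thesis by (intro exI[of _ "real (card F)"]) auto
qed

section \<open>Bordered inverse M-matrices\<close>

lemma det_border_lower_zero:
  assumes "\<And>i. i < n \<Longrightarrow> F (Suc i) 0 = 0"
  shows "Determinant.det (fmat (Suc n) F) = F 0 0 * Determinant.det (fmat n (\<lambda>i j. F (Suc i) (Suc j)))"
proof -
  have "fmat (Suc n) F = four_block_mat (Matrix.mat 1 1 (\<lambda>_. F 0 0)) (Matrix.mat 1 n (\<lambda>(_, j). F 0 (Suc j)))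
      (0\<^sub>m n 1) (fmat n (\<lambda>i j. F (Suc i) (Suc j)))"
  proof (rule eq_matI, goal_cases)
    case (1 i j)
    then show ?case using assms by (cases i; cases j) auto
  qed auto
  then show ?thesis by (simp add: det_four_block_mat_lower_left_zero[of _ 1 _ n] det_single)
qed

lemma det_border_upper_zero:
  assumes "\<And>j. j < n \<Longrightarrow> F 0 (Suc j) = 0"
  shows "Determinant.det (fmat (Suc n) F) = F 0 0 * Determinant.det (fmat n (\<lambda>i j. F (Suc i) (Suc j)))"
proof -
  have "fmat (Suc n) F = four_block_mat (Matrix.mat 1 1 (\<lambda>_. F 0 0)) (0\<^sub>m 1 n)
      (Matrix.mat n 1 (\<lambda>(i, _). F (Suc i) 0)) (fmat n (\<lambda>i j. F (Suc i) (Suc j)))"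
  proof (rule eq_matI, goal_cases)
    case (1 i j)
    then show ?case using assms by (cases i; cases j) auto
  qed auto
  then show ?thesis by (simp add: det_four_block_mat_upper_right_zero[of _ 1 _ n] det_single)
qed

lemma fmat_mult: "fmat n F * fmat n G = fmat n (\<lambda>i j. \<Sum>k<n. F i k * G k j)"
  by (rule eq_matI) (auto simp: scalar_prod_def lessThan_atLeast0)

lemma det_fmat_mult:
  "Determinant.det (fmat n (\<lambda>i j. \<Sum>k<n. F i k * G k j)) = Determinant.det (fmat n F) * Determinant.det (fmat n G)"
  unfolding fmat_mult[symmetric] by (rule det_mult) auto

lemma one_plus_mult_diag:
  "1\<^sub>m n + fmat n K * mat_diag n s = fmat n (\<lambda>i j. (if i = j then 1 else 0) + K i j * s j)"
proof -
  have "fmat n K * mat_diag n s = Matrix.mat n n (\<lambda>(i, j). fmat n K $$ (i, j) * s j)"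
    by (rule mat_diag_mult_right) simp
  then show ?thesis by (intro eq_matI) auto
qed

text \<open>\<open>U\<close> and \<open>f\<close> stand for a block of the potential and the
  matching stretch of the excessive function, renumbered from 0. The assumption
  \<open>row_sum\<close> comes from the constant function 1, \<open>row_sum_f\<close> from
  \<open>f\<close>.\<close>

locale inverse_m_matrix =
  fixes n :: nat and U :: "nat \<Rightarrow> nat \<Rightarrow> real" and f :: "nat \<Rightarrow> real"
  assumes posdef: "posdef n U"
    and offdiag: "\<And>i j. i < n \<Longrightarrow> j < n \<Longrightarrow> i \<noteq> j \<Longrightarrow> inv_entry (fmat n U) i j \<le> 0"
    and row_sum: "\<And>i. i < n \<Longrightarrow> 0 \<le> (\<Sum>k<n. inv_entry (fmat n U) i k)"
    and row_sum_f: "\<And>i. i < n \<Longrightarrow> 0 \<le> (\<Sum>k<n. inv_entry (fmat n U) i k * f k)"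
begin

definition "A = inv_entry (fmat n U)"
definition "\<rho> = (\<Sum>j<n. \<Sum>k<n. A j k * f k)"
definition "K i j = U i j + f j"
definition "D s = Determinant.det (1\<^sub>m n + fmat n U * mat_diag n s)"
definition "DK s = Determinant.det (1\<^sub>m n + fmat n K * mat_diag n s)"

lemma det_U: "0 < Determinant.det (fmat n U)"
  by (rule posdef_det_pos[OF posdef])

lemma sym_U: "i < n \<Longrightarrow> j < n \<Longrightarrow> U i j = U j i"
  using posdef by (auto simp: posdef_def)

lemma UA: "i < n \<Longrightarrow> j < n \<Longrightarrow> (\<Sum>k<n. U i k * A k j) = (if i = j then 1 else 0)"
  and AU: "i < n \<Longrightarrow> j < n \<Longrightarrow> (\<Sum>k<n. A i k * U k j) = (if i = j then 1 else 0)"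
  using inv_entry_right[of n U i j] inv_entry_left[of n U i j] det_U by (auto simp: A_def)

lemma sym_A:
  assumes i: "i < n" and j: "j < n"
  shows "A i j = A j i"
proof -
  have "A i j = (\<Sum>l<n. A i l * (\<Sum>k<n. A j k * U k l))"
    using j by (simp add: AU if_distrib[of "\<lambda>x. _ * x"] cong: if_cong)
  also have "\<dots> = (\<Sum>l<n. \<Sum>k<n. (A i l * U l k) * A j k)"
    unfolding sum_distrib_left by (intro sum.cong refl) (simp add: sym_U mult_ac)
  also have "\<dots> = (\<Sum>k<n. (\<Sum>l<n. A i l * U l k) * A j k)"
    unfolding sum_distrib_right by (rule sum.swap)
  also have "\<dots> = A j i"
    using i by (simp add: AU if_distrib[of "\<lambda>x. x * _"] cong: if_cong)
  finally show ?thesis .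
qed

lemma posdef_A: "posdef n A"
proof -
  have "0 < (\<Sum>i<n. \<Sum>j<n. x i * x j * A i j)" if x: "\<exists>i<n. x i \<noteq> 0" for x
  proof -
    define y where "y i = (\<Sum>j<n. A i j * x j)" for i
    have Uy: "(\<Sum>j<n. U i j * y j) = x i" if "i < n" for i
    proof -
      have "(\<Sum>j<n. U i j * y j) = (\<Sum>k<n. (\<Sum>j<n. U i j * A j k) * x k)"
        unfolding y_def sum_distrib_left sum_distrib_right mult.assoc by (rule sum.swap)
      also have "\<dots> = x i" using that by (simp add: UA if_distrib[of "\<lambda>x. x * _"] cong: if_cong)
      finally show ?thesis .
    qed
    have "\<exists>i<n. y i \<noteq> 0"
    proof (rule ccontr)
      assume "\<not> (\<exists>i<n. y i \<noteq> 0)"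
      then have "x i = 0" if "i < n" for i using Uy[OF that] by simp
      then show False using x by blast
    qed
    then have "0 < (\<Sum>i<n. \<Sum>j<n. y i * y j * U i j)" using posdef by (simp only: posdef_def)
    also have "\<dots> = (\<Sum>i<n. y i * (\<Sum>j<n. U i j * y j))"
      by (simp add: sum_distrib_left mult_ac)
    also have "\<dots> = (\<Sum>i<n. y i * x i)" by (simp add: Uy)
    also have "\<dots> = (\<Sum>i<n. \<Sum>j<n. x i * x j * A i j)"
      by (simp add: y_def sum_distrib_left sum_distrib_right mult_ac)
    finally show ?thesis .
  qed
  then show ?thesis using sym_A by (auto simp: posdef_def)
qed

lemma rho_nonneg: "0 \<le> \<rho>"
  unfolding \<rho>_def by (rule sum_nonneg) (use row_sum_f in \<open>simp add: A_def\<close>)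

lemma rho_eq: "\<rho> = (\<Sum>i<n. f i * (\<Sum>k<n. A i k))"
proof -
  have "\<rho> = (\<Sum>k<n. \<Sum>j<n. A j k * f k)" unfolding \<rho>_def by (rule sum.swap)
  also have "\<dots> = (\<Sum>k<n. \<Sum>j<n. f k * A k j)"
    by (intro sum.cong refl) (simp add: sym_A mult.commute)
  finally show ?thesis by (simp add: sum_distrib_left)
qed

text \<open>The border gets index 0, so that elimination reaches it last and
  \<open>1 + \<rho>\<close> takes the place of \<open>a 0\<close> in
  \<open>is_laplace_det_border\<close>.\<close>

definition "diag0 = case_nat (1 + \<rho>) (\<lambda>i. A i i)"

definition "offd i j = (case i of
    0 \<Rightarrow> (case j of 0 \<Rightarrow> 0 | Suc j' \<Rightarrow> (\<Sum>k<n. A j' k * f k))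
  | Suc i' \<Rightarrow> (case j of 0 \<Rightarrow> (\<Sum>k<n. A i' k) | Suc j' \<Rightarrow> if i' = j' then 0 else - A i' j'))"

abbreviation "T s \<equiv> perturbed diag0 (\<lambda>i j _. offd i j) (case_nat 0 s)"

lemma T_simps:
  "T s 0 0 = 1 + \<rho>"
  "T s 0 (Suc j) = - (\<Sum>k<n. A j k * f k)"
  "T s (Suc i) 0 = - (\<Sum>k<n. A i k)"
  "T s (Suc i) (Suc j) = A i j + (if i = j then s i else 0)"
  by (simp_all add: perturbed_def diag0_def offd_def)

text \<open>Multiplying the bordered matrix by the block matrix with rows \<open>(1, f)\<close> and \<open>(0, U)\<close>
  produces the bordered form of \<open>I + K S\<close>.\<close>

lemma det_bordered: "Determinant.det (fmat n U) * Determinant.det (fmat (Suc n) (T s)) = DK s"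
proof -
  define L where "L i j = (case i of 0 \<Rightarrow> (case j of 0 \<Rightarrow> 1 | Suc j' \<Rightarrow> f j')
    | Suc i' \<Rightarrow> (case j of 0 \<Rightarrow> 0 | Suc j' \<Rightarrow> U i' j'))" for i j
  \<comment> \<open>\<open>L T = E R\<close>, where \<open>E\<close> subtracts row 0 from every
    other row. On the rows of \<open>R\<close> this removes the term \<open>f j * s j\<close> and
    turns \<open>I + K S\<close> into \<open>I + U S\<close>.\<close>
  define E :: "nat \<Rightarrow> nat \<Rightarrow> real" where "E i j = (case i of 0 \<Rightarrow> (case j of 0 \<Rightarrow> 1 | Suc j' \<Rightarrow> 0)
    | Suc i' \<Rightarrow> (case j of 0 \<Rightarrow> -1 | Suc j' \<Rightarrow> if i' = j' then 1 else 0))" for i j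
  define R where "R i j = (case i of 0 \<Rightarrow> (case j of 0 \<Rightarrow> 1 | Suc j' \<Rightarrow> f j' * s j')
    | Suc i' \<Rightarrow> (case j of 0 \<Rightarrow> 0 | Suc j' \<Rightarrow> (if i' = j' then 1 else 0) + K i' j' * s j'))" for i j
  have delta: "(\<Sum>k<n. g k * (if k = j then x k else 0)) = g j * x j" 
    "(\<Sum>k<n. (if j = k then 1 else 0) * g k) = g j" if "j < n" for g x :: "nat \<Rightarrow> real" and j
    using that by (simp_all add: if_distrib[of "\<lambda>x. _ * x"] if_distrib[of "\<lambda>x. x * _"] cong: if_cong)
  have "(\<Sum>k<Suc n. L i k * T s k j) = (\<Sum>k<Suc n. E i k * R k j)" if "i < Suc n" "j < Suc n" for i j
  proof (cases i; cases j)
    assume "i = 0" "j = 0"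
    then show ?thesis
      by (simp add: L_def E_def R_def T_simps rho_eq sum.lessThan_Suc_shift sum_negf sum_distrib_left del: sum.lessThan_Suc)
  next
    fix j' assume ij: "i = 0" "j = Suc j'"
    then have j': "j' < n" using that by simp
    have "(\<Sum>k<n. f k * A k j') = (\<Sum>k<n. A j' k * f k)"
      using j' by (intro sum.cong refl) (simp add: sym_A mult.commute)
    then show ?thesis using ij j'
      by (simp add: L_def E_def R_def T_simps sum.lessThan_Suc_shift distrib_left sum.distrib delta del: sum.lessThan_Suc)
  next
    fix i' assume ij: "i = Suc i'" "j = 0"
    then have i': "i' < n" using that by simp
    have "(\<Sum>k<n. U i' k * (\<Sum>l<n. A k l)) = (\<Sum>l<n. \<Sum>k<n. U i' k * A k l)"
      unfolding sum_distrib_left by (rule sum.swap)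
    also have "\<dots> = 1" using i' by (simp add: UA)
    finally show ?thesis using ij i'
      by (simp add: L_def E_def R_def T_simps sum.lessThan_Suc_shift sum_negf del: sum.lessThan_Suc)
  next
    fix i' j' assume ij: "i = Suc i'" "j = Suc j'"
    then have i': "i' < n" "j' < n" using that by auto
    then show ?thesis using ij
      by (simp add: L_def E_def R_def K_def T_simps sum.lessThan_Suc_shift distrib_left distrib_right sum.distrib delta UA del: sum.lessThan_Suc)
  qed
  then have "fmat (Suc n) (\<lambda>i j. \<Sum>k<Suc n. L i k * T s k j) = fmat (Suc n) (\<lambda>i j. \<Sum>k<Suc n. E i k * R k j)"
    by (rule fmat_cong)
  then have "Determinant.det (fmat (Suc n) L) * Determinant.det (fmat (Suc n) (T s)) =
      Determinant.det (fmat (Suc n) E) * Determinant.det (fmat (Suc n) R)"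
    by (simp only: det_fmat_mult[symmetric])
  moreover have "Determinant.det (fmat (Suc n) L) = Determinant.det (fmat n U)"
    by (subst det_border_lower_zero) (simp_all add: L_def)
  moreover have "Determinant.det (fmat (Suc n) R) = DK s"
    unfolding DK_def one_plus_mult_diag by (subst det_border_lower_zero) (simp_all add: R_def)
  moreover have "Determinant.det (fmat (Suc n) E) = 1"
  proof -
    have "fmat n (\<lambda>i j. E (Suc i) (Suc j)) = 1\<^sub>m n" by (rule eq_matI) (auto simp: E_def)
    then show ?thesis by (subst det_border_upper_zero) (simp_all add: E_def)
  qed
  ultimately show ?thesis by simp
qed

lemma det_shifted: "Determinant.det (fmat n U) * Determinant.det (fmat n (\<lambda>i j. T s (Suc i) (Suc j))) = D s"
proof -
  have "(\<Sum>k<n. U i k * (A k j + (if k = j then s k else 0))) = (if i = j then 1 else 0) + U i j * s j"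
    if "i < n" "j < n" for i j
    using that by (simp add: distrib_left sum.distrib UA if_distrib[of "\<lambda>x. _ * x"] cong: if_cong)
  then show ?thesis
    unfolding D_def one_plus_mult_diag det_fmat_mult[symmetric] T_simps
    by (intro arg_cong[where f = Determinant.det] fmat_cong)
qed

lemma D_0: "D (\<lambda>_. 0) = 1" and DK_0: "DK (\<lambda>_. 0) = 1"
proof -
  have "fmat n (\<lambda>i j. (if i = j then 1 else 0) + M i j * 0) = 1\<^sub>m n" for M
    by (rule eq_matI) auto
  then show "D (\<lambda>_. 0) = 1" "DK (\<lambda>_. 0) = 1" by (simp_all add: D_def DK_def one_plus_mult_diag)
qed

text \<open>Without the border the matrix is the positive definite \<open>A\<close>, and the
  determinant of the whole is the reciprocal of \<open>det U\<close>, because \<open>DK\<close> is 1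
  at \<open>s = 0\<close>.\<close>

lemma pivots: "pivots_pos (Suc n) (T (\<lambda>_. 0))"
proof (rule pivots_pos_shift)
  show "pivots_pos n (\<lambda>i j. T (\<lambda>_. 0) (Suc i) (Suc j))"
    using posdef_pivots_pos[OF posdef_A] by (simp add: T_simps)
  show "0 < Determinant.det (fmat (Suc n) (T (\<lambda>_. 0)))"
  proof (rule zero_less_mult_pos[OF _ det_U])
    show "0 < Determinant.det (fmat n U) * Determinant.det (fmat (Suc n) (T (\<lambda>_. 0)))"
      unfolding det_bordered DK_0 by simp
  qed
qed

lemma case_nat_zero: "case_nat 0 (\<lambda>_. 0) = (\<lambda>_. 0 :: real)"
  by (auto simp: fun_eq_iff split: nat.split)

lemma offd_nonneg: "i < Suc n \<Longrightarrow> j < Suc n \<Longrightarrow> 0 \<le> offd i j"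
  using row_sum row_sum_f offdiag by (auto simp: offd_def A_def split: nat.split)

text \<open>Up to the factor \<open>det U\<close>, both \<open>D\<close> and \<open>DK\<close> are
  determinants of \<open>perturbed\<close> matrices whose \<open>q\<close> are non-negative
  constants, so the elimination lemmas apply. The number \<open>1 + \<rho>\<close> is
  \<open>a 0 + s 0\<close> with the variable of the border set to 0.\<close>

lemma
  assumes al: "0 < \<alpha>"
  shows laplace_D: "is_laplace n (\<lambda>s. D s powr (- \<alpha>))"
    and laplace_DK: "is_laplace n (\<lambda>s. DK s powr (- \<alpha>) - (1 + \<rho>) powr (- \<alpha>) * D s powr (- \<alpha>))"
    and D_pos: "\<And>s. \<forall>i. 0 \<le> s i \<Longrightarrow> 0 < D s"
proof -
  let ?q = "\<lambda>i j (_ :: nat \<Rightarrow> real). offd i j"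
  have q: "is_laplace (Suc n) (?q i j)" if "i < Suc n" "j < Suc n" for i j
    by (rule is_laplace_const) (rule offd_nonneg[OF that])
  have pp: "pivots_pos (Suc n) (perturbed diag0 ?q (\<lambda>_. 0))"
    using pivots by (simp only: case_nat_zero)
  have c0: "\<forall>i. 0 \<le> case_nat 0 s i" if "\<forall>i. 0 \<le> s i" for s :: "nat \<Rightarrow> real"
    using that by (auto split: nat.split)
  have posT: "0 < Determinant.det (fmat (Suc n) (T s))" if "\<forall>i. 0 \<le> s i" for s
    using is_laplace_det[OF q _ pp al] c0[OF that] by (intro det_pos) blast
  have border: "is_laplace n (\<lambda>s. Determinant.det (fmat (Suc n) (T s)) powr (- \<alpha>) -
      (1 + \<rho>) powr (- \<alpha>) * Determinant.det (fmat n (\<lambda>i j. T s (Suc i) (Suc j))) powr (- \<alpha>))"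
    using is_laplace_case_nat[OF is_laplace_det_border[OF q _ pp al]] by (simp add: diag0_def)
  have DA: "is_laplace n (\<lambda>s. Determinant.det (fmat n (perturbed (\<lambda>i. A i i) (\<lambda>i j _. if i = j then 0 else - A i j) s)) powr (- \<alpha>)) \<and>
    (\<forall>s. (\<forall>i. 0 \<le> s i) \<longrightarrow> pivots_pos n (perturbed (\<lambda>i. A i i) (\<lambda>i j _. if i = j then 0 else - A i j) s))"
  proof (rule is_laplace_det[OF _ order_refl _ al])
    show "is_laplace n (\<lambda>_. if i = j then 0 else - A i j)" if "i < n" "j < n" for i j
      using offdiag[OF that] by (intro is_laplace_const) (auto simp: A_def)
    have "perturbed (\<lambda>i. A i i) (\<lambda>i j _. if i = j then 0 else - A i j) (\<lambda>_. 0) = A"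
      by (auto simp: perturbed_def fun_eq_iff)
    then show "pivots_pos n (perturbed (\<lambda>i. A i i) (\<lambda>i j _. if i = j then 0 else - A i j) (\<lambda>_. 0))"
      using posdef_pivots_pos[OF posdef_A] by simp
  qed
  have shift: "(\<lambda>i j. T s (Suc i) (Suc j)) = perturbed (\<lambda>i. A i i) (\<lambda>i j _. if i = j then 0 else - A i j) s" for s
    unfolding T_simps by (auto simp: perturbed_def fun_eq_iff)
  have pos_shift: "0 < Determinant.det (fmat n (\<lambda>i j. T s (Suc i) (Suc j)))" if "\<forall>i. 0 \<le> s i" for s
    unfolding shift using DA that by (intro det_pos) blast
  show "0 < D s" if "\<forall>i. 0 \<le> s i" for s
    unfolding det_shifted[symmetric] using det_U pos_shift[OF that] by (rule mult_pos_pos)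
  let ?u = "Determinant.det (fmat n U) powr (- \<alpha>)"
  have "is_laplace n (\<lambda>s. ?u * Determinant.det (fmat n (\<lambda>i j. T s (Suc i) (Suc j))) powr (- \<alpha>))"
    unfolding shift by (intro is_laplace_mult is_laplace_const DA[THEN conjunct1]) simp
  then show "is_laplace n (\<lambda>s. D s powr (- \<alpha>))"
    by (rule is_laplace_cong)
       (use det_U pos_shift in \<open>simp add: det_shifted[symmetric] powr_mult\<close>)
  have "is_laplace n (\<lambda>s. ?u * (Determinant.det (fmat (Suc n) (T s)) powr (- \<alpha>) -
      (1 + \<rho>) powr (- \<alpha>) * Determinant.det (fmat n (\<lambda>i j. T s (Suc i) (Suc j))) powr (- \<alpha>)))"
    by (intro is_laplace_mult[OF is_laplace_const border]) simp
  then show "is_laplace n (\<lambda>s. DK s powr (- \<alpha>) - (1 + \<rho>) powr (- \<alpha>) * D s powr (- \<alpha>))"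
    by (rule is_laplace_cong)
       (use det_U pos_shift posT in \<open>simp add: det_shifted[symmetric] det_bordered[symmetric] powr_mult algebra_simps\<close>)
qed

end

section \<open>Comparison of rectangle probabilities\<close>

lemma laplace_of_integral:
  assumes M: "laplace_of n M L" and s: "\<forall>i. 0 \<le> s i"
  shows "(\<integral>z. exp (- (\<Sum>i<n. s i * \<bar>z i\<bar>)) \<partial>M) = L s"
proof -
  have "(\<lambda>z. exp (- (\<Sum>i<n. s i * \<bar>z i\<bar>))) \<in> borel_measurable M"
    unfolding measurable_cong_sets[OF laplace_ofD(1)[OF M] refl] by measurable
  then have "(\<integral>z. exp (- (\<Sum>i<n. s i * \<bar>z i\<bar>)) \<partial>M) =
      enn2real (\<integral>\<^sup>+z. ennreal (exp (- (\<Sum>i<n. s i * \<bar>z i\<bar>))) \<partial>M)"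
    by (intro integral_eq_nn_integral) auto
  then show ?thesis using laplace_ofD(2,3)[OF M s] by simp
qed

abbreviation rect :: "nat \<Rightarrow> (nat \<Rightarrow> real) \<Rightarrow> (nat \<Rightarrow> real) set" where
  "rect n c \<equiv> {z. \<forall>i<n. \<bar>z i\<bar> \<le> c i}"

lemma sets_rect: "rect n c \<in> sets seqM"
  by (rule rect_sets) auto

lemma mixture_rect:
  assumes \<nu>: "laplace_of n \<nu> L1" and \<kappa>: "laplace_of n \<kappa> L2" and t: "0 \<le> t"
    and M: "finite_measure M" "sets M = sets seqM"
    and eq: "\<And>s. \<forall>i. 0 < s i \<Longrightarrow> (\<integral>z. exp (- (\<Sum>i<n. s i * \<bar>z i\<bar>)) \<partial>M) = t * L1 s + L2 s"
    and c: "\<And>i. i < n \<Longrightarrow> 0 \<le> c i"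
  shows "measure M (rect n c) = t * measure \<nu> (rect n c) + measure \<kappa> (rect n c)"
proof -
  interpret \<nu>: finite_measure \<nu> by (rule laplace_of_finite[OF \<nu>])
  interpret \<kappa>: finite_measure \<kappa> by (rule laplace_of_finite[OF \<kappa>])
  \<comment> \<open>The two summands are padded with null measures to a sequence, the form that
    \<open>sum_measure\<close> takes.\<close>
  define Ms where "Ms k = (if k = 0 then scale_measure (ennreal t) \<nu> else if k = 1 then \<kappa> else null_measure seqM)" for k :: nat
  have Ms: "sets (Ms k) = sets seqM" for k
    using laplace_ofD(1)[OF \<nu>] laplace_ofD(1)[OF \<kappa>] by (simp add: Ms_def)
  define S where "S = sum_measure seqM Ms"
  have two: "(\<Sum>k. g k) = g 0 + g 1" if "\<And>k. 1 < k \<Longrightarrow> g k = 0" for g :: "nat \<Rightarrow> ennreal"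
  proof -
    have "(\<Sum>k. g k) = (\<Sum>k\<in>{0, 1}. g k)"
      by (rule suminf_finite) (use that in \<open>auto simp: not_less[symmetric]\<close>)
    then show ?thesis by simp
  qed
  have S: "laplace_of n S (\<lambda>s. t * L1 s + L2 s)"
    unfolding laplace_of_def
  proof (intro conjI allI impI)
    show "sets S = sets seqM" unfolding S_def by (rule sets_sum_measure[OF Ms])
    fix s :: "nat \<Rightarrow> real" assume s: "\<forall>i. 0 \<le> s i"
    have nn: "0 \<le> L1 s" "0 \<le> L2 s" using laplace_ofD(2)[OF \<nu> s] laplace_ofD(2)[OF \<kappa> s] by auto
    then show "0 \<le> t * L1 s + L2 s" using t by simp
    have km: "(\<lambda>z. ennreal (exp (- (\<Sum>i<n. s i * \<bar>z i\<bar>)))) \<in> borel_measurable \<nu>"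
      unfolding measurable_cong_sets[OF laplace_ofD(1)[OF \<nu>] refl] by measurable
    have "(\<integral>\<^sup>+z. ennreal (exp (- (\<Sum>i<n. s i * \<bar>z i\<bar>))) \<partial>S) =
        (\<Sum>k. \<integral>\<^sup>+z. ennreal (exp (- (\<Sum>i<n. s i * \<bar>z i\<bar>))) \<partial>Ms k)"
      unfolding S_def by (rule nn_integral_sum_measure[OF Ms]) measurable
    also have "\<dots> = ennreal t * ennreal (L1 s) + ennreal (L2 s)"
      by (subst two) (simp_all add: Ms_def nn_integral_scale_measure[OF km] laplace_ofD(3)[OF \<nu> s] laplace_ofD(3)[OF \<kappa> s])
    finally show "(\<integral>\<^sup>+z. ennreal (exp (- (\<Sum>i<n. s i * \<bar>z i\<bar>))) \<partial>S) = ennreal (t * L1 s + L2 s)"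
      using t nn by (simp add: ennreal_mult)
  qed
  have "measure M (rect n c) = measure S (rect n c)"
  proof (rule laplace_rect_unique[OF M(1) laplace_of_finite[OF S] M(2) laplace_ofD(1)[OF S] _ c])
    fix s :: "nat \<Rightarrow> real" assume "\<forall>i. 0 < s i"
    then have "\<forall>i. 0 \<le> s i" by (auto intro: less_imp_le)
    then show "(\<integral>z. exp (- (\<Sum>i<n. s i * \<bar>z i\<bar>)) \<partial>M) = (\<integral>z. exp (- (\<Sum>i<n. s i * \<bar>z i\<bar>)) \<partial>S)"
      using eq[OF \<open>\<forall>i. 0 < s i\<close>] laplace_of_integral[OF S] by simp
  qed
  also have "measure S (rect n c) = enn2real (\<Sum>k. emeasure (Ms k) (rect n c))"
    unfolding measure_def S_def by (simp add: emeasure_sum_measure[OF Ms sets_rect])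
  also have "(\<Sum>k. emeasure (Ms k) (rect n c)) = ennreal t * emeasure \<nu> (rect n c) + emeasure \<kappa> (rect n c)"
    by (subst two) (simp_all add: Ms_def)
  also have "\<dots> = ennreal (t * measure \<nu> (rect n c) + measure \<kappa> (rect n c))"
    using t by (simp add: \<nu>.emeasure_eq_measure \<kappa>.emeasure_eq_measure ennreal_mult)
  finally show ?thesis using t by (simp del: ennreal_plus)
qed

text \<open>On rectangles \<open>M\<close> agrees with the convolution of \<open>\<nu>\<close> and a
  probability measure. Adding absolute values can only move a point out of a rectangle.\<close>

lemma convol_rect_le:
  assumes \<nu>: "laplace_of n \<nu> L1" and L2: "is_laplace n L2" "L2 (\<lambda>_. 0) = 1"
    and M: "finite_measure M" "sets M = sets seqM"
    and eq: "\<And>s. \<forall>i. 0 < s i \<Longrightarrow> (\<integral>z. exp (- (\<Sum>i<n. s i * \<bar>z i\<bar>)) \<partial>M) = L1 s * L2 s"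
    and c: "\<And>i. i < n \<Longrightarrow> 0 \<le> c i"
  shows "measure M (rect n c) \<le> measure \<nu> (rect n c)"
proof -
  obtain \<mu> where \<mu>: "laplace_of n \<mu> L2" using L2(1) by (auto simp: is_laplace_def)
  interpret \<nu>: finite_measure \<nu> by (rule laplace_of_finite[OF \<nu>])
  interpret \<mu>: finite_measure \<mu> by (rule laplace_of_finite[OF \<mu>])
  note C = laplace_of_convol[OF \<nu> \<mu>]
  have m: "(\<lambda>(x, y) i. \<bar>x i\<bar> + \<bar>y i :: real\<bar>) \<in> \<nu> \<Otimes>\<^sub>M \<mu> \<rightarrow>\<^sub>M seqM"
    by (rule measurable_convol[OF laplace_ofD(1)[OF \<nu>] laplace_ofD(1)[OF \<mu>]])
  have sp: "space \<nu> = UNIV" "space \<mu> = UNIV" using laplace_of_space \<nu> \<mu> by blast+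
  have rn: "rect n c \<in> sets \<nu>" using sets_rect laplace_ofD(1)[OF \<nu>] by blast
  have "measure M (rect n c) = measure (convol \<nu> \<mu>) (rect n c)"
  proof (rule laplace_rect_unique[OF M(1) laplace_of_finite[OF C] M(2) laplace_ofD(1)[OF C] _ c])
    fix s :: "nat \<Rightarrow> real" assume "\<forall>i. 0 < s i"
    then have "\<forall>i. 0 \<le> s i" by (auto intro: less_imp_le)
    then show "(\<integral>z. exp (- (\<Sum>i<n. s i * \<bar>z i\<bar>)) \<partial>M) = (\<integral>z. exp (- (\<Sum>i<n. s i * \<bar>z i\<bar>)) \<partial>convol \<nu> \<mu>)"
      using eq[OF \<open>\<forall>i. 0 < s i\<close>] laplace_of_integral[OF C] by simp
  qed
  also have "\<dots> = measure (\<nu> \<Otimes>\<^sub>M \<mu>) ((\<lambda>(x, y) i. \<bar>x i\<bar> + \<bar>y i\<bar>) -` rect n c \<inter> space (\<nu> \<Otimes>\<^sub>M \<mu>))"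
    unfolding convol_def by (rule measure_distr[OF m sets_rect])
  also have "\<dots> \<le> measure (\<nu> \<Otimes>\<^sub>M \<mu>) (rect n c \<times> space \<mu>)"
  proof -
    have fin: "emeasure (\<nu> \<Otimes>\<^sub>M \<mu>) (rect n c \<times> space \<mu>) < \<infinity>"
      by (subst \<mu>.emeasure_pair_measure_Times[OF rn sets.top])
         (simp add: ennreal_mult_less_top \<nu>.emeasure_eq_measure \<mu>.emeasure_eq_measure)
    show ?thesis
    proof (rule measure_mono_fmeasurable)
      show "(\<lambda>(x, y) i. \<bar>x i\<bar> + \<bar>y i\<bar>) -` rect n c \<inter> space (\<nu> \<Otimes>\<^sub>M \<mu>) \<subseteq> rect n c \<times> space \<mu>"
      proof
        fix p assume p: "p \<in> (\<lambda>(x, y) i. \<bar>x i\<bar> + \<bar>y i\<bar>) -` rect n c \<inter> space (\<nu> \<Otimes>\<^sub>M \<mu>)"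
        obtain a b where ab: "p = (a, b)" by (cases p)
        have "\<bar>\<bar>a i\<bar> + \<bar>b i\<bar>\<bar> \<le> c i" if "i < n" for i using p that by (simp add: ab)
        then have "\<bar>a i\<bar> \<le> c i" if "i < n" for i using that by (smt (verit))
        then show "p \<in> rect n c \<times> space \<mu>" by (simp add: ab sp)
      qed
      show "(\<lambda>(x, y) i. \<bar>x i\<bar> + \<bar>y i\<bar>) -` rect n c \<inter> space (\<nu> \<Otimes>\<^sub>M \<mu>) \<in> sets (\<nu> \<Otimes>\<^sub>M \<mu>)"
        by (rule measurable_sets[OF m sets_rect])
      show "rect n c \<times> space \<mu> \<in> fmeasurable (\<nu> \<Otimes>\<^sub>M \<mu>)"
        using fin rn by (intro fmeasurableI) auto
    qed
  qed
  also have "\<dots> = measure \<nu> (rect n c)"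
  proof -
    have "emeasure (\<nu> \<Otimes>\<^sub>M \<mu>) (rect n c \<times> space \<mu>) = emeasure \<nu> (rect n c) * emeasure \<mu> (space \<mu>)"
      by (rule \<mu>.emeasure_pair_measure_Times[OF rn sets.top])
    then show ?thesis using laplace_of_emeasure[OF \<mu>] L2(2) by (simp add: measure_def)
  qed
  finally show ?thesis .
qed

context inverse_m_matrix begin

lemma laplace_D_nonneg:
  assumes "0 \<le> b"
  shows "is_laplace n (\<lambda>s. D s powr (- b))"
proof (cases "b = 0")
  case True
  have "is_laplace n (\<lambda>_. 1)" by (rule is_laplace_const) simp
  then show ?thesis
    by (rule is_laplace_cong) (use D_pos[of 1] True in \<open>simp add: less_imp_neq[symmetric]\<close>)
qed (use assms laplace_D in auto)

text \<open>Monotonicity in the exponent: \<open>D powr (- b)\<close> is \<open>D powr (- a)\<close>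
  times \<open>D powr (- (b - a))\<close>, and the second factor is the transform of a probability
  measure because \<open>D\<close> is 1 at \<open>s = 0\<close>.\<close>

lemma D_rect_antimono:
  assumes ab: "0 < a" "a \<le> b" and \<nu>: "laplace_of n \<nu> (\<lambda>s. D s powr (- a))"
    and M: "finite_measure M" "sets M = sets seqM"
      "\<And>s. \<forall>i. 0 < s i \<Longrightarrow> (\<integral>z. exp (- (\<Sum>i<n. s i * \<bar>z i\<bar>)) \<partial>M) = D s powr (- b)"
    and c: "\<And>i. i < n \<Longrightarrow> 0 \<le> c i"
  shows "measure M (rect n c) \<le> measure \<nu> (rect n c)"
proof (rule convol_rect_le[OF \<nu> laplace_D_nonneg[of "b - a"] _ M(1,2) _ c])
  show "0 \<le> b - a" using ab by simp
  show "D (\<lambda>_. 0) powr (- (b - a)) = 1" by (simp add: D_0)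
  show "(\<integral>z. exp (- (\<Sum>i<n. s i * \<bar>z i\<bar>)) \<partial>M) = D s powr (- a) * D s powr (- (b - a))" if "\<forall>i. 0 < s i" for s
    using M(3)[OF that] by (simp add: powr_add[symmetric])
qed

text \<open>On rectangles the law of \<open>Z\<close> is \<open>t \<nu> + \<kappa>\<close>. All that
  is known of \<open>\<kappa>\<close> is that it is a positive measure of total mass
  \<open>1 - t\<close>, and the two bounds are the two extremes this allows.\<close>

lemma DK_rect:
  assumes Q: "prob_space Q" and Z: "\<And>j. Z j \<in> borel_measurable Q" "\<And>j. AE \<omega> in Q. 0 \<le> Z j \<omega>"
    and al: "0 < \<alpha>"
    and E: "\<And>s. \<forall>i. 0 < s i \<Longrightarrow> (\<integral>\<omega>. exp (- (\<Sum>i<n. s i * Z i \<omega>)) \<partial>Q) = DK s powr (- \<alpha>)"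
    and \<nu>: "laplace_of n \<nu> (\<lambda>s. D s powr (- \<alpha>))" and c: "\<And>i. i < n \<Longrightarrow> 0 \<le> c i"
  defines "t \<equiv> (1 + \<rho>) powr (- \<alpha>)" and "p \<equiv> measure Q {\<omega> \<in> space Q. \<forall>i<n. Z i \<omega> \<le> c i}"
  shows "t * measure \<nu> (rect n c) \<le> p" "p \<le> t * measure \<nu> (rect n c) + (1 - t)"
proof -
  interpret Q: prob_space Q by fact
  obtain \<kappa> where \<kappa>: "laplace_of n \<kappa> (\<lambda>s. DK s powr (- \<alpha>) - t * D s powr (- \<alpha>))"
    using laplace_DK[OF al] by (auto simp: is_laplace_def t_def)
  interpret \<kappa>: finite_measure \<kappa> by (rule laplace_of_finite[OF \<kappa>])
  have m: "(\<lambda>\<omega> j. Z j \<omega>) \<in> Q \<rightarrow>\<^sub>M seqM" by (rule measurable_PiM_single') (auto simp: space_PiM Z)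
  let ?M = "distr Q seqM (\<lambda>\<omega> j. Z j \<omega>)"
  have nonneg: "AE \<omega> in Q. \<forall>j. 0 \<le> Z j \<omega>" using Z(2) by (simp add: AE_all_countable)
  have "measure ?M (rect n c) = t * measure \<nu> (rect n c) + measure \<kappa> (rect n c)"
  proof (rule mixture_rect[OF \<nu> \<kappa> _ Q.finite_measure_distr[OF m] _ _ c])
    show "0 \<le> t" by (simp add: t_def)
    fix s :: "nat \<Rightarrow> real" assume s: "\<forall>i. 0 < s i"
    have "(\<integral>z. exp (- (\<Sum>i<n. s i * \<bar>z i\<bar>)) \<partial>?M) = (\<integral>\<omega>. exp (- (\<Sum>i<n. s i * \<bar>Z i \<omega>\<bar>)) \<partial>Q)"
      by (rule integral_distr[OF m]) measurable
    also have "\<dots> = (\<integral>\<omega>. exp (- (\<Sum>i<n. s i * Z i \<omega>)) \<partial>Q)"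
      by (rule integral_cong_AE) (use nonneg Z(1) in \<open>auto elim!: eventually_mono\<close>)
    also have "\<dots> = DK s powr (- \<alpha>)" by (rule E[OF s])
    finally show "(\<integral>z. exp (- (\<Sum>i<n. s i * \<bar>z i\<bar>)) \<partial>?M) = t * D s powr (- \<alpha>) + (DK s powr (- \<alpha>) - t * D s powr (- \<alpha>))"
      by simp
  qed simp
  moreover have "measure ?M (rect n c) = p"
  proof -
    have "measure ?M (rect n c) = measure Q {\<omega> \<in> space Q. \<forall>i<n. \<bar>Z i \<omega>\<bar> \<le> c i}"
      by (rule measure_distr_rect(1)[OF Z(1)]) auto
    also have "\<dots> = p"
      unfolding p_def
    proof (rule Q.finite_measure_eq_AE)
      show "AE \<omega> in Q. (\<omega> \<in> {\<omega> \<in> space Q. \<forall>i<n. \<bar>Z i \<omega>\<bar> \<le> c i}) = (\<omega> \<in> {\<omega> \<in> space Q. \<forall>i<n. Z i \<omega> \<le> c i})"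
        using nonneg by eventually_elim simp
    qed (use Z(1) in measurable)
    finally show ?thesis .
  qed
  moreover have "0 \<le> measure \<kappa> (rect n c)" by simp
  moreover have "measure \<kappa> (rect n c) \<le> 1 - t"
  proof -
    have "emeasure \<kappa> (space \<kappa>) = ennreal (1 - t)"
      using laplace_of_emeasure[OF \<kappa>] by (simp add: D_0 DK_0)
    moreover have "t \<le> 1" using rho_nonneg al by (simp add: t_def powr_minus_divide ge_one_powr_ge_zero)
    ultimately have "measure \<kappa> (space \<kappa>) = 1 - t" by (simp add: measure_def)
    then show ?thesis using \<kappa>.bounded_measure[of "rect n c"] by simp
  qed
  ultimately show "t * measure \<nu> (rect n c) \<le> p" "p \<le> t * measure \<nu> (rect n c) + (1 - t)" by auto
qed

lemma copies_law:
  fixes m :: nat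
  assumes G: "centered_gaussian_sequence N U' \<eta>" and UU: "\<And>i j. i < n \<Longrightarrow> j < n \<Longrightarrow> U' i j = U i j"
    and s: "\<forall>i. 0 < s i"
  shows "(\<integral>\<omega>. exp (- (\<Sum>j<n. s j * (\<Sum>i<m. (\<eta> j (\<omega> i))\<^sup>2 / 2))) \<partial>(\<Pi>\<^sub>M i\<in>{..<m}. N)) = D s powr (- real m / 2)"
proof -
  have f: "fmat n U' = fmat n U" by (rule fmat_cong) (rule UU)
  have p: "posdef n U'"
  proof -
    have "(\<Sum>i<n. \<Sum>j<n. x i * x j * U' i j) = (\<Sum>i<n. \<Sum>j<n. x i * x j * U i j)" for x
      by (intro sum.cong refl) (simp add: UU)
    then show ?thesis using posdef by (simp add: posdef_def UU)
  qed
  show ?thesis using copies_laplace[OF G p, of s m] s by (simp add: D_def f)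
qed

lemma gaussian_law:
  assumes G: "centered_gaussian_sequence N U \<eta>" and s: "\<forall>i. 0 < s i"
  shows "(\<integral>\<omega>. exp (- (\<Sum>j<n. s j * ((\<eta> j \<omega>)\<^sup>2 / 2))) \<partial>N) = D s powr (- (1 / 2))"
  using centered_gaussian_laplace[OF G posdef, of s] s by (simp add: D_def)

text \<open>The comparison runs from \<open>Z\<close> to the law \<open>\<nu>\<close> for the kernel
  \<open>U\<close> and exponent \<open>\<alpha>\<close>, at the cost of the defect, and from there
  down to the exponent \<open>1 / 2\<close>, where the law is that of
  \<open>\<eta>\<^sup>2 / 2\<close>.\<close>

lemma gaussian_lower:
  assumes Q: "prob_space Q" and Z: "\<And>j. Z j \<in> borel_measurable Q" "\<And>j. AE \<omega> in Q. 0 \<le> Z j \<omega>"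
    and al: "1 / 2 \<le> \<alpha>"
    and E: "\<And>s. \<forall>i. 0 < s i \<Longrightarrow> (\<integral>\<omega>. exp (- (\<Sum>i<n. s i * Z i \<omega>)) \<partial>Q) = DK s powr (- \<alpha>)"
    and c: "\<And>i. i < n \<Longrightarrow> 0 \<le> c i" and G: "centered_gaussian_sequence N U \<eta>"
  shows "measure Q {\<omega> \<in> space Q. \<forall>i<n. Z i \<omega> \<le> c i} \<le>
    measure N {\<omega> \<in> space N. \<forall>i<n. (\<eta> i \<omega>)\<^sup>2 / 2 \<le> c i} + (1 - (1 + \<rho>) powr (- \<alpha>))"
proof -
  have al0: "0 < \<alpha>" using al by linarith
  have \<eta>: "\<eta> j \<in> borel_measurable N" for j
    using centered_gaussian_gaussian[OF G] by (simp add: gaussian_variable_def)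
  interpret N: prob_space N using G by (simp add: centered_gaussian_sequence_def)
  obtain \<nu> where \<nu>: "laplace_of n \<nu> (\<lambda>s. D s powr (- \<alpha>))"
    using laplace_D[OF al0] by (auto simp: is_laplace_def)
  obtain \<mu> where \<mu>: "laplace_of n \<mu> (\<lambda>s. D s powr (- (1 / 2)))"
    using laplace_D[of "1 / 2"] by (auto simp: is_laplace_def)
  interpret \<nu>: finite_measure \<nu> by (rule laplace_of_finite[OF \<nu>])
  let ?Y = "\<lambda>j \<omega>. (\<eta> j \<omega>)\<^sup>2 / 2"
  have Ym: "?Y j \<in> borel_measurable N" for j using \<eta> by measurable
  let ?M = "distr N seqM (\<lambda>\<omega> j. ?Y j \<omega>)"
  have m: "(\<lambda>\<omega> j. ?Y j \<omega>) \<in> N \<rightarrow>\<^sub>M seqM" by (rule measurable_PiM_single') (auto simp: space_PiM Ym)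
  have "measure \<nu> (rect n c) \<le> measure \<mu> (rect n c)"
  proof (rule D_rect_antimono[OF _ al \<mu> laplace_of_finite[OF \<nu>] laplace_ofD(1)[OF \<nu>] _ c])
    show "(\<integral>z. exp (- (\<Sum>i<n. s i * \<bar>z i\<bar>)) \<partial>\<nu>) = D s powr (- \<alpha>)" if "\<forall>i. 0 < s i" for s
      by (rule laplace_of_integral[OF \<nu>]) (use that in \<open>auto intro: less_imp_le\<close>)
  qed simp_all
  also have "measure \<mu> (rect n c) = measure ?M (rect n c)"
  proof (rule laplace_rect_unique[OF laplace_of_finite[OF \<mu>] N.finite_measure_distr[OF m] laplace_ofD(1)[OF \<mu>] _ _ c])
    fix s :: "nat \<Rightarrow> real" assume s: "\<forall>i. 0 < s i"
    then have s0: "\<forall>i. 0 \<le> s i" by (auto intro: less_imp_le)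
    have "(\<integral>z. exp (- (\<Sum>i<n. s i * \<bar>z i\<bar>)) \<partial>?M) = (\<integral>\<omega>. exp (- (\<Sum>i<n. s i * \<bar>?Y i \<omega>\<bar>)) \<partial>N)"
      by (rule integral_distr[OF m]) measurable
    also have "\<dots> = D s powr (- (1 / 2))" using gaussian_law[OF G s] by simp
    finally show "(\<integral>z. exp (- (\<Sum>i<n. s i * \<bar>z i\<bar>)) \<partial>\<mu>) = (\<integral>z. exp (- (\<Sum>i<n. s i * \<bar>z i\<bar>)) \<partial>?M)"
      by (simp only: laplace_of_integral[OF \<mu> s0])
  qed simp
  also have "measure ?M (rect n c) = measure N {\<omega> \<in> space N. \<forall>i<n. \<bar>?Y i \<omega>\<bar> \<le> c i}"
    by (rule measure_distr_rect(1)[OF Ym]) auto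
  finally have 1: "measure \<nu> (rect n c) \<le> measure N {\<omega> \<in> space N. \<forall>i<n. ?Y i \<omega> \<le> c i}" by simp
  have t: "(1 + \<rho>) powr (- \<alpha>) \<le> 1"
    using rho_nonneg al0 by (simp add: powr_minus_divide ge_one_powr_ge_zero)
  have "(1 + \<rho>) powr (- \<alpha>) * measure \<nu> (rect n c) \<le> 1 * measure \<nu> (rect n c)"
    using t by (intro mult_right_mono) auto
  moreover have "measure Q {\<omega> \<in> space Q. \<forall>i<n. Z i \<omega> \<le> c i} \<le>
      (1 + \<rho>) powr (- \<alpha>) * measure \<nu> (rect n c) + (1 - (1 + \<rho>) powr (- \<alpha>))"
    by (rule DK_rect(2)[OF Q Z al0 E \<nu> c])
  ultimately show ?thesis using 1 by linarith
qed

text \<open>Here the exponent is raised to \<open>m / 2\<close>, which lowers rectangle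
  probabilities and hence raises the probability of leaving a rectangle.\<close>

lemma gaussian_upper:
  fixes m :: nat
  assumes Q: "prob_space Q" and Z: "\<And>j. Z j \<in> borel_measurable Q" "\<And>j. AE \<omega> in Q. 0 \<le> Z j \<omega>"
    and al: "0 < \<alpha>" "\<alpha> \<le> real m / 2"
    and E: "\<And>s. \<forall>i. 0 < s i \<Longrightarrow> (\<integral>\<omega>. exp (- (\<Sum>i<n. s i * Z i \<omega>)) \<partial>Q) = DK s powr (- \<alpha>)"
    and c: "\<And>i. i < n \<Longrightarrow> 0 \<le> c i" and G: "centered_gaussian_sequence N U \<eta>"
  shows "measure Q {\<omega> \<in> space Q. \<not> (\<forall>i<n. Z i \<omega> \<le> c i)} \<le>
    measure (\<Pi>\<^sub>M i\<in>{..<m}. N) {\<omega> \<in> space (\<Pi>\<^sub>M i\<in>{..<m}. N). \<not> (\<forall>j<n. (\<Sum>i<m. (\<eta> j (\<omega> i))\<^sup>2 / 2) \<le> c j)} +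
    (1 - (1 + \<rho>) powr (- \<alpha>))"
proof -
  have \<eta>: "\<eta> j \<in> borel_measurable N" for j
    using centered_gaussian_gaussian[OF G] by (simp add: gaussian_variable_def)
  interpret N: prob_space N using G by (simp add: centered_gaussian_sequence_def)
  interpret Q: prob_space Q by fact
  interpret P: product_prob_space "\<lambda>_::nat. N" "{..<m}" ..
  let ?W = "\<Pi>\<^sub>M i\<in>{..<m}. N"
  let ?Y = "\<lambda>j \<omega>. \<Sum>i<m. (\<eta> j (\<omega> i))\<^sup>2 / 2"
  have "(\<lambda>\<omega>. \<omega> i) \<in> ?W \<rightarrow>\<^sub>M N" if "i < m" for i
    by (rule measurable_component_singleton) (use that in simp)
  from measurable_compose[OF this \<eta>] have Ym: "?Y j \<in> borel_measurable ?W" for j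
    by (intro borel_measurable_sum borel_measurable_divide borel_measurable_power borel_measurable_const) auto
  obtain \<nu> where \<nu>: "laplace_of n \<nu> (\<lambda>s. D s powr (- \<alpha>))"
    using laplace_D[OF al(1)] by (auto simp: is_laplace_def)
  interpret \<nu>: finite_measure \<nu> by (rule laplace_of_finite[OF \<nu>])
  let ?M = "distr ?W seqM (\<lambda>\<omega> j. ?Y j \<omega>)"
  have m: "(\<lambda>\<omega> j. ?Y j \<omega>) \<in> ?W \<rightarrow>\<^sub>M seqM" by (rule measurable_PiM_single') (auto simp: space_PiM Ym)
  have Y0: "\<bar>?Y j \<omega>\<bar> = ?Y j \<omega>" for j \<omega> by (simp add: sum_nonneg)
  have "measure ?M (rect n c) \<le> measure \<nu> (rect n c)"
  proof (rule D_rect_antimono[OF al \<nu> P.finite_measure_distr[OF m] _ _ c])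
    fix s :: "nat \<Rightarrow> real" assume s: "\<forall>i. 0 < s i"
    have "(\<integral>z. exp (- (\<Sum>i<n. s i * \<bar>z i\<bar>)) \<partial>?M) = (\<integral>\<omega>. exp (- (\<Sum>i<n. s i * \<bar>?Y i \<omega>\<bar>)) \<partial>?W)"
      by (rule integral_distr[OF m]) measurable
    also have "\<dots> = D s powr (- (real m / 2))" using copies_law[OF G refl s, of m] by (simp only: Y0) simp
    finally show "(\<integral>z. exp (- (\<Sum>i<n. s i * \<bar>z i\<bar>)) \<partial>?M) = D s powr (- (real m / 2))" .
  qed simp
  moreover have "measure ?M (rect n c) = measure ?W {\<omega> \<in> space ?W. \<forall>i<n. \<bar>?Y i \<omega>\<bar> \<le> c i}"
    by (rule measure_distr_rect(1)[OF Ym]) auto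
  ultimately have 1: "measure ?W {\<omega> \<in> space ?W. \<forall>i<n. ?Y i \<omega> \<le> c i} \<le> measure \<nu> (rect n c)"
    by (simp only: Y0)
  let ?t = "(1 + \<rho>) powr (- \<alpha>)"
  have t: "?t \<le> 1" using rho_nonneg al(1) by (simp add: powr_minus_divide ge_one_powr_ge_zero)
  let ?v = "measure ?W {\<omega> \<in> space ?W. \<forall>i<n. ?Y i \<omega> \<le> c i}"
  have "?v \<le> 1" by (rule P.prob_le_1)
  \<comment> \<open>The product \<open>t v\<close> is bounded below by \<open>t + v - 1\<close>, so
    that the two defects \<open>1 - t\<close> and \<open>1 - v\<close> add up.\<close>
  then have "0 \<le> (1 - ?t) * (1 - ?v)" using t by (intro mult_nonneg_nonneg) auto
  then have "?t + ?v - 1 \<le> ?t * ?v" by (simp add: algebra_simps)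
  also have "\<dots> \<le> ?t * measure \<nu> (rect n c)" using 1 by (intro mult_left_mono) auto
  also have "\<dots> \<le> measure Q {\<omega> \<in> space Q. \<forall>i<n. Z i \<omega> \<le> c i}" by (rule DK_rect(1)[OF Q Z al(1) E \<nu> c])
  finally have 2: "1 - measure Q {\<omega> \<in> space Q. \<forall>i<n. Z i \<omega> \<le> c i} \<le> (1 - ?v) + (1 - ?t)" by simp
  have sQ: "{\<omega> \<in> space Q. \<forall>i<n. Z i \<omega> \<le> c i} \<in> sets Q" using Z(1) by measurable
  have sW: "{\<omega> \<in> space ?W. \<forall>i<n. ?Y i \<omega> \<le> c i} \<in> sets ?W" using Ym by measurable
  have "{\<omega> \<in> space Q. \<not> (\<forall>i<n. Z i \<omega> \<le> c i)} = space Q - {\<omega> \<in> space Q. \<forall>i<n. Z i \<omega> \<le> c i}"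
    "{\<omega> \<in> space ?W. \<not> (\<forall>i<n. ?Y i \<omega> \<le> c i)} = space ?W - {\<omega> \<in> space ?W. \<forall>i<n. ?Y i \<omega> \<le> c i}"
    by auto
  then show ?thesis using 2 Q.prob_compl[OF sQ] P.prob_compl[OF sW] by simp
qed

end

section \<open>Limit superior\<close>

text \<open>A single starting point \<open>l\<close> for each \<open>e\<close> is enough: the event
  that the bound fails infinitely often lies in the increasing union over \<open>n\<close> of the
  failures on the block from \<open>l\<close> of length \<open>n\<close>.\<close>

lemma AE_eventually_from_tails:
  fixes X :: "nat \<Rightarrow> 'c \<Rightarrow> real"
  assumes Q: "prob_space Q" and X: "\<And>j. X j \<in> borel_measurable Q"
    and tails: "\<And>e. 0 < e \<Longrightarrow> \<exists>l. \<forall>n\<ge>1. measure Q {\<omega> \<in> space Q. \<not> (\<forall>j<n. X (l + j) \<omega> \<le> c (l + j))} \<le> e"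
  shows "AE \<omega> in Q. \<exists>l. \<forall>j\<ge>l. X j \<omega> \<le> c j"
proof -
  interpret prob_space Q by fact
  define A where "A l n = {\<omega> \<in> space Q. \<not> (\<forall>j<n. X (l + j) \<omega> \<le> c (l + j))}" for l n
  have A: "A l n \<in> sets Q" for l n unfolding A_def using X by measurable
  let ?B = "{\<omega> \<in> space Q. \<not> (\<exists>l. \<forall>j\<ge>l. X j \<omega> \<le> c j)}"
  have B: "?B \<in> sets Q" using X by measurable
  have "measure Q ?B \<le> 0"
  proof (rule field_le_epsilon)
    fix e :: real assume "0 < e"
    from tails[OF this] obtain l where l: "\<And>n. 1 \<le> n \<Longrightarrow> measure Q (A l n) \<le> e"
      unfolding A_def by blast
    have lim: "(\<lambda>n. measure Q (A l n)) \<longlonglongrightarrow> measure Q (\<Union>n. A l n)"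
    proof (rule finite_Lim_measure_incseq)
      show "range (A l) \<subseteq> sets Q" using A by blast
      show "incseq (A l)" unfolding incseq_def A_def by (blast intro: order_less_le_trans)
    qed
    have "measure Q (\<Union>n. A l n) \<le> e"
      by (rule tendsto_upperbound[OF lim]) (auto intro!: eventually_sequentiallyI[of 1] l)
    moreover have "measure Q ?B \<le> measure Q (\<Union>n. A l n)"
    proof (rule finite_measure_mono)
      show "?B \<subseteq> (\<Union>n. A l n)"
      proof
        fix \<omega> assume w: "\<omega> \<in> ?B"
        then obtain j where j: "l \<le> j" "\<not> X j \<omega> \<le> c j" by blast
        then have "\<omega> \<in> A l (Suc (j - l))" using w by (auto simp: A_def intro!: exI[of _ "j - l"])
        then show "\<omega> \<in> (\<Union>n. A l n)" by blast
      qed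
    qed (use A in auto)
    ultimately show "measure Q ?B \<le> 0 + e" by simp
  qed
  then have "emeasure Q ?B = 0" by (simp add: emeasure_eq_measure measure_le_0_iff)
  then show ?thesis by (intro AE_I[OF _ _ B]) auto
qed

text \<open>If the bound holds from \<open>l\<close> on, it holds on every block that starts later,
  and blocks with a late start have arbitrarily small probability.\<close>

lemma AE_frequently_from_blocks:
  fixes X :: "nat \<Rightarrow> 'c \<Rightarrow> real"
  assumes Q: "prob_space Q" and X: "\<And>j. X j \<in> borel_measurable Q"
    and blocks: "\<And>e. 0 < e \<Longrightarrow> \<exists>l0. \<forall>l\<ge>l0. \<exists>n. measure Q {\<omega> \<in> space Q. \<forall>j<n. X (l + j) \<omega> \<le> c (l + j)} \<le> e"
  shows "AE \<omega> in Q. \<forall>l. \<exists>j\<ge>l. c j < X j \<omega>"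
proof -
  interpret prob_space Q by fact
  have meas: "{\<omega> \<in> space Q. \<forall>j<n. X (l + j) \<omega> \<le> c (l + j)} \<in> sets Q" for l n using X by measurable
  define E where "E l = {\<omega> \<in> space Q. \<forall>j\<ge>l. X j \<omega> \<le> c j}" for l
  have E: "E l \<in> sets Q" for l unfolding E_def using X by measurable
  have "measure Q (E l) \<le> 0" for l
  proof (rule field_le_epsilon)
    fix e :: real assume "0 < e"
    from blocks[OF this] obtain l0 where
      l0: "\<And>l. l0 \<le> l \<Longrightarrow> \<exists>n. measure Q {\<omega> \<in> space Q. \<forall>j<n. X (l + j) \<omega> \<le> c (l + j)} \<le> e" by blast
    define k where "k = max l l0"
    obtain n where n: "measure Q {\<omega> \<in> space Q. \<forall>j<n. X (k + j) \<omega> \<le> c (k + j)} \<le> e"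
      using l0[of k] by (auto simp: k_def)
    have "measure Q (E l) \<le> measure Q {\<omega> \<in> space Q. \<forall>j<n. X (k + j) \<omega> \<le> c (k + j)}"
      by (rule finite_measure_mono[OF _ meas]) (auto simp: E_def k_def)
    then show "measure Q (E l) \<le> 0 + e" using n by simp
  qed
  then have "emeasure Q (E l) = 0" for l by (simp add: emeasure_eq_measure measure_le_0_iff)
  then have "AE \<omega> in Q. \<omega> \<notin> E l" for l using E by (intro AE_not_in) (auto intro: null_setsI)
  then have "AE \<omega> in Q. \<forall>l. \<omega> \<notin> E l" by (simp add: AE_all_countable)
  moreover have "AE \<omega> in Q. \<omega> \<in> space Q" by (rule AE_space)
  ultimately show ?thesis
  proof eventually_elim
    case (elim \<omega>)
    then show ?case unfolding E_def by (auto simp: not_le)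
  qed
qed

text \<open>This and the next lemma are for \<open>\<eta>\<close>: they turn an almost sure
  statement into statements on finite blocks, the kind that the comparison carries over to
  \<open>Z\<close>.\<close>

lemma tails_from_AE_eventually:
  fixes X :: "nat \<Rightarrow> 'c \<Rightarrow> real"
  assumes Q: "prob_space Q" and X: "\<And>j. X j \<in> borel_measurable Q"
    and AE: "AE \<omega> in Q. \<exists>l. \<forall>j\<ge>l. X j \<omega> \<le> c j" and e: "0 < e"
  shows "\<exists>l0. \<forall>l\<ge>l0. \<forall>n. measure Q {\<omega> \<in> space Q. \<not> (\<forall>j<n. X (l + j) \<omega> \<le> c (l + j))} \<le> e"
proof -
  interpret prob_space Q by fact
  define A where "A l = {\<omega> \<in> space Q. \<not> (\<forall>j\<ge>l. X j \<omega> \<le> c j)}" for l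
  have A: "A l \<in> sets Q" for l unfolding A_def using X by measurable
  have "(\<lambda>l. measure Q (A l)) \<longlonglongrightarrow> measure Q (\<Inter>l. A l)"
  proof (rule finite_Lim_measure_decseq)
    show "range A \<subseteq> sets Q" using A by blast
    show "decseq A" unfolding decseq_def A_def by (blast intro: order_trans)
  qed
  moreover have "measure Q (\<Inter>l. A l) = 0"
  proof -
    have ae: "AE \<omega> in Q. \<omega> \<notin> (\<Inter>l. A l)" using AE by eventually_elim (auto simp: A_def)
    have "(\<Inter>l. A l) \<in> sets Q" using A by (intro sets.countable_INT) auto
    from prob_eq_0[OF this] ae show ?thesis by (rule iffD2)
  qed
  ultimately have "\<forall>\<^sub>F l in sequentially. measure Q (A l) < e" using e order_tendstoD(2) by fastforce
  then obtain l0 where l0: "\<And>l. l0 \<le> l \<Longrightarrow> measure Q (A l) < e" by (auto simp: eventually_sequentially)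
  have "measure Q {\<omega> \<in> space Q. \<not> (\<forall>j<n. X (l + j) \<omega> \<le> c (l + j))} \<le> e" if "l0 \<le> l" for l n
  proof -
    have "measure Q {\<omega> \<in> space Q. \<not> (\<forall>j<n. X (l + j) \<omega> \<le> c (l + j))} \<le> measure Q (A l)"
    proof (rule finite_measure_mono[OF _ A])
      show "{\<omega> \<in> space Q. \<not> (\<forall>j<n. X (l + j) \<omega> \<le> c (l + j))} \<subseteq> A l"
        unfolding A_def using le_add1 by blast
    qed
    then show ?thesis using l0[OF that] by simp
  qed
  then show ?thesis by blast
qed

lemma blocks_from_AE_frequently:
  fixes X :: "nat \<Rightarrow> 'c \<Rightarrow> real"
  assumes Q: "prob_space Q" and X: "\<And>j. X j \<in> borel_measurable Q"
    and AE: "AE \<omega> in Q. \<forall>l. \<exists>j\<ge>l. c j < X j \<omega>" and e: "0 < e"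
  shows "\<exists>n\<ge>1. measure Q {\<omega> \<in> space Q. \<forall>j<n. X (l + j) \<omega> \<le> c (l + j)} \<le> e"
proof -
  interpret prob_space Q by fact
  define A where "A n = {\<omega> \<in> space Q. \<forall>j<n. X (l + j) \<omega> \<le> c (l + j)}" for n
  have A: "A n \<in> sets Q" for n unfolding A_def using X by measurable
  have "(\<lambda>n. measure Q (A n)) \<longlonglongrightarrow> measure Q (\<Inter>n. A n)"
  proof (rule finite_Lim_measure_decseq)
    show "range A \<subseteq> sets Q" using A by blast
    show "decseq A" unfolding decseq_def A_def by (blast intro: order_less_le_trans)
  qed
  moreover have "measure Q (\<Inter>n. A n) = 0"
  proof -
    have ae: "AE \<omega> in Q. \<omega> \<notin> (\<Inter>n. A n)"
      using AE
    proof eventually_elim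
      case (elim \<omega>)
      then obtain j where "l \<le> j" "c j < X j \<omega>" by blast
      then have "\<omega> \<notin> A (Suc (j - l))" by (auto simp: A_def intro!: exI[of _ "j - l"])
      then show ?case by blast
    qed
    have "(\<Inter>n. A n) \<in> sets Q" using A by (intro sets.countable_INT) auto
    from prob_eq_0[OF this] ae show ?thesis by (rule iffD2)
  qed
  ultimately have "\<forall>\<^sub>F n in sequentially. measure Q (A n) < e" using e order_tendstoD(2) by fastforce
  then obtain n0 where "\<And>n. n0 \<le> n \<Longrightarrow> measure Q (A n) < e" by (auto simp: eventually_sequentially)
  then have "measure Q (A (max 1 n0)) < e" by simp
  then show ?thesis unfolding A_def by (intro exI[of _ "max 1 n0"]) simp
qed

section \<open>The limit superior of the permanental sequence\<close>

lemma permanental_laplace: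
  assumes Z: "permanental_sequence Q \<alpha> K Z" and s: "\<forall>i. 0 < s i"
  shows "(\<integral>\<omega>. exp (- (\<Sum>m<n. s m * Z (l + m) \<omega>)) \<partial>Q) =
    Determinant.det (1\<^sub>m n + fmat n (\<lambda>p q. K (l + p) (l + q)) * mat_diag n s) powr (- \<alpha>)"
proof -
  have "inj_on (\<lambda>m. l + m) {..<n} \<and> (\<forall>m<n. 0 < s m)" using s by (auto simp: inj_on_def)
  then show ?thesis using Z unfolding permanental_sequence_def by blast
qed

lemma little_o_one_uniformlyD:
  assumes a: "little_o_one_uniformly a" and e: "0 < e"
  shows "\<exists>l0. \<forall>l\<ge>l0. \<forall>n\<ge>1. \<bar>a l n\<bar> < e"
proof -
  have "\<forall>\<^sub>F l in sequentially. (SUP n\<in>{1..}. ereal \<bar>a l n\<bar>) < ereal e"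
    using a e unfolding little_o_one_uniformly_def by (intro order_tendstoD(2)) auto
  then obtain l0 where l0: "\<And>l. l0 \<le> l \<Longrightarrow> (SUP n\<in>{1..}. ereal \<bar>a l n\<bar>) < ereal e"
    by (auto simp: eventually_sequentially)
  have "\<bar>a l n\<bar> < e" if "l0 \<le> l" "1 \<le> n" for l n
  proof -
    have "ereal \<bar>a l n\<bar> \<le> (SUP n\<in>{1..}. ereal \<bar>a l n\<bar>)" using that(2) by (intro SUP_upper) auto
    then have "ereal \<bar>a l n\<bar> < ereal e" using l0[OF that(1)] by (rule le_less_trans)
    then show ?thesis by simp
  qed
  then show ?thesis by blast
qed

lemma powr_defect:
  fixes a :: real
  assumes "0 < e"
  shows "\<exists>d>0. \<forall>r. 0 \<le> r \<and> r < d \<longrightarrow> 1 - (1 + r) powr (- a) \<le> e"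
proof -
  have "isCont (\<lambda>r::real. (1 + r) powr (- a)) 0"
    by (intro continuous_intros) auto
  then have "((\<lambda>r::real. (1 + r) powr (- a)) \<longlongrightarrow> 1) (at 0)" by (simp add: isCont_def)
  from tendstoD[OF this assms] obtain d where d: "0 < d"
    "\<And>r. r \<noteq> 0 \<Longrightarrow> dist r 0 < d \<Longrightarrow> dist ((1 + r) powr (- a)) 1 < e"
    unfolding eventually_at by auto
  have "1 - (1 + r) powr (- a) \<le> e" if "0 \<le> r" "r < d" for r
  proof (cases "r = 0")
    case False
    then show ?thesis using d(2)[of r] that by (simp add: dist_real_def abs_less_iff)
  qed (use assms in simp)
  then show ?thesis using d(1) by blast
qed

lemma limsup_ereal_le:
  fixes x :: "nat \<Rightarrow> real"
  assumes "\<And>k. \<exists>l. \<forall>j\<ge>l. x j \<le> b k" "b \<longlonglongrightarrow> c"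
  shows "limsup (\<lambda>j. ereal (x j)) \<le> ereal c"
proof (rule LIMSEQ_le_const)
  show "(\<lambda>k. ereal (b k)) \<longlonglongrightarrow> ereal c" using assms(2) by simp
  have "limsup (\<lambda>j. ereal (x j)) \<le> ereal (b k)" for k
    using assms(1)[of k] by (intro Limsup_bounded) (auto simp: eventually_sequentially)
  then show "\<exists>N. \<forall>k\<ge>N. limsup (\<lambda>j. ereal (x j)) \<le> ereal (b k)" by blast
qed

lemma limsup_ereal_ge:
  fixes x :: "nat \<Rightarrow> real"
  assumes "\<And>k. \<forall>l. \<exists>j\<ge>l. b k < x j" "b \<longlonglongrightarrow> c"
  shows "ereal c \<le> limsup (\<lambda>j. ereal (x j))"
proof (rule LIMSEQ_le_const2)
  show "(\<lambda>k. ereal (b k)) \<longlonglongrightarrow> ereal c" using assms(2) by simp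
  have "ereal (b k) \<le> limsup (\<lambda>j. ereal (x j))" for k
  proof (rule ccontr)
    assume "\<not> ereal (b k) \<le> limsup (\<lambda>j. ereal (x j))"
    then have "\<forall>\<^sub>F j in sequentially. ereal (x j) < ereal (b k)"
      using Limsup_lessD[of sequentially "\<lambda>j. ereal (x j)" "ereal (b k)"] by simp
    then obtain l where "\<forall>j\<ge>l. x j < b k" by (auto simp: eventually_sequentially)
    then show False using assms(1)[of k] less_asym by blast
  qed
  then show "\<exists>N. \<forall>k\<ge>N. ereal (b k) \<le> limsup (\<lambda>j. ereal (x j))" by blast
qed

lemma limsup_eventually_le:
  fixes x :: "nat \<Rightarrow> real"
  assumes "limsup (\<lambda>j. ereal (x j)) < ereal c"
  shows "\<exists>l. \<forall>j\<ge>l. x j \<le> c"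
proof -
  have "\<forall>\<^sub>F j in sequentially. ereal (x j) < ereal c" by (rule Limsup_lessD[OF assms])
  then show ?thesis by (auto simp: eventually_sequentially intro: less_imp_le)
qed

lemma limsup_frequently_gt:
  fixes x :: "nat \<Rightarrow> real"
  assumes "ereal c < limsup (\<lambda>j. ereal (x j))"
  shows "\<forall>l. \<exists>j\<ge>l. c < x j"
proof (rule ccontr)
  assume "\<not> (\<forall>l. \<exists>j\<ge>l. c < x j)"
  then have "\<forall>\<^sub>F j in sequentially. ereal (x j) \<le> ereal c"
    by (auto simp: eventually_sequentially not_less)
  then have "limsup (\<lambda>j. ereal (x j)) \<le> ereal c" by (rule Limsup_bounded)
  then show False using assms by simp
qed

text \<open>In both directions the almost sure behaviour of \<open>\<eta>\<close> is expressed on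
  finite blocks, carried over to \<open>Z\<close> with an error that is at most \<open>e / 2\<close>
  for late blocks, and turned back into an almost sure statement. Constants \<open>c < 1\<close> and
  \<open>d > 0\<close> give room, and countably many of them recover the bound 1.\<close>

lemma permanental_limsup:
  fixes U :: "nat \<Rightarrow> nat \<Rightarrow> real" and f \<phi> :: "nat \<Rightarrow> real" and N :: "'a measure" and Q :: "'c measure"
  assumes m_matrix: "\<And>l n. inverse_m_matrix n (\<lambda>i j. U (l + i) (l + j)) (\<lambda>i. f (l + i))"
    and G: "centered_gaussian_sequence N U \<eta>"
    and small: "little_o_one_uniformly (\<lambda>l n. \<Sum>j<n. \<Sum>k<n. inv_entry (block U l n) j k * f (k + l))"
    and \<phi>: "\<And>j. 0 < \<phi> j"
    and sup: "AE \<omega> in N. limsup (\<lambda>j. ereal (\<eta> j \<omega> / sqrt (2 * \<phi> j))) = 1"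
    and al: "0 < \<alpha>" and Z: "permanental_sequence Q \<alpha> (\<lambda>j k. U j k + f k) Z"
  shows permanental_limsup_ge: "1 / 2 \<le> \<alpha> \<Longrightarrow> AE \<omega> in Q. 1 \<le> limsup (\<lambda>j. ereal (Z j \<omega> / \<phi> j))"
    and permanental_limsup_le: "AE \<omega> in Q. limsup (\<lambda>j. ereal (Z j \<omega> / \<phi> j)) \<le> 1"
proof -
  have Q: "prob_space Q" and Zm: "\<And>j. Z j \<in> borel_measurable Q" and Z0: "\<And>j. AE \<omega> in Q. 0 \<le> Z j \<omega>"
    using Z by (auto simp: permanental_sequence_def)
  have N: "prob_space N" using G by (simp add: centered_gaussian_sequence_def)
  interpret Q: prob_space Q by fact
  interpret N: prob_space N by fact
  have \<eta>: "\<eta> j \<in> borel_measurable N" for j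
    using centered_gaussian_gaussian[OF G] by (simp add: gaussian_variable_def)
  have sq\<phi>: "0 < sqrt (2 * \<phi> j)" for j using \<phi> by simp
  let ?\<rho> = "\<lambda>l n. inverse_m_matrix.\<rho> n (\<lambda>i j. U (l + i) (l + j)) (\<lambda>i. f (l + i))"
  have rho: "?\<rho> l n = (\<Sum>j<n. \<Sum>k<n. inv_entry (block U l n) j k * f (k + l))" for l n
    by (simp only: inverse_m_matrix.\<rho>_def[OF m_matrix] inverse_m_matrix.A_def[OF m_matrix] block_def add.commute[of _ l])
  have defect: "\<exists>l0. \<forall>l\<ge>l0. \<forall>n\<ge>1. 1 - (1 + ?\<rho> l n) powr (- \<alpha>) \<le> e" if e: "0 < e" for e
  proof -
    obtain d where d: "0 < d" "\<And>r. 0 \<le> r \<Longrightarrow> r < d \<Longrightarrow> 1 - (1 + r) powr (- \<alpha>) \<le> e"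
      using powr_defect[OF e, of \<alpha>] by blast
    obtain l0 where "\<And>l n. l0 \<le> l \<Longrightarrow> 1 \<le> n \<Longrightarrow> \<bar>?\<rho> l n\<bar> < d"
      using little_o_one_uniformlyD[OF small d(1)] unfolding rho by blast
    then have "1 - (1 + ?\<rho> l n) powr (- \<alpha>) \<le> e" if "l0 \<le> l" "1 \<le> n" for l n
      using that inverse_m_matrix.rho_nonneg[OF m_matrix, of n l] by (intro d(2)) (auto simp: abs_less_iff)
    then show ?thesis by blast
  qed
  have E: "(\<integral>\<omega>. exp (- (\<Sum>i<n. s i * Z (l + i) \<omega>)) \<partial>Q) =
      inverse_m_matrix.DK n (\<lambda>i j. U (l + i) (l + j)) (\<lambda>i. f (l + i)) s powr (- \<alpha>)" if "\<forall>i. 0 < s i" for s l n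
    using permanental_laplace[OF Z that, where l = l and n = n]
    by (simp add: inverse_m_matrix.DK_def[OF m_matrix] inverse_m_matrix.K_def[OF m_matrix])
  note Gl = centered_gaussian_shift[OF G]
  show "AE \<omega> in Q. 1 \<le> limsup (\<lambda>j. ereal (Z j \<omega> / \<phi> j))" if half: "1 / 2 \<le> \<alpha>"
  proof -
    have freq: "AE \<omega> in Q. \<forall>l. \<exists>j\<ge>l. c * \<phi> j < Z j \<omega>" if c: "0 < c" "c < 1" for c
    proof (rule AE_frequently_from_blocks[OF Q Zm])
      fix e :: real assume e: "0 < e"
      have G_freq: "AE \<omega> in N. \<forall>l. \<exists>j\<ge>l. c * \<phi> j < (\<eta> j \<omega>)\<^sup>2 / 2"
        using sup
      proof eventually_elim
        case (elim \<omega>)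
        have "sqrt c < 1" using c by simp
        then have "ereal (sqrt c) < limsup (\<lambda>j. ereal (\<eta> j \<omega> / sqrt (2 * \<phi> j)))" using elim by simp
        then have fr: "\<forall>l. \<exists>j\<ge>l. sqrt c < \<eta> j \<omega> / sqrt (2 * \<phi> j)" by (rule limsup_frequently_gt)
        have "c * \<phi> j < (\<eta> j \<omega>)\<^sup>2 / 2" if "sqrt c < \<eta> j \<omega> / sqrt (2 * \<phi> j)" for j
        proof -
          have "sqrt c * sqrt (2 * \<phi> j) < \<eta> j \<omega>" using that by (simp only: pos_less_divide_eq[OF sq\<phi>])
          moreover have "0 \<le> sqrt c * sqrt (2 * \<phi> j)" using c \<phi>[of j] by simp
          ultimately have "(sqrt c * sqrt (2 * \<phi> j))\<^sup>2 < (\<eta> j \<omega>)\<^sup>2" by (rule power_strict_mono) simp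
          then show ?thesis using c \<phi>[of j] by (simp add: power_mult_distrib)
        qed
        then show ?case using fr by blast
      qed
      have Ym: "(\<lambda>\<omega>. (\<eta> j \<omega>)\<^sup>2 / 2) \<in> borel_measurable N" for j using \<eta> by measurable
      have "0 < e / 2" using e by simp
      from defect[OF this] obtain l0 where
        l0: "\<And>l n. l0 \<le> l \<Longrightarrow> 1 \<le> n \<Longrightarrow> 1 - (1 + ?\<rho> l n) powr (- \<alpha>) \<le> e / 2" by blast
      have "\<exists>n. measure Q {\<omega> \<in> space Q. \<forall>j<n. Z (l + j) \<omega> \<le> c * \<phi> (l + j)} \<le> e" if l: "l0 \<le> l" for l
      proof -
        obtain n where n: "1 \<le> n" "measure N {\<omega> \<in> space N. \<forall>j<n. (\<eta> (l + j) \<omega>)\<^sup>2 / 2 \<le> c * \<phi> (l + j)} \<le> e / 2"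
          using blocks_from_AE_frequently[OF N Ym G_freq \<open>0 < e / 2\<close>, of l] by blast
        have "measure Q {\<omega> \<in> space Q. \<forall>j<n. Z (l + j) \<omega> \<le> c * \<phi> (l + j)} \<le>
            measure N {\<omega> \<in> space N. \<forall>j<n. (\<eta> (l + j) \<omega>)\<^sup>2 / 2 \<le> c * \<phi> (l + j)} + (1 - (1 + ?\<rho> l n) powr (- \<alpha>))"
          by (rule inverse_m_matrix.gaussian_lower[OF m_matrix Q Zm Z0 half E _ Gl])
             (use c \<phi> in \<open>auto simp: less_imp_le\<close>)
        then show ?thesis using n l0[OF l n(1)] by (intro exI[of _ n]) linarith
      qed
      then show "\<exists>l0. \<forall>l\<ge>l0. \<exists>n. measure Q {\<omega> \<in> space Q. \<forall>j<n. Z (l + j) \<omega> \<le> c * \<phi> (l + j)} \<le> e" by blast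
    qed
    \<comment> \<open>The shift by 2 makes \<open>b 0 = 1 / 2\<close>, so that all
      \<open>b k\<close> are positive, as \<open>freq\<close> requires.\<close>
    define b where "b k = 1 - 1 / real (Suc (Suc k))" for k
    have b: "0 < b k" "b k < 1" for k by (auto simp: b_def)
    have b_lim: "b \<longlonglongrightarrow> 1"
      unfolding b_def using tendsto_diff[OF tendsto_const[of 1] LIMSEQ_Suc[OF LIMSEQ_Suc[OF lim_1_over_n]]] by simp
    have "AE \<omega> in Q. \<forall>k. \<forall>l. \<exists>j\<ge>l. b k * \<phi> j < Z j \<omega>"
      by (rule AE_all_countable[THEN iffD2], rule allI, rule freq[OF b])
    then show ?thesis
    proof eventually_elim
      case (elim \<omega>)
      then have "\<forall>l. \<exists>j\<ge>l. b k < Z j \<omega> / \<phi> j" for k by (simp add: pos_less_divide_eq[OF \<phi>])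
      from limsup_ereal_ge[OF this b_lim] show ?case by (simp add: one_ereal_def)
    qed
  qed
  show "AE \<omega> in Q. limsup (\<lambda>j. ereal (Z j \<omega> / \<phi> j)) \<le> 1"
  proof -
    obtain m :: nat where "2 * \<alpha> < real m" using reals_Archimedean2 by blast
    then have m: "\<alpha> \<le> real m / 2" by simp
    \<comment> \<open>One factor \<open>1 + d\<close> comes from the limsup of \<open>\<eta>\<close>
      and one from the net; both are squared in passing from \<open>\<eta>\<close> to
      \<open>\<eta>\<^sup>2\<close>, whence the fourth power.\<close>
    have evt: "AE \<omega> in Q. \<exists>l. \<forall>j\<ge>l. Z j \<omega> \<le> (1 + d) ^ 4 * \<phi> j" if d: "0 < d" for d
    proof (rule AE_eventually_from_tails[OF Q Zm])
      fix e :: real assume e: "0 < e"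
      obtain B where B: "0 \<le> B" and tail: "\<And>C \<eta> n c. centered_gaussian_sequence N C \<eta> \<Longrightarrow> (\<And>j. j < n \<Longrightarrow> 0 < c j) \<Longrightarrow>
          measure (\<Pi>\<^sub>M i\<in>{..<m}. N) {\<omega> \<in> space (\<Pi>\<^sub>M i\<in>{..<m}. N).
            \<not> (\<forall>j<n. (\<Sum>i<m. (\<eta> j (\<omega> i))\<^sup>2) \<le> ((1 + d) * c j)\<^sup>2)}
          \<le> B * measure N {\<omega> \<in> space N. \<not> (\<forall>j<n. \<eta> j \<omega> \<le> c j)}"
        using copies_tail[OF N d, of m] by blast
      define c where "c j = (1 + d) * sqrt (2 * \<phi> j)" for j
      have c: "0 < c j" for j using d sq\<phi>[of j] by (simp add: c_def)
      have le_c: "AE \<omega> in N. \<exists>l. \<forall>j\<ge>l. \<eta> j \<omega> \<le> c j"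
        using sup
      proof eventually_elim
        case (elim \<omega>)
        then have "limsup (\<lambda>j. ereal (\<eta> j \<omega> / sqrt (2 * \<phi> j))) < ereal (1 + d)" using d by (simp add: one_ereal_def)
        then have "\<exists>l. \<forall>j\<ge>l. \<eta> j \<omega> / sqrt (2 * \<phi> j) \<le> 1 + d" by (rule limsup_eventually_le)
        then show ?case by (simp only: pos_divide_le_eq[OF sq\<phi>] c_def)
      qed
      \<comment> \<open>The denominator has \<open>B + 1\<close> because \<open>B\<close> may be 0;
        the Gaussian part is still at most \<open>e / 2\<close>.\<close>
      have e': "0 < e / (2 * (B + 1))" using e B by simp
      from tails_from_AE_eventually[where X = \<eta> and c = c, OF N \<eta> le_c e'] obtain l1 where
        l1: "\<And>l n. l1 \<le> l \<Longrightarrow> measure N {\<omega> \<in> space N. \<not> (\<forall>j<n. \<eta> (l + j) \<omega> \<le> c (l + j))} \<le> e / (2 * (B + 1))"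
        by blast
      have "0 < e / 2" using e by simp
      from defect[OF this] obtain l0 where
        l0: "\<And>l n. l0 \<le> l \<Longrightarrow> 1 \<le> n \<Longrightarrow> 1 - (1 + ?\<rho> l n) powr (- \<alpha>) \<le> e / 2" by blast
      define l where "l = max l0 l1"
      have "measure Q {\<omega> \<in> space Q. \<not> (\<forall>j<n. Z (l + j) \<omega> \<le> (1 + d) ^ 4 * \<phi> (l + j))} \<le> e" if n: "1 \<le> n" for n
      proof -
        let ?W = "\<Pi>\<^sub>M i\<in>{..<m}. N"
        have sq: "(\<Sum>i<m. x i / 2) \<le> (1 + d) ^ 4 * \<phi> j \<longleftrightarrow> (\<Sum>i<m. x i) \<le> ((1 + d) * c j)\<^sup>2" for x :: "nat \<Rightarrow> real" and j
        proof -
          have "((1 + d) * c j)\<^sup>2 = (1 + d) ^ 4 * (2 * \<phi> j)"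
            using \<phi>[of j] by (simp add: c_def power_mult_distrib power2_eq_square[of "1 + d"] power4_eq_xxxx mult_ac)
          then show ?thesis by (simp add: sum_divide_distrib[symmetric] mult_ac)
        qed
        have "measure Q {\<omega> \<in> space Q. \<not> (\<forall>j<n. Z (l + j) \<omega> \<le> (1 + d) ^ 4 * \<phi> (l + j))} \<le>
            measure ?W {\<omega> \<in> space ?W. \<not> (\<forall>j<n. (\<Sum>i<m. (\<eta> (l + j) (\<omega> i))\<^sup>2 / 2) \<le> (1 + d) ^ 4 * \<phi> (l + j))} +
            (1 - (1 + ?\<rho> l n) powr (- \<alpha>))"
          by (rule inverse_m_matrix.gaussian_upper[OF m_matrix Q Zm Z0 al m E _ Gl])
             (use d \<phi> in \<open>auto simp: less_imp_le\<close>)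
        also have "\<dots> \<le> B * measure N {\<omega> \<in> space N. \<not> (\<forall>j<n. \<eta> (l + j) \<omega> \<le> c (l + j))} + e / 2"
          unfolding sq using tail[OF Gl[of l], of n "\<lambda>j. c (l + j)"] c l0[of l n] n
          by (intro add_mono) (auto simp: l_def)
        also have "\<dots> \<le> B * (e / (2 * (B + 1))) + e / 2"
          using l1[of l n] B by (intro add_mono mult_left_mono) (auto simp: l_def)
        also have "\<dots> \<le> e" using B e by (simp add: field_simps)
        finally show ?thesis .
      qed
      then show "\<exists>l. \<forall>n\<ge>1. measure Q {\<omega> \<in> space Q. \<not> (\<forall>j<n. Z (l + j) \<omega> \<le> (1 + d) ^ 4 * \<phi> (l + j))} \<le> e" by blast
    qed
    define b where "b k = (1 + 1 / real (Suc k)) ^ 4" for k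
    have b_lim: "b \<longlonglongrightarrow> 1"
      unfolding b_def using tendsto_power[OF tendsto_add[OF tendsto_const[of 1] LIMSEQ_Suc[OF lim_1_over_n]], of 4] by simp
    have "AE \<omega> in Q. \<forall>k. \<exists>l. \<forall>j\<ge>l. Z j \<omega> \<le> b k * \<phi> j"
      unfolding b_def by (rule AE_all_countable[THEN iffD2], rule allI, rule evt) simp
    then show ?thesis
    proof eventually_elim
      case (elim \<omega>)
      then have "\<exists>l. \<forall>j\<ge>l. Z j \<omega> / \<phi> j \<le> b k" for k by (simp add: pos_divide_le_eq[OF \<phi>])
      from limsup_ereal_le[OF this b_lim] show ?case by (simp add: one_ereal_def)
    qed
  qed
qed

theorem theorem1p2:
  fixes \<Omega> :: "'w set" and F :: "ennreal \<Rightarrow> 'w measure" and P :: "nat \<Rightarrow> 'w measure"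
    and X :: "real \<Rightarrow> 'w \<Rightarrow> nat option"
    and U :: "nat \<Rightarrow> nat \<Rightarrow> real" and f :: "nat \<Rightarrow> real"
    and N :: "'a measure" and \<eta> :: "nat \<Rightarrow> 'a \<Rightarrow> real" and \<phi> :: "nat \<Rightarrow> real"
  defines "U \<equiv> potential_density P X"
  assumes "borel_right_process \<Omega> F P X"
    and "symmetric_process P X"
    and "transient_process P X"
    and "\<forall>j k. 0 < U j k"
    and "\<forall>k. 0 \<le> f k"
    and "excessive P X (\<lambda>k. ennreal (f k))"
  shows
    "(\<forall>l n. 1 \<le> n \<longrightarrow> (\<forall>j<n. 0 \<le> (\<Sum>k<n. inv_entry (block U l n) j k * f (k + l)))) \<and>
     (centered_gaussian_sequence N U \<eta> \<and>
      little_o_one_uniformly (\<lambda>l n. \<Sum>j<n. \<Sum>k<n. inv_entry (block U l n) j k * f (k + l)) \<and>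
      (\<forall>j. 0 < \<phi> j) \<and>
      (AE \<omega> in N. limsup (\<lambda>j. ereal (\<eta> j \<omega> / sqrt (2 * \<phi> j))) = 1) \<and>
      f \<in> o(\<phi>) \<longrightarrow>
      (\<forall>(\<alpha>::real) (Q :: 'c measure) Z.
         0 < \<alpha> \<and> permanental_sequence Q \<alpha> (\<lambda>j k. U j k + f k) Z \<longrightarrow>
         (1 / 2 \<le> \<alpha> \<longrightarrow> (AE \<omega> in Q. limsup (\<lambda>j. ereal (Z j \<omega> / \<phi> j)) = 1)) \<and>
         (AE \<omega> in Q. limsup (\<lambda>j. ereal (Z j \<omega> / \<phi> j)) \<le> 1)))"
proof -
  interpret borel_right_process \<Omega> F P X by fact
  have block: "block U l n = fmat n (\<lambda>i j. U (l + i) (l + j))" for l n by (simp add: block_def)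
  have pos: "0 \<le> (\<Sum>k<n. inv_entry (block U l n) j k * f (l + k))" if "j < n" for l n j
    unfolding U_def
    by (rule inverse_potential_excessive[OF assms(4,3) _ _ that, where v = f])
       (use assms(6) excessiveD[OF assms(7)] in auto)
  have m_matrix: "inverse_m_matrix n (\<lambda>i j. U (l + i) (l + j)) (\<lambda>i. f (l + i))" for l n
  proof
    show "posdef n (\<lambda>i j. U (l + i) (l + j))"
      unfolding U_def by (rule posdef_potential[OF assms(4,3)])
    show "inv_entry (fmat n (\<lambda>i j. U (l + i) (l + j))) i j \<le> 0" if "i < n" "j < n" "i \<noteq> j" for i j
      unfolding block[symmetric] unfolding U_def by (rule inverse_potential_offdiag[OF assms(4,3) that])
    \<comment> \<open>The constant 1 serves as \<open>v\<close>: what is asked of \<open>v\<close>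
      is \<open>P_t v \<le> v\<close>, and transition probabilities sum to at most 1.\<close>
    show "0 \<le> (\<Sum>k<n. inv_entry (fmat n (\<lambda>i j. U (l + i) (l + j))) i k)" if "i < n" for i
      unfolding block[symmetric] unfolding U_def
      using inverse_potential_excessive[OF assms(4,3) _ _ that, where v = "\<lambda>_. 1"] excessive_one by simp
    show "0 \<le> (\<Sum>k<n. inv_entry (fmat n (\<lambda>i j. U (l + i) (l + j))) i k * f (l + k))" if "i < n" for i
      unfolding block[symmetric] by (rule pos[OF that])
  qed
  show ?thesis
  proof (intro conjI impI allI)
    show "0 \<le> (\<Sum>k<n. inv_entry (block U l n) j k * f (k + l))" if "j < n" for l n j
      using pos[OF that, of l] by (simp only: add.commute[of _ l])
  next
    fix \<alpha> :: real and Q :: "'c measure" and Z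
    assume H: "centered_gaussian_sequence N U \<eta> \<and>
      little_o_one_uniformly (\<lambda>l n. \<Sum>j<n. \<Sum>k<n. inv_entry (block U l n) j k * f (k + l)) \<and>
      (\<forall>j. 0 < \<phi> j) \<and>
      (AE \<omega> in N. limsup (\<lambda>j. ereal (\<eta> j \<omega> / sqrt (2 * \<phi> j))) = 1) \<and> f \<in> o(\<phi>)"
      and Z: "0 < \<alpha> \<and> permanental_sequence Q \<alpha> (\<lambda>j k. U j k + f k) Z"
    have \<phi>: "0 < \<phi> j" for j using H by blast
    note H' = conjunct1[OF H] conjunct1[OF conjunct2[OF H]]
      conjunct1[OF conjunct2[OF conjunct2[OF conjunct2[OF H]]]]
    have le: "AE \<omega> in Q. limsup (\<lambda>j. ereal (Z j \<omega> / \<phi> j)) \<le> 1"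
      by (rule permanental_limsup_le[OF m_matrix H'(1,2) \<phi> H'(3) conjunct1[OF Z] conjunct2[OF Z]])
    then show "AE \<omega> in Q. limsup (\<lambda>j. ereal (Z j \<omega> / \<phi> j)) \<le> 1" .
    show "AE \<omega> in Q. limsup (\<lambda>j. ereal (Z j \<omega> / \<phi> j)) = 1" if "1 / 2 \<le> \<alpha>"
      using le permanental_limsup_ge[OF m_matrix H'(1,2) \<phi> H'(3) conjunct1[OF Z] conjunct2[OF Z] that]
      by eventually_elim (rule antisym)
  qed
qed

end
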